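(* Let $K$ be a complete, algebraically closed nonarchimedean valued field and let $\varphi(z)\in K(z)$ have degree $d\ge1$. Then $$\mathrm{Lip}_{\mathrm{Berk}}(\varphi)\le\max\Big(\frac{1}{\mathrm{GIR}(\varphi)\cdot B_0(\varphi)^d},\ \frac{d}{\mathrm{GIR}(\varphi)^{1/d}\cdot B_0(\varphi)}\Big).$$
   Context: $K$ is a complete, algebraically closed field with a nontrivial nonarchimedean absolute value $|\cdot|$; $\mathcal O=\{z\in K:|z|\le 1\}$. Fix $q>1$ and write $\log=\log_q$. $\mathbf P^1_{\mathrm{Berk}}$ is the Berkovich projective line over $K$: a uniquely path-connected tree containing $\mathbf P^1(K)=K\cup\{\infty\}$; for $a\in K$, $r>0$, $\zeta_{a,r}$ is the point corresponding to the disc $D(a,r)=\{z:|z-a|\le r\}$, $\zeta_{a,0}=a$, $\zeta_G=\zeta_{0,1}$ is the Gauss point; $[x,y]$ is the unique path, $(x,y]$ etc. the half-open paths. On $\mathbf H^1=\mathbf P^1_{\mathrm{Berk}}\setminus\mathbf P^1(K)$ the logarithmic path metric $\rho$ gives the path $\{\zeta_{a,r}:R_1\le r\le R_2\}$ length $\log(R_2/R_1)$. $\mathrm{diam}_G(x)=q^{-\rho(\zeta_G,x)}$ for $x\in\mathbf H^1$, $0$ for $x\in\mathbf P^1(K)$; explicitly $\mathrm{diam}_G(\zeta_{a,r})=r/\max(1,|a|,r)^2$. $x\vee_G y$ is the first point where $[x,\zeta_G]$ and $[y,\zeta_G]$ meet; $d(x,y)=2\,\mathrm{diam}_G(x\vee_G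 y)-\mathrm{diam}_G(x)-\mathrm{diam}_G(y)$. A nonconstant $\varphi\in K(z)$ acts continuously on $\mathbf P^1_{\mathrm{Berk}}$; $\mathrm{Lip}_{\mathrm{Berk}}(\varphi)=\sup_{x\ne y} d(\varphi(x),\varphi(y))/d(x,y)$. Gauss Image radius: $\mathrm{GIR}(\varphi)=\mathrm{diam}_G(\varphi(\zeta_G))$. For $a\in\mathbf P^1(K)$ and $0<r<1$ let $Q_{a,r}$ be the unique point of $[a,\zeta_G]$ with $\mathrm{diam}_G(Q_{a,r})=r$, and $\mathcal B(a,r)^-=\{x\in\mathbf P^1_{\mathrm{Berk}}:Q_{a,r}\in(x,\zeta_G]\}$; $\mathcal B(a,1)^-=\bigcup_{r<1}\mathcal B(a,r)^-$. Ball-Mapping radius: $B_0(\varphi)=\sup\{0<r\le1:\ \varphi(\mathcal B(a,r)^-)\ne\mathbf P^1_{\mathrm{Berk}}\text{ for all }a\in\mathbf P^1(K)\}$. *)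

theory Defs
  imports Complex_Main "HOL-Computational_Algebra.Polynomial" "HOL-Computational_Algebra.Polynomial_Factorial"
    "HOL-Library.Extended_Real"
begin

definition nonarch_abs :: "('a::field \<Rightarrow> real) \<Rightarrow> bool" where
  "nonarch_abs absK \<longleftrightarrow>
     (\<forall>x. absK x \<ge> 0) \<and> (\<forall>x. absK x = 0 \<longleftrightarrow> x = 0) \<and>
     (\<forall>x y. absK (x * y) = absK x * absK y) \<and>
     (\<forall>x y. absK (x + y) \<le> max (absK x) (absK y))"

definition abs_complete :: "('a::field \<Rightarrow> real) \<Rightarrow> bool" where
  "abs_complete absK \<longleftrightarrow>
     (\<forall>X::nat \<Rightarrow> 'a. (\<forall>e>0. \<exists>N. \<forall>m\<ge>N. \<forall>n\<ge>N. absK (X m - X n) < e) \<longrightarrow>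
        (\<exists>L. \<forall>e>0. \<exists>N. \<forall>n\<ge>N. absK (X n - L) < e))"

definition alg_closed :: "'a::field itself \<Rightarrow> bool" where
  "alg_closed _ \<longleftrightarrow> (\<forall>p::'a poly. degree p \<ge> 1 \<longrightarrow> (\<exists>z. poly p z = 0))"

definition abs_nontrivial :: "('a::field \<Rightarrow> real) \<Rightarrow> bool" where
  "abs_nontrivial absK \<longleftrightarrow> (\<exists>z. absK z \<noteq> 0 \<and> absK z \<noteq> 1)"

definition nonarch_acf :: "('a::field \<Rightarrow> real) \<Rightarrow> bool" where
  "nonarch_acf absK \<longleftrightarrow> nonarch_abs absK \<and> abs_complete absK \<and>
     alg_closed TYPE('a) \<and> abs_nontrivial absK"

text \<open>A point of the Berkovich affine line is a multiplicative seminorm on K[T]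
  extending the absolute value of K; the projective line adds the point infinity.\<close>

datatype 's berkpt = BAff 's | BInf

type_synonym 'a berk = "('a poly \<Rightarrow> real) berkpt"

definition is_mseminorm :: "('a::field \<Rightarrow> real) \<Rightarrow> ('a poly \<Rightarrow> real) \<Rightarrow> bool" where
  "is_mseminorm absK s \<longleftrightarrow>
     (\<forall>f. s f \<ge> 0) \<and> (\<forall>c. s [:c:] = absK c) \<and>
     (\<forall>f g. s (f * g) = s f * s g) \<and> (\<forall>f g. s (f + g) \<le> s f + s g)"

definition P1Berk :: "('a::field \<Rightarrow> real) \<Rightarrow> 'a berk set" where
  "P1Berk absK = insert BInf {BAff s | s. is_mseminorm absK s}"

definition typeI :: "('a::field \<Rightarrow> real) \<Rightarrow> 'a \<Rightarrow> 'a berk" where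
  "typeI absK a = BAff (\<lambda>f. absK (poly f a))"

definition P1K :: "('a::field \<Rightarrow> real) \<Rightarrow> 'a berk set" where
  "P1K absK = insert BInf (range (typeI absK))"

definition gauss :: "('a::field \<Rightarrow> real) \<Rightarrow> 'a berk" where
  "gauss absK = BAff (\<lambda>f. Max ((\<lambda>i. absK (coeff f i)) ` {..degree f}))"

text \<open>Berkovich's partial order (tree order rooted at infinity) and the unique paths [x,y].\<close>
definition berk_le :: "'a::zero berk \<Rightarrow> 'a berk \<Rightarrow> bool" where
  "berk_le x y \<longleftrightarrow> y = BInf \<or> (\<exists>s t. x = BAff s \<and> y = BAff t \<and> (\<forall>f. s f \<le> t f))"

definition berk_path :: "('a::field \<Rightarrow> real) \<Rightarrow> 'a berk \<Rightarrow> 'a berk \<Rightarrow> 'a berk set" where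
  "berk_path absK x y = {z \<in> P1Berk absK. (berk_le x z \<or> berk_le y z) \<and>
      (\<forall>w \<in> P1Berk absK. berk_le x w \<and> berk_le y w \<longrightarrow> berk_le z w)}"

definition join_G :: "('a::field \<Rightarrow> real) \<Rightarrow> 'a berk \<Rightarrow> 'a berk \<Rightarrow> 'a berk" where
  "join_G absK x y = (THE z. z \<in> berk_path absK x (gauss absK) \<inter> berk_path absK y (gauss absK) \<and>
      (\<forall>w \<in> berk_path absK x z. w \<in> berk_path absK y (gauss absK) \<longrightarrow> w = z))"

text \<open>diam_G: for zeta_{a,r} this is r / max(1,|a|,r)^2; in general
  (inf_a [T-a]_x) / max(1,[T]_x)^2, and 0 at infinity.\<close>
definition diam_G :: "'a::field berk \<Rightarrow> real" where
  "diam_G x = (case x of BInf \<Rightarrow> 0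
      | BAff s \<Rightarrow> (INF a. s [:-a, 1:]) / (max 1 (s [:0, 1:]))\<^sup>2)"

definition berk_d :: "('a::field \<Rightarrow> real) \<Rightarrow> 'a berk \<Rightarrow> 'a berk \<Rightarrow> real" where
  "berk_d absK x y = 2 * diam_G (join_G absK x y) - diam_G x - diam_G y"

section \<open>Action of a rational function phi = P/Q (coprime, Q \<noteq> 0)\<close>

text \<open>hcomp f P Q = Q^(deg f) * f(P/Q), a polynomial.\<close>
definition hcomp :: "'a::field poly \<Rightarrow> 'a poly \<Rightarrow> 'a poly \<Rightarrow> 'a poly" where
  "hcomp f P Q = (\<Sum>i\<le>degree f. smult (coeff f i) (P ^ i * Q ^ (degree f - i)))"

definition berk_map :: "('a::field \<Rightarrow> real) \<Rightarrow> 'a poly \<Rightarrow> 'a poly \<Rightarrow> 'a berk \<Rightarrow> 'a berk" where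
  "berk_map absK P Q x = (case x of
       BInf \<Rightarrow> (if degree P > degree Q then BInf
               else typeI absK (if degree P = degree Q then lead_coeff P / lead_coeff Q else 0))
     | BAff s \<Rightarrow> (if s Q = 0 then BInf
               else BAff (\<lambda>f. s (hcomp f P Q) / s Q ^ degree f)))"

definition Lip_Berk :: "('a::field \<Rightarrow> real) \<Rightarrow> 'a poly \<Rightarrow> 'a poly \<Rightarrow> ereal" where
  "Lip_Berk absK P Q = (SUP xy \<in> {(x, y). x \<in> P1Berk absK \<and> y \<in> P1Berk absK \<and> x \<noteq> y}.
       ereal (berk_d absK (berk_map absK P Q (fst xy)) (berk_map absK P Q (snd xy))
              / berk_d absK (fst xy) (snd xy)))"

definition GIR :: "('a::field \<Rightarrow> real) \<Rightarrow> 'a poly \<Rightarrow> 'a poly \<Rightarrow> real" where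
  "GIR absK P Q = diam_G (berk_map absK P Q (gauss absK))"

definition Q_pt :: "('a::field \<Rightarrow> real) \<Rightarrow> 'a berk \<Rightarrow> real \<Rightarrow> 'a berk" where
  "Q_pt absK a r = (THE z. z \<in> berk_path absK a (gauss absK) \<and> diam_G z = r)"

definition ball_minus_lt1 :: "('a::field \<Rightarrow> real) \<Rightarrow> 'a berk \<Rightarrow> real \<Rightarrow> 'a berk set" where
  "ball_minus_lt1 absK a r =
     {x \<in> P1Berk absK. Q_pt absK a r \<in> berk_path absK x (gauss absK) - {x}}"

definition ball_minus :: "('a::field \<Rightarrow> real) \<Rightarrow> 'a berk \<Rightarrow> real \<Rightarrow> 'a berk set" where
  "ball_minus absK a r = (if r < 1 then ball_minus_lt1 absK a r
      else (\<Union>r'\<in>{0<..<1}. ball_minus_lt1 absK a r'))"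

definition B0 :: "('a::field \<Rightarrow> real) \<Rightarrow> 'a poly \<Rightarrow> 'a poly \<Rightarrow> real" where
  "B0 absK P Q = Sup {r. 0 < r \<and> r \<le> 1 \<and>
      (\<forall>a \<in> P1K absK. berk_map absK P Q ` ball_minus absK a r \<noteq> P1Berk absK)}"

end

theory Submission
  imports Defs "HOL-Analysis.Analysis"
begin

text \<open>
  A point \<open>x\<close> of the Berkovich line is determined by its kernel \<open>c \<mapsto> diam_G (join_G x c)\<close> on \<open>P1(K)\<close>,
  and the kernels that occur are exactly the functions satisfying the ultrametric inequalities against
  the chordal distance. Pointwise comparison of kernels is the tree order rooted at the Gauss point, the
  kernel of a join is a pointwise maximum, and \<open>diam_G\<close> is the infimum of the kernel.

  Normalise \<open>H x = max [P]_x [Q]_x\<close> to be 1 at the Gauss point. Factoring \<open>P - c Q\<close> over \<open>K\<close>, the kernel of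
  \<open>phi x\<close> at \<open>c\<close> is \<open>||P - c Q||\<close> times the product of the kernel of \<open>x\<close> over the \<open>d\<close> preimages of \<open>c\<close>,
  divided by \<open>H x\<close>. Hence along a path towards the Gauss point, with parameter \<open>t = diam_G\<close>, the image
  moves with \<open>diam_G (phi x) = y = K t^n\<close> locally, where \<open>n\<close> is a difference of two numbers of preimages, so that
  \<open>1 \<le> m = |n| \<le> d\<close>, and the Lipschitz constant is the supremum of \<open>m y / t\<close>.

  If \<open>t \<ge> B0\<close> this is at most \<open>d / B0\<close>. If \<open>t < B0\<close>, some value \<open>e\<close> is omitted by a ball of radius
  arbitrarily close to \<open>B0\<close> around \<open>x\<close>, and the product formula for \<open>e\<close> gives \<open>H x \<ge> GIR B0^d\<close>. One of the
  two numbers of preimages is at least \<open>m\<close>, so the product formula also gives \<open>(y/t)^m \<le> 1 / (GIR B0^d)\<close>.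
  Finally \<open>m (GIR B0^d)^(-1/m)\<close> is largest at \<open>m = 1\<close> or \<open>m = d\<close>.
\<close>

text \<open>Discs do not describe every point unless K is spherically complete, so nothing rests on
  centres and radii: the kernel treats all types of points, and infinity, alike. Slopes are taken as
  germs to the right of a parameter. A product of factors \<open>max (k a) t\<close> is a single
  monomial just above every \<tau>, break points included, so the break points of a path need never
  be listed. The delicate point is that the exponent is not 0. For a badly chosen value c the kernel
  of the image at c stays constant and says nothing about the motion; some c must see a different
  number of preimages than \<open>H\<close> does, since otherwise the map would look constant along
  the path. A nonzero exponent also makes y strictly monotone, which forces c to minimise the kernel
  of the image, so that y is its diameter. Positivity of GIR is a consequence as well. The point
  omitted by a ball need not lie in P1(K), while the product formula speaks of P1(K) only. The
  argument therefore runs backwards: a ball containing preimages of all of P1(K) covers, by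
  compactness, the whole line.\<close>

section \<open>Products of numbers in the unit interval, roots, and compactness of cubes\<close>

lemma le_if_power_le_linear:
  fixes u M :: real
  assumes "0 \<le> u" "0 \<le> M" and le: "\<And>n. u ^ n \<le> real (Suc n) * M ^ n"
  shows "u \<le> M"
proof (rule ccontr)
  assume "\<not> u \<le> M"
  then have "M < u" by simp
  define q where "q = M / u"
  have q: "0 \<le> q" "q < 1" using \<open>M < u\<close> assms by (auto simp: q_def)
  have "1 \<le> real (Suc n) * q ^ n" for n
    using le[of n] \<open>M < u\<close> assms by (simp add: q_def power_divide field_simps)
  moreover have "(\<lambda>n. real (Suc n) * q ^ n) \<longlonglongrightarrow> 0"
  proof -
    have "(\<lambda>n. real n * q ^ n + q ^ n) \<longlonglongrightarrow> 0 + 0"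
      using q by (intro tendsto_add powser_times_n_limit_0 LIMSEQ_realpow_zero) auto
    then show ?thesis by (simp add: algebra_simps)
  qed
  ultimately have "1 \<le> (0::real)"
    by (meson LIMSEQ_le_const)
  then show False by simp
qed

lemma prod_list_map_mono:
  fixes f g :: "'b \<Rightarrow> real"
  assumes "\<And>x. x \<in> set xs \<Longrightarrow> 0 \<le> f x \<and> f x \<le> g x"
  shows "0 \<le> prod_list (map f xs) \<and> prod_list (map f xs) \<le> prod_list (map g xs)"
  using assms
proof (induction xs)
  case (Cons a xs)
  then have "0 \<le> prod_list (map f xs)" "prod_list (map f xs) \<le> prod_list (map g xs)" "0 \<le> f a" "f a \<le> g a"
    by auto
  then show ?case using mult_mono[of "f a" "g a" "prod_list (map f xs)" "prod_list (map g xs)"] by simp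
qed simp

lemma prod_list_map_le_one:
  fixes f :: "'b \<Rightarrow> real"
  assumes "\<And>x. 0 \<le> f x \<and> f x \<le> 1"
  shows "prod_list (map f xs) \<le> 1"
  using prod_list_map_mono[of xs f "\<lambda>_. 1"] assms by (simp add: map_replicate_const)

lemma prod_list_map_const_le_power:
  fixes f :: "'b \<Rightarrow> real"
  assumes "\<And>x. x \<in> set xs \<Longrightarrow> r \<le> f x" "0 \<le> r"
  shows "r ^ length xs \<le> prod_list (map f xs)"
  using prod_list_map_mono[of xs "\<lambda>_. r" f] assms by (simp add: map_replicate_const)

lemma tendsto_prod_list_map:
  fixes f :: "'i \<Rightarrow> 'b \<Rightarrow> real"
  assumes "\<And>x. ((\<lambda>i. f i x) \<longlongrightarrow> g x) F"
  shows "((\<lambda>i. prod_list (map (f i) xs)) \<longlongrightarrow> prod_list (map g xs)) F"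
  using assms by (induction xs) (auto intro!: tendsto_mult)

lemma poly_factor_root:
  fixes f :: "'a::field poly"
  assumes "poly f r = 0" "f \<noteq> 0"
  obtains g where "f = [:-r, 1:] * g" "g \<noteq> 0" "degree f = Suc (degree g)"
proof -
  obtain g where g: "f = [:-r, 1:] * g"
    using assms(1) by (auto simp: poly_eq_0_iff_dvd)
  then have "g \<noteq> 0" using assms by auto
  moreover have "degree f = Suc (degree g)"
    unfolding g by (subst degree_mult_eq) (use \<open>g \<noteq> 0\<close> in auto)
  ultimately show ?thesis using g that by blast
qed

lemma prod_list_map_le_elem:
  fixes f :: "'b \<Rightarrow> real"
  assumes "\<And>x. 0 \<le> f x \<and> f x \<le> 1" "a \<in> set xs"
  shows "prod_list (map f xs) \<le> f a"
  using assms(2)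
proof (induction xs)
  case (Cons b xs)
  have p: "0 \<le> prod_list (map f xs)" "prod_list (map f xs) \<le> 1"
    using prod_list_map_mono[of xs f f] prod_list_map_le_one[of f xs] assms(1) by auto
  show ?case
  proof (cases "a = b")
    case True
    then show ?thesis using mult_left_le[of "prod_list (map f xs)" "f b"] p assms(1) by simp
  next
    case False
    then have "prod_list (map f xs) \<le> f a" using Cons by auto
    then show ?thesis using mult_left_le_one_le[of "prod_list (map f xs)" "f b"] p assms(1)[of b] by simp
  qed
qed simp

text \<open>Replacing the factors one at a time costs at most \<open>e\<close> each, as the other
  factors are at most 1.\<close>

lemma prod_list_map_diff_le:
  fixes f g :: "'b \<Rightarrow> real"
  assumes "\<And>x. 0 \<le> f x \<and> f x \<le> g x \<and> g x \<le> 1 \<and> g x \<le> f x + e"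
  shows "prod_list (map g xs) \<le> prod_list (map f xs) + real (length xs) * e"
proof (induction xs)
  case (Cons a xs)
  let ?F = "prod_list (map f xs)" and ?G = "prod_list (map g xs)"
  have g: "0 \<le> g x" "g x \<le> 1" "0 \<le> f x" "f x \<le> 1" "0 \<le> e" for x using assms[of x] by linarith+
  have G: "0 \<le> ?G" "?G \<le> 1" "?F \<le> ?G"
    using prod_list_map_mono[of xs f g] prod_list_map_mono[of xs g g] prod_list_map_le_one[of g xs] assms g by auto
  have "g a * ?G \<le> (f a + e) * ?G" using assms[of a] G by (intro mult_right_mono) auto
  also have "\<dots> = f a * ?G + e * ?G" by (simp add: algebra_simps)
  also have "e * ?G \<le> e * 1" using G g by (intro mult_left_mono) auto
  also have "f a * ?G = f a * ?F + f a * (?G - ?F)" by (simp add: algebra_simps)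
  also have "f a * (?G - ?F) \<le> ?G - ?F" using g G by (intro mult_left_le_one_le) auto
  finally show ?case using Cons by (simp add: algebra_simps)
qed simp

text \<open>Tychonoff. A filter finer than \<open>sequentially\<close> replaces a subsequence: the
  index set will be P1(K), and a cube over an uncountable set need not be sequentially
  compact.\<close>

lemma unit_cube_cluster_point:
  fixes f :: "nat \<Rightarrow> 'b \<Rightarrow> real"
  assumes "\<And>j b. 0 \<le> f j b \<and> f j b \<le> 1"
  obtains g G where "G \<noteq> bot" "G \<le> sequentially" "\<And>b. ((\<lambda>j. f j b) \<longlongrightarrow> g b) G"
proof -
  have "compact (PiE UNIV (\<lambda>_::'b. {0..1::real}))"
    unfolding compactin_euclidean_iff[symmetric] euclidean_product_topology[symmetric]
    by (subst compactin_PiE) auto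
  moreover have "eventually (\<lambda>x. x \<in> PiE UNIV (\<lambda>_::'b. {0..1::real})) (filtermap f sequentially)"
    using assms by (auto simp: eventually_filtermap PiE_def)
  ultimately obtain g where g: "inf (nhds g) (filtermap f sequentially) \<noteq> bot"
    unfolding compact_filter by (metis filtermap_bot_iff sequentially_bot)
  define G where "G = inf (filtercomap f (nhds g)) sequentially"
  have "G \<noteq> bot"
  proof
    assume "G = bot"
    then have "eventually (\<lambda>_. False) G" by simp
    then obtain A B where A: "eventually A (filtercomap f (nhds g))" and B: "eventually B sequentially"
      and AB: "\<And>j. A j \<Longrightarrow> B j \<Longrightarrow> False"
      unfolding G_def eventually_inf by blast
    obtain C where C: "eventually C (nhds g)" "\<And>j. C (f j) \<Longrightarrow> A j"
      using A unfolding eventually_filtercomap by blast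
    have "eventually (\<lambda>x. \<exists>j. B j \<and> x = f j) (filtermap f sequentially)"
      unfolding eventually_filtermap using B by (rule eventually_mono) auto
    then have "eventually (\<lambda>_. False) (inf (nhds g) (filtermap f sequentially))"
      unfolding eventually_inf using C AB by blast
    then show False using g by (simp add: trivial_limit_def)
  qed
  moreover have "G \<le> sequentially" by (simp add: G_def)
  moreover have "((\<lambda>j. f j b) \<longlongrightarrow> g b) G" for b
  proof -
    have lim: "filterlim f (nhds g) G"
      unfolding G_def by (rule filterlim_mono[OF filterlim_filtercomap order.refl]) simp
    show ?thesis
    proof (rule topological_tendstoI)
      fix S :: "real set" assume S: "open S" "g b \<in> S"
      have "open ((\<lambda>x. x b) -` S)" by (rule open_vimage[OF S(1) continuous_on_product_coordinates])
      then show "\<forall>\<^sub>F j in G. f j b \<in> S"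
        using topological_tendstoD[OF lim, of "(\<lambda>x. x b) -` S"] S(2) by simp
    qed
  qed
  ultimately show ?thesis using that by blast
qed

section \<open>Partial fractions and comparison of monomials along a filter\<close>

text \<open>Writes \<open>P / Q\<close> as \<open>A / Q1 + B / Q2\<close>, poles in \<open>E\<close>
  against poles outside. The degree bound makes \<open>A / Q1\<close> a principal part, which
  contributes only negative exponents to a Laurent expansion.\<close>

lemma partial_fractions:
  fixes P Q :: "'a::field poly"
  assumes "Q \<noteq> 0"
  shows "\<exists>Q1 Q2 A B. Q = Q1 * Q2 \<and> (\<forall>r. poly Q1 r = 0 \<longrightarrow> r \<in> E) \<and> (\<forall>r. poly Q2 r = 0 \<longrightarrow> r \<notin> E) \<and>
    P = A * Q2 + B * Q1 \<and> (A = 0 \<or> degree A < degree Q1)"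
  using assms
proof (induction "degree Q" arbitrary: Q)
  case 0
  then obtain c where "Q = [:c:]" by (metis degree_eq_zeroE)
  then show ?case
    using 0 by (intro exI[of _ 1] exI[of _ Q] exI[of _ 0] exI[of _ P]) auto
next
  case (Suc n)
  show ?case
  proof (cases "\<exists>r\<in>E. poly Q r = 0")
    case False
    then show ?thesis by (intro exI[of _ 1] exI[of _ Q] exI[of _ 0] exI[of _ P]) auto
  next
    case True
    then obtain r where r: "r \<in> E" "poly Q r = 0" by blast
    obtain Q' where Q': "Q = [:-r, 1:] * Q'" "Q' \<noteq> 0" "degree Q = Suc (degree Q')"
      using poly_factor_root[OF r(2) Suc.prems] by blast
    have "n = degree Q'" using Suc.hyps(2) Q'(3) by simp
    from Suc.hyps(1)[OF this Q'(2)] obtain Q1 Q2 A B where I: "Q' = Q1 * Q2" "\<forall>r. poly Q1 r = 0 \<longrightarrow> r \<in> E"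
      "\<forall>r. poly Q2 r = 0 \<longrightarrow> r \<notin> E" "P = A * Q2 + B * Q1" "A = 0 \<or> degree A < degree Q1" by blast
    have "Q1 \<noteq> 0" using I(1) Q'(2) by auto
    \<comment> \<open>The value of \<open>B / Q2\<close> at \<open>r\<close>. After division by
      \<open>T - r\<close> the term \<open>e / (T - r)\<close> joins the part with poles in
      \<open>E\<close>, and in the rest the factor \<open>T - r\<close> cancels.\<close>
    define e where "e = poly B r / poly Q2 r"
    have "poly Q2 r \<noteq> 0" using I(3) r(1) by blast
    then have "poly (B - smult e Q2) r = 0" by (simp add: e_def)
    then have "[:-r, 1:] dvd B - smult e Q2" by (simp only: poly_eq_0_iff_dvd)
    then obtain B' where B': "B - smult e Q2 = [:-r, 1:] * B'" by (rule dvdE)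
    have deg: "degree ([:-r, 1:] * Q1) = Suc (degree Q1)"
      using \<open>Q1 \<noteq> 0\<close> by (subst degree_mult_eq) auto
    have "P = (A + smult e Q1) * Q2 + (B - smult e Q2) * Q1"
      by (subst I(4)) (simp add: algebra_simps)
    then have "P = (A + smult e Q1) * Q2 + B' * ([:-r, 1:] * Q1)"
      unfolding B' by (simp only: mult_ac)
    moreover have "degree (A + smult e Q1) < degree ([:-r, 1:] * Q1)"
      unfolding deg less_Suc_eq_le using I(5) by (intro degree_add_le) (auto simp: degree_smult_le)
    moreover have "Q = ([:-r, 1:] * Q1) * Q2" by (simp only: Q'(1) I(1) mult_ac)
    moreover have "\<forall>b. poly ([:-r, 1:] * Q1) b = 0 \<longrightarrow> b \<in> E" using I(2) r(1) by auto
    ultimately show ?thesis using I(3) by blast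
  qed
qed

text \<open>Along \<open>F\<close> the positive quantity \<open>u\<close> leaves every real
  \<open>v\<close> and ends strictly on one side of it, as \<open>t\<close> and \<open>1 / t\<close>
  do when \<open>t\<close> decreases to a limit. Two monomials in \<open>u\<close> of different
  exponents are then eventually strictly comparable.\<close>

definition deciding :: "'i filter \<Rightarrow> ('i \<Rightarrow> real) \<Rightarrow> bool" where
  "deciding F u \<longleftrightarrow> F \<noteq> bot \<and> eventually (\<lambda>t. 0 < u t) F \<and>
     (\<forall>v. eventually (\<lambda>t. u t < v) F \<or> eventually (\<lambda>t. v < u t) F)"

lemma deciding_power:
  assumes "deciding F u" "n \<ge> 1" "0 < w"
  shows "eventually (\<lambda>t. u t ^ n < w) F \<or> eventually (\<lambda>t. w < u t ^ n) F"
proof -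
  define v where "v = root n w"
  have v: "v ^ n = w" "0 < v" using assms by (auto simp: v_def)
  have pos: "eventually (\<lambda>t. 0 < u t) F" using assms(1) by (simp add: deciding_def)
  consider "eventually (\<lambda>t. u t < v) F" | "eventually (\<lambda>t. v < u t) F"
    using assms(1) by (auto simp: deciding_def)
  then show ?thesis
  proof cases
    case 1
    then have "eventually (\<lambda>t. u t ^ n < w) F"
      using pos by eventually_elim (use v assms(2) in \<open>metis less_imp_le power_strict_mono not_one_le_zero gr0I\<close>)
    then show ?thesis ..
  next
    case 2
    then have "eventually (\<lambda>t. w < u t ^ n) F"
      by eventually_elim (use v assms(2) in \<open>metis less_imp_le power_strict_mono not_one_le_zero gr0I\<close>)
    then show ?thesis ..
  qed
qed

lemma deciding_power_not_const:
  assumes "deciding F u" "n \<ge> 1"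
  shows "\<not> eventually (\<lambda>t. u t ^ n = w) F"
proof
  assume ev: "eventually (\<lambda>t. u t ^ n = w) F"
  have F: "F \<noteq> bot" and pos: "eventually (\<lambda>t. 0 < u t) F" using assms(1) by (auto simp: deciding_def)
  have "eventually (\<lambda>t. 0 < w) F" using ev pos by eventually_elim (metis zero_less_power)
  then have "0 < w" using F by (simp add: eventually_const)
  from deciding_power[OF assms this] have "eventually (\<lambda>t. False) F"
  proof
    assume "eventually (\<lambda>t. u t ^ n < w) F"
    then show ?thesis using ev by eventually_elim simp
  next
    assume "eventually (\<lambda>t. w < u t ^ n) F"
    then show ?thesis using ev by eventually_elim simp
  qed
  then show False using F by (simp add: trivial_limit_def)
qed

text \<open>Dividing by the smaller power compares \<open>u t ^ (n2 - n1)\<close> with the threshold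
  \<open>C1 / C2\<close>.\<close>

lemma deciding_monomials:
  assumes F: "deciding F u" and C: "0 < C1" "0 < C2" and "n1 < n2"
  shows "eventually (\<lambda>t. C1 * u t ^ n1 < C2 * u t ^ n2) F \<or> eventually (\<lambda>t. C2 * u t ^ n2 < C1 * u t ^ n1) F"
proof -
  have pos: "eventually (\<lambda>t. 0 < u t) F" using F by (auto simp: deciding_def)
  have s: "u t ^ n2 = u t ^ (n2 - n1) * u t ^ n1" for t using assms(4) by (simp flip: power_add)
  have "eventually (\<lambda>t. u t ^ (n2 - n1) < C1 / C2) F \<or> eventually (\<lambda>t. C1 / C2 < u t ^ (n2 - n1)) F"
    using assms by (intro deciding_power) auto
  then show ?thesis
  proof
    assume "eventually (\<lambda>t. u t ^ (n2 - n1) < C1 / C2) F"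
    then have "eventually (\<lambda>t. C2 * u t ^ n2 < C1 * u t ^ n1) F"
      using pos
    proof eventually_elim
      case (elim t)
      then have "u t ^ (n2 - n1) * C2 < C1" using C by (simp add: pos_less_divide_eq)
      then have "(u t ^ (n2 - n1) * C2) * u t ^ n1 < C1 * u t ^ n1" using elim by simp
      then show ?case by (simp add: s mult_ac)
    qed
    then show ?thesis ..
  next
    assume "eventually (\<lambda>t. C1 / C2 < u t ^ (n2 - n1)) F"
    then have "eventually (\<lambda>t. C1 * u t ^ n1 < C2 * u t ^ n2) F"
      using pos
    proof eventually_elim
      case (elim t)
      then have "C1 < u t ^ (n2 - n1) * C2" using C by (simp add: pos_divide_less_eq)
      then have "C1 * u t ^ n1 < (u t ^ (n2 - n1) * C2) * u t ^ n1" using elim by simp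
      then show ?case by (simp add: s mult_ac)
    qed
    then show ?thesis ..
  qed
qed

lemma deciding_at_right: "0 \<le> \<tau> \<Longrightarrow> deciding (at_right \<tau>) (\<lambda>t::real. t)"
proof -
  assume \<tau>: "0 \<le> \<tau>"
  have "eventually (\<lambda>t. t < v) (at_right \<tau>) \<or> eventually (\<lambda>t. v < t) (at_right \<tau>)" for v :: real
  proof (cases "\<tau> < v")
    case True
    then show ?thesis using eventually_at_right_less eventually_at_rightI[of \<tau> v "\<lambda>t. t < v"] by auto
  next
    case False
    then show ?thesis by (intro disjI2 eventually_at_rightI[of \<tau> "\<tau> + 1"]) auto
  qed
  moreover have "eventually (\<lambda>t. 0 < t) (at_right \<tau>)"
    using \<tau> by (intro eventually_at_rightI[of \<tau> "\<tau> + 1"]) auto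
  ultimately show ?thesis by (simp add: deciding_def)
qed

lemma deciding_inverse:
  assumes "deciding F u"
  shows "deciding F (\<lambda>t. 1 / u t)"
proof -
  have pos: "eventually (\<lambda>t. 0 < u t) F" using assms by (auto simp: deciding_def)
  have "eventually (\<lambda>t. 1 / u t < v) F \<or> eventually (\<lambda>t. v < 1 / u t) F" for v
  proof (cases "v \<le> 0")
    case True
    have "eventually (\<lambda>t. v < 1 / u t) F"
      using pos
    proof eventually_elim
      case (elim t)
      then have "0 < 1 / u t" by simp
      then show ?case using True by linarith
    qed
    then show ?thesis ..
  next
    case False
    then have v: "0 < v" by simp
    consider "eventually (\<lambda>t. u t < 1 / v) F" | "eventually (\<lambda>t. 1 / v < u t) F"
      using assms by (auto simp: deciding_def)
    then show ?thesis
    proof cases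
      case 1
      then have "eventually (\<lambda>t. v < 1 / u t) F"
        using pos
      proof eventually_elim
        case (elim t)
        then show ?case using v by (simp add: pos_less_divide_eq mult.commute)
      qed
      then show ?thesis ..
    next
      case 2
      then have "eventually (\<lambda>t. 1 / u t < v) F"
        using pos
      proof eventually_elim
        case (elim t)
        then show ?case using v by (simp add: pos_divide_less_eq mult.commute)
      qed
      then show ?thesis ..
    qed
  qed
  moreover have "eventually (\<lambda>t. 0 < 1 / u t) F" using pos by eventually_elim simp
  ultimately show ?thesis using assms by (simp add: deciding_def)
qed

section \<open>Real inequalities that turn local slopes into a global constant\<close>

lemma power_diff_le_linear:
  fixes s t :: real
  assumes "0 \<le> s" "s \<le> t"
  shows "t ^ Suc m - s ^ Suc m \<le> real (Suc m) * t ^ m * (t - s)"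
proof (induction m)
  case (Suc m)
  have "s ^ Suc m \<le> t ^ Suc m" using assms by (intro power_mono)
  then have "s ^ Suc m * (t - s) \<le> t ^ Suc m * (t - s)" using assms by (intro mult_right_mono) auto
  moreover have "t * (t ^ Suc m - s ^ Suc m) \<le> t * (real (Suc m) * t ^ m * (t - s))"
    using Suc assms by (intro mult_left_mono) auto
  moreover have "t ^ Suc (Suc m) - s ^ Suc (Suc m) = t * (t ^ Suc m - s ^ Suc m) + s ^ Suc m * (t - s)"
    by (simp add: algebra_simps)
  moreover have "real (Suc (Suc m)) * t ^ Suc m * (t - s) = t * (real (Suc m) * t ^ m * (t - s)) + t ^ Suc m * (t - s)"
    by (simp add: algebra_simps)
  ultimately show ?case by linarith
qed simp

text \<open>In the variable \<open>1/m\<close> the function \<open>ln m + C/m\<close> is convex, so on \<open>1 \<le> m \<le> d\<close> it is largest at an end.\<close>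

lemma mult_root_le_max_endpoints:
  fixes z g B :: real
  assumes z: "0 < z" "z ^ m \<le> 1 / (g * B ^ d)" and gB: "0 < g" "0 < B" and m: "1 \<le> m" "m \<le> d"
  shows "real m * z \<le> max (1 / (g * B ^ d)) (real d / (g powr (1 / real d) * B))"
proof -
  define C where "C = - ln (g * B ^ d)"
  have gBd: "0 < g * B ^ d" using gB by simp
  have md: "0 < real m" "0 < real d" using m by auto
  have "real m * ln z \<le> C"
  proof -
    have "ln (z ^ m) \<le> ln (1 / (g * B ^ d))" using z gBd by (subst ln_le_cancel_iff) auto
    then show ?thesis using z(1) gB by (simp add: ln_realpow ln_div C_def)
  qed
  then have lnz: "ln z \<le> C / real m" using md by (simp add: field_simps)
  define p q where "p = 1 / real m" and "q = 1 / real d"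
  have pq: "0 < q" "q \<le> p" "p \<le> 1"
    using m md by (auto simp: p_def q_def divide_simps)
  \<comment> \<open>\<open>p\<close> lies between the reciprocals of the two ends, 1 for
    \<open>m = 1\<close> and \<open>q\<close> for \<open>m = d\<close>, and \<open>l0\<close> is its
    weight. For \<open>d = 1\<close> the interval is a point.\<close>
  obtain l0 where l: "0 \<le> l0" "l0 \<le> 1" "p = (1 - l0) + l0 * q"
  proof (cases "q = 1")
    case True
    then show ?thesis using that[of 0] pq by simp
  next
    case False
    then have q1: "0 < 1 - q" using pq by linarith
    have "0 \<le> (1 - p) / (1 - q)" "(1 - p) / (1 - q) \<le> 1" using pq q1 by (simp_all add: divide_le_eq_1)
    moreover have "(1 - p) / (1 - q) * (1 - q) = 1 - p" using q1 by simp
    then have "p = (1 - (1 - p) / (1 - q)) + (1 - p) / (1 - q) * q"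
      by (simp only: right_diff_distrib)
    ultimately show ?thesis by (rule that)
  qed
  have "(1 - l0) * ln 1 + l0 * ln q \<le> ln ((1 - l0) *\<^sub>R 1 + l0 *\<^sub>R q)"
    by (rule concave_onD[OF ln_concave l(1,2)]) (use pq in simp_all)
  then have "l0 * ln q \<le> ln p"
    unfolding l(3) by simp
  then have lnm: "ln (real m) \<le> l0 * ln (real d)" using md by (simp add: p_def q_def ln_div)
  have "ln (real m * z) = ln (real m) + ln z" using md z(1) by (simp add: ln_mult)
  also have "\<dots> \<le> l0 * ln (real d) + C * p" using lnm lnz by (simp add: p_def)
  also have "\<dots> = (1 - l0) * C + l0 * (ln (real d) + C * q)" unfolding l(3) by (simp add: algebra_simps)
  also have "\<dots> \<le> (1 - l0) * max C (ln (real d) + C * q) + l0 * max C (ln (real d) + C * q)"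
    using l(1,2) by (intro add_mono mult_left_mono) auto
  also have "\<dots> = max C (ln (real d) + C / real d)" by (simp add: algebra_simps q_def)
  finally have "real m * z \<le> exp (max C (ln (real d) + C / real d))"
    using exp_le_cancel_iff[of "ln (real m * z)"] exp_ln[of "real m * z"] mult_pos_pos[OF md(1) z(1)] by simp
  also have "\<dots> = max (exp C) (exp (ln (real d) + C / real d))"
    by (simp add: max_def)
  also have "exp C = 1 / (g * B ^ d)" using gBd by (simp add: C_def exp_minus divide_inverse)
  also have "exp (ln (real d) + C / real d) = real d / (g powr (1 / real d) * B)"
  proof -
    have "C = - ln g - real d * ln B" using gB by (simp add: C_def ln_mult ln_realpow)
    then have C: "C / real d = - (1 / real d * ln g) - ln B" using md by (simp add: diff_divide_distrib)
    have "exp (ln (real d) + (- (1 / real d * ln g) - ln B)) = exp (ln (real d)) * (inverse (exp (1 / real d * ln g)) / exp (ln B))"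
      by (simp only: exp_add exp_diff exp_minus)
    also have "\<dots> = real d / (g powr (1 / real d) * B)"
      using gB md by (simp add: powr_def divide_inverse)
    finally show ?thesis unfolding C .
  qed
  finally show ?thesis .
qed

text \<open>A continuation argument. The slope bound is known only strictly to the right of interior
  parameters, and \<open>D\<close> is not assumed continuous: the crude bound, with a large
  constant, bridges arbitrarily short gaps at the left end and at the supremum.\<close>

lemma right_local_Lipschitz:
  fixes D :: "real \<Rightarrow> real \<Rightarrow> real"
  assumes tri: "\<And>r s t. a \<le> r \<Longrightarrow> r \<le> s \<Longrightarrow> s \<le> t \<Longrightarrow> t \<le> b \<Longrightarrow> D r t \<le> D r s + D s t"
    and crude: "\<And>s t. a \<le> s \<Longrightarrow> s \<le> t \<Longrightarrow> t \<le> b \<Longrightarrow> D s t \<le> C * (t - s)"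
    and loc: "\<And>\<tau>. a < \<tau> \<Longrightarrow> \<tau> < b \<Longrightarrow> \<exists>e>\<tau>. \<forall>s t. \<tau> < s \<longrightarrow> s < t \<longrightarrow> t < e \<longrightarrow> D s t \<le> L * (t - s)"
    and "0 \<le> C" "0 \<le> L" "a \<le> b"
  shows "D a b \<le> L * (b - a)"
proof -
  have lim: "D s t \<le> L * (t - s)"
    if st: "a \<le> s" "s < t" "t \<le> b" and near: "\<And>e. 0 < e \<Longrightarrow> \<exists>s'. s < s' \<and> s' < s + e \<and> s' < t \<and> D s' t \<le> L * (t - s')" for s t
  proof (rule field_le_epsilon)
    fix e :: real assume e: "0 < e"
    have "0 < e / (C + 1)" using e \<open>0 \<le> C\<close> by simp
    then obtain s' where s': "s < s'" "s' < s + e / (C + 1)" "s' < t" "D s' t \<le> L * (t - s')"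
      using near by blast
    have "D s t \<le> D s s' + D s' t" using st s' by (intro tri) auto
    moreover have "D s s' \<le> C * (s' - s)" using st s' by (intro crude) auto
    moreover have "C * (s' - s) \<le> (C + 1) * (e / (C + 1))" using s' \<open>0 \<le> C\<close> by (intro mult_mono) auto
    moreover have "(C + 1) * (e / (C + 1)) = e" using \<open>0 \<le> C\<close> by simp
    moreover have "L * (t - s') \<le> L * (t - s)" using s'(1) \<open>0 \<le> L\<close> by (intro mult_left_mono) auto
    ultimately show "D s t \<le> L * (t - s) + e" using s'(4) by linarith
  qed
  have inner: "D s b \<le> L * (b - s)" if s: "a < s" "s < b" for s
  proof -
    \<comment> \<open>The bound starting at \<open>s\<close> survives at the supremum by the crude
      estimate, and \<open>loc\<close> then carries it further, so the supremum must be
      \<open>b\<close>.\<close>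
    define S where "S = {t. s \<le> t \<and> t \<le> b \<and> D s t \<le> L * (t - s)}"
    have sS: "s \<in> S" using crude[of s s] s by (simp add: S_def)
    have bdd: "bdd_above S" by (rule bdd_aboveI[of _ b]) (simp add: S_def)
    define \<sigma> where "\<sigma> = Sup S"
    have \<sigma>: "s \<le> \<sigma>" "\<sigma> \<le> b"
    proof -
      show "s \<le> \<sigma>" unfolding \<sigma>_def by (rule cSup_upper[OF sS bdd])
      show "\<sigma> \<le> b" unfolding \<sigma>_def using sS by (intro cSup_least) (auto simp: S_def)
    qed
    have "D s \<sigma> \<le> L * (\<sigma> - s)"
    proof (rule field_le_epsilon)
      fix e :: real assume e: "0 < e"
      have "0 < e / (C + 1)" using e \<open>0 \<le> C\<close> by simp
      then have "\<sigma> - e / (C + 1) < Sup S" unfolding \<sigma>_def by linarith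
      then obtain t where t: "t \<in> S" "\<sigma> - e / (C + 1) < t"
        using less_cSupD[of S] sS by blast
      have t\<sigma>: "t \<le> \<sigma>" unfolding \<sigma>_def using t(1) bdd by (rule cSup_upper)
      have "D s \<sigma> \<le> D s t + D t \<sigma>" using t t\<sigma> \<sigma> s by (intro tri) (auto simp: S_def)
      moreover have "D s t \<le> L * (t - s)" using t by (simp add: S_def)
      moreover have "L * (t - s) \<le> L * (\<sigma> - s)" using t\<sigma> \<open>0 \<le> L\<close> by (intro mult_left_mono) auto
      moreover have "D t \<sigma> \<le> C * (\<sigma> - t)" using t t\<sigma> \<sigma> s by (intro crude) (auto simp: S_def)
      moreover have "C * (\<sigma> - t) \<le> (C + 1) * (e / (C + 1))" using t t\<sigma> \<open>0 \<le> C\<close> by (intro mult_mono) auto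
      moreover have "(C + 1) * (e / (C + 1)) = e" using \<open>0 \<le> C\<close> by simp
      ultimately show "D s \<sigma> \<le> L * (\<sigma> - s) + e" by linarith
    qed
    have "\<sigma> = b"
    proof (rule ccontr)
      assume "\<sigma> \<noteq> b"
      then have "\<sigma> < b" using \<sigma> by simp
      moreover have "a < \<sigma>" using s(1) \<sigma>(1) by simp
      ultimately obtain e where e: "e > \<sigma>" "\<forall>s t. \<sigma> < s \<longrightarrow> s < t \<longrightarrow> t < e \<longrightarrow> D s t \<le> L * (t - s)"
        using loc by blast
      define t where "t = (\<sigma> + min e b) / 2"
      have t: "\<sigma> < t" "t < e" "t < b" using e(1) \<open>\<sigma> < b\<close> unfolding t_def by (simp_all add: min_def)
      have "D \<sigma> t \<le> L * (t - \<sigma>)"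
      proof (rule lim)
        fix h :: real assume "0 < h"
        then have "\<sigma> < \<sigma> + min h (t - \<sigma>) / 2" "\<sigma> + min h (t - \<sigma>) / 2 < \<sigma> + h" "\<sigma> + min h (t - \<sigma>) / 2 < t"
          using t by (cases "h \<le> t - \<sigma>"; simp add: min_def field_simps)+
        then show "\<exists>s'. \<sigma> < s' \<and> s' < \<sigma> + h \<and> s' < t \<and> D s' t \<le> L * (t - s')"
          using e(2) t(2) by (intro exI[of _ "\<sigma> + min h (t - \<sigma>) / 2"]) simp
      qed (use t \<sigma> s in auto)
      moreover have "D s t \<le> D s \<sigma> + D \<sigma> t" using t \<sigma> s by (intro tri) auto
      ultimately have "D s t \<le> L * (t - s)" using \<open>D s \<sigma> \<le> L * (\<sigma> - s)\<close> by (simp add: algebra_simps)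
      then have "t \<in> S" using t \<sigma> by (simp add: S_def)
      then have "t \<le> \<sigma>" unfolding \<sigma>_def using bdd by (rule cSup_upper)
      then show False using t by simp
    qed
    then show ?thesis using \<open>D s \<sigma> \<le> L * (\<sigma> - s)\<close> by simp
  qed
  show ?thesis
  proof (cases "a = b")
    case True
    then show ?thesis using crude[of a b] by simp
  next
    case False
    show ?thesis
    proof (rule lim)
      fix h :: real assume "0 < h"
      then have "a < a + min h (b - a) / 2" "a + min h (b - a) / 2 < a + h" "a + min h (b - a) / 2 < b"
        using False \<open>a \<le> b\<close> by (cases "h \<le> b - a"; simp add: min_def field_simps)+
      then show "\<exists>s'. a < s' \<and> s' < a + h \<and> s' < b \<and> D s' b \<le> L * (b - s')"
        using inner by (intro exI[of _ "a + min h (b - a) / 2"]) simp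
    qed (use False \<open>a \<le> b\<close> in auto)
  qed
qed

text \<open>Just above \<tau> each factor is either \<open>t\<close>, when
  \<open>k a \<le> \<tau>\<close>, or the constant \<open>k a\<close>; \<open>N\<close> counts the
  former. The tie \<open>k a = \<tau>\<close> is harmless on the right side only. The bound
  \<open>C \<le> 1\<close> later keeps coefficients below the values at the Gauss point.\<close>

lemma prod_list_max_germ:
  fixes k :: "'b \<Rightarrow> real"
  assumes "0 \<le> \<tau>" "\<And>a. k a \<le> 1"
  shows "\<exists>C N. 0 < C \<and> C \<le> 1 \<and> N \<le> length as \<and>
    eventually (\<lambda>t. prod_list (map (\<lambda>a. max (k a) t) as) = C * t ^ N) (at_right \<tau>)"
proof (induction as)
  case Nil
  show ?case by (intro exI[of _ 1] exI[of _ 0]) simp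
next
  case (Cons a as)
  then obtain C N where C: "0 < C" "C \<le> 1" "N \<le> length as"
    "eventually (\<lambda>t. prod_list (map (\<lambda>a. max (k a) t) as) = C * t ^ N) (at_right \<tau>)" by blast
  show ?case
  proof (cases "k a \<le> \<tau>")
    case True
    have "eventually (\<lambda>t. prod_list (map (\<lambda>a. max (k a) t) (a # as)) = C * t ^ Suc N) (at_right \<tau>)"
      using C(4) eventually_at_right_less[of \<tau>]
    proof eventually_elim
      case (elim t)
      then have "max (k a) t = t" using True by simp
      then show ?case using elim(1) by (simp only: list.map prod_list.Cons power_Suc mult_ac)
    qed
    then show ?thesis using C(1-3) by (intro exI[of _ C] exI[of _ "Suc N"]) simp
  next
    case False
    then have "eventually (\<lambda>t. t < k a) (at_right \<tau>)" by (intro eventually_at_rightI[of \<tau> "k a"]) auto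
    then have "eventually (\<lambda>t. prod_list (map (\<lambda>a. max (k a) t) (a # as)) = (k a * C) * t ^ N) (at_right \<tau>)"
      using C(4)
    proof eventually_elim
      case (elim t)
      then have "max (k a) t = k a" by simp
      then show ?case using elim(2) by (simp only: list.map prod_list.Cons mult_ac)
    qed
    moreover have "0 < k a * C" using False C(1) assms(1) by simp
    moreover have "k a * C \<le> 1" using False C(1,2) assms by (intro mult_le_one) auto
    ultimately show ?thesis using C(3) by (intro exI[of _ "k a * C"] exI[of _ N]) simp
  qed
qed

text \<open>The exponent of the image along a path may be negative; it is carried as a quotient of
  natural powers, to be resolved by the sign of \<open>N - M\<close>.\<close>

lemma power_quotient_eq:
  fixes t :: real
  assumes "0 < t"
  shows "N > M \<Longrightarrow> t ^ N / t ^ M = t ^ (N - M)" "N < M \<Longrightarrow> t ^ N / t ^ M = 1 / t ^ (M - N)"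
proof -
  assume "N > M"
  then have "t ^ N = t ^ (N - M) * t ^ M" by (simp flip: power_add)
  then show "t ^ N / t ^ M = t ^ (N - M)" using assms by simp
next
  assume "N < M"
  then have "t ^ M = t ^ (M - N) * t ^ N" by (simp flip: power_add)
  then show "t ^ N / t ^ M = 1 / t ^ (M - N)" using assms by simp
qed

lemma power_quotient_inj:
  fixes s t :: real
  assumes "0 < s" "0 < t" "N \<noteq> M" "s ^ N / s ^ M = t ^ N / t ^ M"
  shows "s = t"
proof (cases "N > M")
  case True
  then have "s ^ (N - M) = t ^ (N - M)" using assms power_quotient_eq(1)[OF _ True] by simp
  then show ?thesis using True assms(1,2) power_eq_iff_eq_base[of "N - M" s t] by simp
next
  case False
  then have lt: "N < M" using assms(3) by simp
  then have "1 / s ^ (M - N) = 1 / t ^ (M - N)" using assms power_quotient_eq(2)[OF _ lt] by simp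
  then have "s ^ (M - N) = t ^ (M - N)" by simp
  then show ?thesis using lt assms(1,2) power_eq_iff_eq_base[of "M - N" s t] by simp
qed

text \<open>\<open>n\<close> and \<open>m\<close> are formal degrees. This is multiplicativity at
  infinity, where a form of degree \<open>n\<close> takes its coefficient of index \<open>n\<close>
  as value.\<close>

lemma coeff_mult_bound_sum:
  fixes f g :: "'a::comm_semiring_0 poly"
  assumes "degree f \<le> n" "degree g \<le> m"
  shows "coeff (f * g) (n + m) = coeff f n * coeff g m"
proof (cases "degree f = n \<and> degree g = m")
  case True
  then show ?thesis using coeff_mult_degree_sum[of f g] by simp
next
  case False
  then have "degree f < n \<or> degree g < m" using assms by auto
  moreover from this have "degree (f * g) < n + m" using degree_mult_le[of f g] assms by linarith
  ultimately show ?thesis by (auto simp: coeff_eq_0)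
qed

section \<open>Kernels of points of the Berkovich line\<close>

locale berkovich =
  fixes absK :: "'a::field \<Rightarrow> real"
  assumes acf: "nonarch_acf absK"
begin

section \<open>The absolute value of K and multiplicative seminorms\<close>

lemma abs_nonneg [simp]: "0 \<le> absK x"
  and abs_eq_0 [simp]: "absK x = 0 \<longleftrightarrow> x = 0"
  and abs_mult: "absK (x * y) = absK x * absK y"
  and abs_add: "absK (x + y) \<le> max (absK x) (absK y)"
  using acf by (auto simp: nonarch_acf_def nonarch_abs_def)

lemma abs_0 [simp]: "absK 0 = 0" by simp

lemma abs_pos [simp]: "0 < absK x \<longleftrightarrow> x \<noteq> 0"
  by (metis abs_0 abs_eq_0 abs_nonneg less_eq_real_def less_irrefl)

lemma abs_1 [simp]: "absK 1 = 1"
proof -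
  have "absK 1 * absK 1 = absK 1 * 1" using abs_mult[of 1 1] by simp
  moreover have "absK 1 \<noteq> 0" by simp
  ultimately show ?thesis using mult_left_cancel by blast
qed

lemma abs_minus [simp]: "absK (- x) = absK x"
proof -
  have "absK (-1) * absK (-1) = 1" using abs_mult[of "-1" "-1"] by simp
  then have "absK (-1) = 1"
    using abs_nonneg[of "-1"] by (metis abs_of_nonneg abs_square_eq_1 power2_eq_square)
  then show ?thesis using abs_mult[of "-1" x] by simp
qed

lemma abs_diff: "absK (x - y) \<le> max (absK x) (absK y)"
  using abs_add[of x "- y"] by simp

lemma abs_power: "absK (x ^ n) = absK x ^ n"
  by (induction n) (simp_all add: abs_mult)

lemma abs_of_nat: "absK (of_nat n) \<le> 1"
proof (induction n)
  case (Suc n)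
  then show ?case using abs_add[of 1 "of_nat n"] by simp
qed simp

lemma root_exists:
  assumes "degree (p :: 'a poly) \<ge> 1"
  obtains z where "poly p z = 0"
  using acf assms by (auto simp: nonarch_acf_def alg_closed_def)

text \<open>The value group is divisible: for large \<open>n\<close> an \<open>n\<close>-th root
  \<open>y\<close> of an element of value above 1 has value between 1 and \<open>w / u'\<close>, and
  the powers of such a \<open>y\<close> cannot jump over the interval.\<close>

lemma value_group_dense:
  assumes "0 \<le> u" "u < w"
  obtains z where "u < absK z" "absK z < w"
proof -
  define u' where "u' = (if u = 0 then w / 2 else u)"
  have u': "0 < u'" "u' < w" "u \<le> u'" using assms by (auto simp: u'_def)
  obtain b where "absK b > 1"
  proof -
    obtain z where z: "absK z \<noteq> 0" "absK z \<noteq> 1"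
      using acf by (auto simp: nonarch_acf_def abs_nontrivial_def)
    show ?thesis
    proof (cases "absK z > 1")
      case False
      have "absK (inverse z) * absK z = 1" using z abs_mult[of "inverse z" z] by simp
      then have "absK (inverse z) = 1 / absK z" using z by (simp add: field_simps)
      moreover have "absK z < 1" "0 < absK z" using False z by auto
      ultimately have "absK (inverse z) > 1" by simp
      then show ?thesis using that by blast
    qed (use that in blast)
  qed
  obtain n where n: "absK b < (w / u') ^ n"
    using real_arch_pow[of "w / u'" "absK b"] u' by auto
  then have n0: "n > 0" using \<open>absK b > 1\<close> by (cases n) auto
  have dm: "degree (monom (1::'a) n + [:-b:]) = n"
    using n0 by (subst degree_add_eq_left) (auto simp: degree_monom_eq)
  have "degree (monom (1::'a) n + [:-b:]) \<ge> 1"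
    unfolding dm using n0 by simp
  then obtain y where "poly (monom (1::'a) n + [:-b:]) y = 0"
    using root_exists by blast
  then have "y ^ n = b" by (simp add: poly_monom)
  then have yn: "absK y ^ n = absK b" by (metis abs_power)
  have y1: "absK y > 1"
    using yn \<open>absK b > 1\<close> by (metis abs_nonneg linorder_not_le power_le_one)
  have yw: "absK y < w / u'"
    using n yn u' by (metis less_eq_real_def linorder_not_less power_mono zero_less_divide_iff order.strict_trans)
  have "y \<noteq> 0" using y1 by auto
  obtain N where N: "u' < absK y ^ N" using real_arch_pow[OF y1] by blast
  have "\<exists>k. absK y ^ N / absK y ^ k \<le> u'"
  proof -
    obtain k where "absK y ^ N / u' < absK y ^ k" using real_arch_pow[OF y1] by blast
    then show ?thesis using u' \<open>y \<noteq> 0\<close> by (intro exI[of _ k]) (simp add: field_simps)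
  qed
  then have L: "absK y ^ N / absK y ^ (LEAST k. absK y ^ N / absK y ^ k \<le> u') \<le> u'"
    by (rule LeastI_ex)
  \<comment> \<open>Dividing by \<open>y\<close> step by step, the last value above
    \<open>u'\<close> is at most \<open>u' * absK y\<close>, hence below \<open>w\<close>.\<close>
  define k where "k = (LEAST k. absK y ^ N / absK y ^ k \<le> u')"
  have "k \<noteq> 0"
    using L N unfolding k_def[symmetric] by (metis div_by_1 linorder_not_less power_0)
  then obtain j where j: "k = Suc j" using not0_implies_Suc by blast
  have "\<not> absK y ^ N / absK y ^ j \<le> u'"
    using not_less_Least[of j "\<lambda>k. absK y ^ N / absK y ^ k \<le> u'"] j k_def by auto
  moreover have "absK y ^ N / absK y ^ j \<le> u' * absK y"
    using L \<open>y \<noteq> 0\<close> unfolding k_def[symmetric] j by (simp add: field_simps)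
  moreover have "u' * absK y < w" using yw u' by (simp add: field_simps)
  moreover have "absK (y ^ N / y ^ j) = absK y ^ N / absK y ^ j"
  proof -
    have "absK (y ^ N / y ^ j) * absK (y ^ j) = absK (y ^ N)"
      using \<open>y \<noteq> 0\<close> by (simp flip: abs_mult)
    then show ?thesis using \<open>y \<noteq> 0\<close> by (simp add: abs_power field_simps)
  qed
  ultimately show ?thesis using that[of "y ^ N / y ^ j"] u' by simp
qed

abbreviation "tT \<equiv> [:0, 1:] :: 'a poly"

lemma
  assumes "is_mseminorm absK s"
  shows sem_nonneg: "0 \<le> s f"
    and sem_const: "s [:c:] = absK c"
    and sem_mult: "s (f * g) = s f * s g"
    and sem_triangle: "s (f + g) \<le> s f + s g"
  using assms by (auto simp: is_mseminorm_def)

lemma sem_1: "is_mseminorm absK s \<Longrightarrow> s 1 = 1"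
  using sem_const[of s 1] by (simp add: one_pCons)

lemma sem_0: "is_mseminorm absK s \<Longrightarrow> s 0 = 0"
  using sem_const[of s 0] by simp

lemma sem_smult: "is_mseminorm absK s \<Longrightarrow> s (smult c f) = absK c * s f"
  using sem_mult[of s "[:c:]" f] sem_const[of s c] by simp

lemma sem_power: "is_mseminorm absK s \<Longrightarrow> s (f ^ n) = s f ^ n"
  by (induction n) (simp_all add: sem_1 sem_mult)

lemma sem_sum_le:
  assumes "is_mseminorm absK s" "finite I"
  shows "s (\<Sum>i\<in>I. f i) \<le> (\<Sum>i\<in>I. s (f i))"
  using assms(2,1)
proof (induction I rule: finite_induct)
  case (insert i I)
  then show ?case using sem_triangle[of s "f i" "\<Sum>i\<in>I. f i"] by simp
qed (simp add: sem_0)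

text \<open>Power trick: \<open>(f + g) ^ n\<close> expands into \<open>n + 1\<close> terms whose
  binomial coefficients have value at most 1, and the factor \<open>n + 1\<close> disappears on
  taking \<open>n\<close>-th roots.\<close>

lemma sem_add:
  assumes s: "is_mseminorm absK s"
  shows "s (f + g) \<le> max (s f) (s g)"
proof (rule le_if_power_le_linear)
  show "0 \<le> s (f + g)" "0 \<le> max (s f) (s g)" using sem_nonneg[OF s] by (auto simp: max_def)
  fix n
  let ?M = "max (s f) (s g)"
  have "s (f + g) ^ n = s ((f + g) ^ n)" by (simp add: sem_power[OF s])
  also have "\<dots> = s (\<Sum>k\<le>n. of_nat (n choose k) * f ^ k * g ^ (n - k))"
    by (simp add: binomial_ring)
  also have "\<dots> \<le> (\<Sum>k\<le>n. s (of_nat (n choose k) * f ^ k * g ^ (n - k)))"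
    by (intro sem_sum_le[OF s]) simp
  also have "\<dots> \<le> (\<Sum>k\<le>n. ?M ^ n)"
  proof (rule sum_mono)
    fix k assume k: "k \<in> {..n}"
    have "s (of_nat (n choose k) * f ^ k * g ^ (n - k)) = absK (of_nat (n choose k)) * (s f ^ k * s g ^ (n - k))"
      by (simp add: sem_mult[OF s] sem_power[OF s] sem_smult[OF s] of_nat_poly mult.assoc)
    also have "\<dots> \<le> 1 * (?M ^ k * ?M ^ (n - k))"
      by (intro mult_mono power_mono abs_of_nat mult_nonneg_nonneg zero_le_power)
        (auto simp: sem_nonneg[OF s] le_max_iff_disj)
    also have "\<dots> = ?M ^ n" using k by (simp flip: power_add)
    finally show "s (of_nat (n choose k) * f ^ k * g ^ (n - k)) \<le> ?M ^ n" .
  qed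
  also have "\<dots> = real (Suc n) * ?M ^ n" by simp
  finally show "s (f + g) ^ n \<le> real (Suc n) * ?M ^ n" .
qed

section \<open>Homogeneous coordinates, kernels and the chordal metric\<close>

fun pt :: "'a option \<Rightarrow> 'a berk" where
  "pt None = BInf"
| "pt (Some a) = typeI absK a"

text \<open>Homogeneous coordinates \<open>(c0 : c1)\<close> of \<open>c\<close>, with \<open>\<infinity> = None = (-1 : 0)\<close>, so that the linear form
  \<open>c1 T - c0\<close> vanishing at \<open>c\<close> is \<open>T - c\<close> for finite \<open>c\<close> and \<open>1\<close> for \<open>\<infinity>\<close>.\<close>

fun hc0 :: "'a option \<Rightarrow> 'a" where
  "hc0 None = -1"
| "hc0 (Some a) = a"

fun hc1 :: "'a option \<Rightarrow> 'a" where
  "hc1 None = 0"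
| "hc1 (Some a) = 1"

definition wt :: "'a option \<Rightarrow> real" where
  "wt c = max (absK (hc0 c)) (absK (hc1 c))"

text \<open>The value at \<open>x\<close> of \<open>f\<close>, regarded as a binary form of degree \<open>n\<close>, with the coordinates of \<open>x\<close> normalised.\<close>

definition hval :: "nat \<Rightarrow> 'a berk \<Rightarrow> 'a poly \<Rightarrow> real" where
  "hval n x f = (case x of BInf \<Rightarrow> absK (coeff f n) | BAff s \<Rightarrow> s f / max 1 (s tT) ^ n)"

text \<open>Equals \<open>diam_G (join_G absK x (pt c))\<close>, but is written through the linear
  form vanishing at \<open>c\<close>, which makes it multiplicative over the roots of a polynomial.
  On P1(K) it is the chordal distance.\<close>

definition kap :: "'a berk \<Rightarrow> 'a option \<Rightarrow> real" where
  "kap x c = hval 1 x [:- hc0 c, hc1 c:] / wt c"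

abbreviation chord :: "'a option \<Rightarrow> 'a option \<Rightarrow> real" where
  "chord a b \<equiv> kap (pt a) b"

lemma hval_simps [simp]:
  "hval n BInf f = absK (coeff f n)"
  "hval n (BAff s) f = s f / max 1 (s tT) ^ n"
  by (simp_all add: hval_def)

lemma wt_ge_1: "1 \<le> wt c" by (cases c) (auto simp: wt_def)

lemma wt_pos [simp]: "0 < wt c" "0 \<le> wt c" "wt c \<noteq> 0"
  using wt_ge_1[of c] by linarith+

lemma wt_simps: "wt None = 1" "wt (Some a) = max 1 (absK a)"
  by (auto simp: wt_def max.commute)

lemma P1Berk_cases:
  assumes "x \<in> P1Berk absK"
  obtains "x = BInf" | s where "x = BAff s" "is_mseminorm absK s"
  using assms by (auto simp: P1Berk_def)

lemma BInf_in [simp]: "BInf \<in> P1Berk absK" by (simp add: P1Berk_def)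

lemma BAff_in [simp]: "BAff s \<in> P1Berk absK \<longleftrightarrow> is_mseminorm absK s" by (simp add: P1Berk_def)

lemma typeI_mseminorm: "is_mseminorm absK (\<lambda>f. absK (poly f a))"
proof -
  have "absK (x + y) \<le> absK x + absK y" for x y
    using abs_add[of x y] abs_nonneg[of x] abs_nonneg[of y] by linarith
  then show ?thesis by (auto simp: is_mseminorm_def abs_mult)
qed

lemma pt_in [simp]: "pt c \<in> P1Berk absK"
  by (cases c) (auto simp: typeI_def typeI_mseminorm)

lemma P1K_eq: "P1K absK = range pt"
proof -
  have "x \<in> P1K absK \<longleftrightarrow> x \<in> range pt" for x
    unfolding P1K_def image_iff by (metis UNIV_I insertE insertI1 insertI2 not_Some_eq pt.simps rangeE rangeI)
  then show ?thesis by blast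
qed

lemma hval_nonneg: "x \<in> P1Berk absK \<Longrightarrow> 0 \<le> hval n x f"
  by (erule P1Berk_cases) (auto simp: sem_nonneg)

lemma hval_add: "x \<in> P1Berk absK \<Longrightarrow> hval n x (f + g) \<le> max (hval n x f) (hval n x g)"
proof (erule P1Berk_cases)
  fix s assume x: "x = BAff s" and s: "is_mseminorm absK s"
  have "s (f + g) / max 1 (s tT) ^ n \<le> max (s f) (s g) / max 1 (s tT) ^ n"
    by (intro divide_right_mono sem_add[OF s]) auto
  then show ?thesis
    unfolding x by (auto simp: max_def split: if_splits)
qed (auto simp: abs_add)

lemma hval_smult: "x \<in> P1Berk absK \<Longrightarrow> hval n x (smult c f) = absK c * hval n x f"
  by (erule P1Berk_cases) (auto simp: sem_smult abs_mult)

lemma hval_mult: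
  assumes "x \<in> P1Berk absK" "degree f \<le> n" "degree g \<le> m"
  shows "hval (n + m) x (f * g) = hval n x f * hval m x g"
  using assms(1) by (rule P1Berk_cases)
    (auto simp: sem_mult power_add coeff_mult_bound_sum[OF assms(2,3)] abs_mult)

lemma hval_1_max: "x \<in> P1Berk absK \<Longrightarrow> max (hval 1 x 1) (hval 1 x tT) = 1"
proof (erule P1Berk_cases)
  fix s assume x: "x = BAff s" and s: "is_mseminorm absK s"
  show ?thesis unfolding x using sem_1[OF s] by (auto simp: max_def field_simps)
qed auto

lemma kap_nonneg: "x \<in> P1Berk absK \<Longrightarrow> 0 \<le> kap x c"
  by (simp add: kap_def hval_nonneg less_imp_le)

lemma hval_linear_form: "x \<in> P1Berk absK \<Longrightarrow> hval 1 x [:- hc0 c, hc1 c:] = wt c * kap x c"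
  by (simp add: kap_def)

lemma hval_combine:
  assumes "x \<in> P1Berk absK" "smult a f = smult b g + smult c h"
  shows "absK a * hval n x f \<le> max (absK b * hval n x g) (absK c * hval n x h)"
  using hval_add[OF assms(1), of n "smult b g" "smult c h"] assms(2)
  by (simp flip: hval_smult[OF assms(1)])

lemma kap_le_1:
  assumes x: "x \<in> P1Berk absK"
  shows "kap x c \<le> 1"
proof -
  have "absK 1 * hval 1 x [:- hc0 c, hc1 c:] \<le> max (absK (hc1 c) * hval 1 x tT) (absK (- hc0 c) * hval 1 x 1)"
    by (rule hval_combine[OF x]) (simp add: one_pCons)
  moreover have "hval 1 x tT \<le> 1" "hval 1 x 1 \<le> 1" using hval_1_max[OF x] by (auto simp: max_def split: if_splits)
  then have "absK (hc1 c) * hval 1 x tT \<le> absK (hc1 c)" "absK (- hc0 c) * hval 1 x 1 \<le> absK (hc0 c)"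
    by (simp_all add: mult_left_le)
  ultimately have "hval 1 x [:- hc0 c, hc1 c:] \<le> wt c" unfolding wt_def by auto
  then show ?thesis by (simp add: kap_def)
qed

lemma chord_det: "chord c e = absK (hc0 c * hc1 e - hc1 c * hc0 e) / (wt c * wt e)"
proof (cases c)
  case (Some a)
  then show ?thesis
    by (cases e) (auto simp: kap_def typeI_def wt_simps)
qed (cases e; simp add: kap_def wt_simps)

lemma chord_sym: "chord c e = chord e c"
proof -
  have "absK (hc0 c * hc1 e - hc1 c * hc0 e) = absK (hc0 e * hc1 c - hc1 e * hc0 c)"
    using abs_minus[of "hc0 c * hc1 e - hc1 c * hc0 e"] by (simp add: algebra_simps)
  then show ?thesis by (simp add: chord_det mult.commute)
qed

lemma chord_self [simp]: "chord c c = 0"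
  by (simp add: chord_det)

text \<open>With \<open>D\<close> the determinant of the coordinates of \<open>e\<close> and
  \<open>c\<close>, a coordinate of \<open>e\<close> times the form of \<open>c\<close> combines the
  form of \<open>e\<close> with \<open>D\<close> times 1 or \<open>T\<close>. The coordinate of
  \<open>e\<close> that attains \<open>wt e\<close> gives the claim.\<close>

lemma kap_ultra1:
  assumes x: "x \<in> P1Berk absK"
  shows "kap x c \<le> max (kap x e) (chord e c)"
proof -
  let ?L = "hval 1 x" and ?c = "[:- hc0 c, hc1 c:]" and ?e = "[:- hc0 e, hc1 e:]"
  define D where "D = hc0 e * hc1 c - hc1 e * hc0 c"
  have m: "?L 1 \<le> 1" "?L tT \<le> 1" using hval_1_max[OF x] by (auto simp: max_def split: if_splits)
  have h1: "absK (hc1 e) * ?L ?c \<le> max (absK (hc1 c) * ?L ?e) (absK D * ?L 1)"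
    by (rule hval_combine[OF x]) (simp add: one_pCons D_def algebra_simps)
  have h0: "absK (hc0 e) * ?L ?c \<le> max (absK (hc0 c) * ?L ?e) (absK D * ?L tT)"
    by (rule hval_combine[OF x]) (simp add: D_def algebra_simps)
  have D: "absK D * ?L 1 \<le> absK D" "absK D * ?L tT \<le> absK D"
    using m by (simp_all add: mult_left_le)
  have w: "absK (hc1 c) * ?L ?e \<le> wt c * ?L ?e" "absK (hc0 c) * ?L ?e \<le> wt c * ?L ?e"
    by (auto intro!: mult_right_mono hval_nonneg[OF x] simp: wt_def)
  have "wt e = absK (hc0 e) \<or> wt e = absK (hc1 e)" by (simp add: wt_def max_def)
  then have "wt e * ?L ?c \<le> max (wt c * ?L ?e) (absK D)"
    using order_trans[OF h1 max.mono[OF w(1) D(1)]] order_trans[OF h0 max.mono[OF w(2) D(2)]] by auto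
  then have "wt e * ?L ?c / (wt e * wt c) \<le> max (wt c * ?L ?e) (absK D) / (wt e * wt c)"
    by (intro divide_right_mono) (simp_all add: less_imp_le)
  also have "\<dots> = max (wt c * ?L ?e / (wt e * wt c)) (absK D / (wt e * wt c))"
    by (simp only: max_divide_distrib_right mult_nonneg_nonneg[OF wt_pos(2) wt_pos(2)] if_True)
  finally show ?thesis
    by (simp add: kap_def[of x] chord_det D_def)
qed

text \<open>Dual to the previous inequality: \<open>D\<close> times a coordinate of \<open>x\<close>
  combines the two linear forms, and one of the normalised coordinates of \<open>x\<close> has value
  1.\<close>

lemma kap_ultra2:
  assumes x: "x \<in> P1Berk absK"
  shows "chord e c \<le> max (kap x e) (kap x c)"
proof -
  let ?L = "hval 1 x" and ?c = "[:- hc0 c, hc1 c:]" and ?e = "[:- hc0 e, hc1 e:]"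
  define D where "D = hc0 e * hc1 c - hc1 e * hc0 c"
  have h1: "absK D * ?L 1 \<le> max (absK (hc1 e) * ?L ?c) (absK (- hc1 c) * ?L ?e)"
    by (rule hval_combine[OF x]) (simp add: one_pCons D_def algebra_simps)
  have h0: "absK D * ?L tT \<le> max (absK (hc0 e) * ?L ?c) (absK (- hc0 c) * ?L ?e)"
    by (rule hval_combine[OF x]) (simp add: D_def algebra_simps)
  have w: "absK (hc1 e) * ?L ?c \<le> wt e * ?L ?c" "absK (hc0 e) * ?L ?c \<le> wt e * ?L ?c"
    "absK (- hc1 c) * ?L ?e \<le> wt c * ?L ?e" "absK (- hc0 c) * ?L ?e \<le> wt c * ?L ?e"
    by (auto intro!: mult_right_mono hval_nonneg[OF x] simp: wt_def)
  have "?L 1 = 1 \<or> ?L tT = 1" using hval_1_max[OF x] by (metis max_def)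
  then have "absK D \<le> max (wt e * ?L ?c) (wt c * ?L ?e)"
    using order_trans[OF h1 max.mono[OF w(1) w(3)]] order_trans[OF h0 max.mono[OF w(2) w(4)]] by (metis mult.right_neutral)
  then have "absK D / (wt e * wt c) \<le> max (wt e * ?L ?c) (wt c * ?L ?e) / (wt e * wt c)"
    by (intro divide_right_mono) (simp_all add: less_imp_le)
  also have "\<dots> = max (wt e * ?L ?c / (wt e * wt c)) (wt c * ?L ?e / (wt e * wt c))"
    by (simp only: max_divide_distrib_right mult_nonneg_nonneg[OF wt_pos(2) wt_pos(2)] if_True)
  finally show ?thesis
    by (simp add: kap_def[of x] chord_det D_def max.commute)
qed

text \<open>A form of degree \<open>n\<close> over an algebraically closed field is a product of
  \<open>n\<close> linear forms, a drop of the degree being made up by zeros at infinity. The same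
  \<open>A\<close> and \<open>as\<close> serve all \<open>x\<close>, so the kernel controls every
  polynomial.\<close>

lemma hval_factorization:
  assumes "f \<noteq> 0" "degree f \<le> n"
  shows "\<exists>A>0. \<exists>as. length as = n \<and> (\<forall>x\<in>P1Berk absK. hval n x f = A * prod_list (map (kap x) as))"
  using assms
proof (induction n arbitrary: f)
  case 0
  then obtain c where c: "f = [:c:]" "c \<noteq> 0" by (metis degree_eq_zeroE le_zero_eq pCons_0_0)
  have "hval 0 x f = absK c" if "x \<in> P1Berk absK" for x
    using that by (rule P1Berk_cases) (auto simp: c sem_const)
  then show ?case using c by (intro exI[of _ "absK c"]) auto
next
  case (Suc n)
  obtain c g where g: "g \<noteq> 0" "degree g \<le> n" "f = [:- hc0 c, hc1 c:] * g"
  proof (cases "degree f = Suc n")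
    case True
    then obtain r where "poly f r = 0" using root_exists[of f] by auto
    then obtain g where "f = [:-r, 1:] * g" "g \<noteq> 0" "degree f = Suc (degree g)"
      using poly_factor_root Suc.prems by blast
    then show ?thesis using that[of g "Some r"] True by auto
  next
    case False
    then show ?thesis using that[of f None] Suc.prems by (auto simp flip: one_pCons)
  qed
  from Suc.IH[OF g(1,2)] obtain A as where A: "A > 0" "length as = n"
    "\<forall>x\<in>P1Berk absK. hval n x g = A * prod_list (map (kap x) as)" by blast
  have "hval (Suc n) x f = (wt c * A) * prod_list (map (kap x) (c # as))" if x: "x \<in> P1Berk absK" for x
  proof -
    have "hval (1 + n) x f = hval 1 x [:- hc0 c, hc1 c:] * hval n x g"
      unfolding g(3) by (rule hval_mult[OF x _ g(2)]) (auto simp: degree_pCons_eq_if)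
    then show ?thesis unfolding hval_linear_form[OF x] using A x by simp
  qed
  then show ?case using A by (intro exI[of _ "wt c * A"] conjI exI[of _ "c # as"]) auto
qed

lemma kap_None_eq_0: "x \<in> P1Berk absK \<Longrightarrow> kap x None = 0 \<longleftrightarrow> x = BInf"
  by (erule P1Berk_cases) (auto simp: kap_def wt_simps sem_1 simp flip: one_pCons)

lemma kap_None_BAff: "is_mseminorm absK s \<Longrightarrow> kap (BAff s) None = 1 / max 1 (s tT)"
  by (auto simp: kap_def wt_simps sem_1 simp flip: one_pCons)

lemma sem_eq_hval:
  assumes "is_mseminorm absK s"
  shows "s f = hval n (BAff s) f / kap (BAff s) None ^ n"
  by (simp add: kap_None_BAff[OF assms] power_divide)

text \<open>Products of linear forms exhaust the polynomials, and the value at \<open>None\<close>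
  restores the normalisation, so the kernel determines the seminorm.\<close>

lemma kap_inject:
  assumes x: "x \<in> P1Berk absK" and y: "y \<in> P1Berk absK" and eq: "kap x = kap y"
  shows "x = y"
proof (cases "x = BInf \<or> y = BInf")
  case True
  then show ?thesis using kap_None_eq_0 x y eq by metis
next
  case False
  then obtain s t where st: "x = BAff s" "is_mseminorm absK s" "y = BAff t" "is_mseminorm absK t"
    using x y by (metis P1Berk_cases)
  have "s f = t f" for f
  proof (cases "f = 0")
    case True
    then show ?thesis by (simp add: sem_0 st)
  next
    case False
    from hval_factorization[OF False order.refl]
    have "hval (degree f) x f = hval (degree f) y f" using x y eq by auto
    then show ?thesis
      using sem_eq_hval[OF st(2), of f "degree f"] sem_eq_hval[OF st(4), of f "degree f"] eq st by metis
  qed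
  then show ?thesis using st by (simp add: ext)
qed

text \<open>Berkovich's order compares seminorms, that is the quotients
  \<open>kap x c / kap x None\<close>. Multiplied out, the criterion also covers infinity, where
  \<open>kap x None = 0\<close>.\<close>

lemma berk_le_kap:
  assumes x: "x \<in> P1Berk absK" and y: "y \<in> P1Berk absK"
  shows "berk_le x y \<longleftrightarrow> (\<forall>c. kap x c * kap y None \<le> kap y c * kap x None)"
proof (cases "y = BInf")
  case True
  then show ?thesis
    using kap_nonneg[OF x] kap_nonneg[OF y] kap_None_eq_0[OF y] by (simp add: berk_le_def)
next
  case False
  then obtain t where t: "y = BAff t" "is_mseminorm absK t" using y by (metis P1Berk_cases)
  have yN: "kap y None > 0" using kap_None_eq_0[OF y] kap_nonneg[OF y, of None] False by force
  show ?thesis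
  proof (cases "x = BInf")
    case True
    have "kap x (Some 0) = 1" by (simp add: True kap_def wt_simps)
    then have "\<not> kap x (Some 0) * kap y None \<le> kap y (Some 0) * kap x None"
      using yN kap_None_eq_0[OF x] True by simp
    then show ?thesis using True t by (auto simp: berk_le_def)
  next
    case False
    then obtain s where s: "x = BAff s" "is_mseminorm absK s" using x by (metis P1Berk_cases)
    have xN: "kap x None > 0" using kap_None_eq_0[OF x] kap_nonneg[OF x, of None] False by force
    have slin: "s [:- hc0 c, hc1 c:] = wt c * kap x c / kap x None"
      "t [:- hc0 c, hc1 c:] = wt c * kap y c / kap y None" for c
      using sem_eq_hval[OF s(2), of "[:- hc0 c, hc1 c:]" 1] sem_eq_hval[OF t(2), of "[:- hc0 c, hc1 c:]" 1]
      unfolding s(1)[symmetric] t(1)[symmetric] hval_linear_form[OF x] hval_linear_form[OF y] by simp_all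
    have "berk_le x y \<longleftrightarrow> (\<forall>f. s f \<le> t f)" using s t by (auto simp: berk_le_def)
    also have "\<dots> \<longleftrightarrow> (\<forall>c. kap x c / kap x None \<le> kap y c / kap y None)"
    proof (intro iffI allI)
      fix c assume "\<forall>f. s f \<le> t f"
      then have "s [:- hc0 c, hc1 c:] \<le> t [:- hc0 c, hc1 c:]" by blast
      then have "wt c * (kap x c / kap x None) \<le> wt c * (kap y c / kap y None)" by (simp add: slin)
      then show "kap x c / kap x None \<le> kap y c / kap y None" by (simp only: mult_le_cancel_left_pos[OF wt_pos(1)])
    next
      fix f assume *: "\<forall>c. kap x c / kap x None \<le> kap y c / kap y None"
      show "s f \<le> t f"
      proof (cases "f = 0")
        case False
        define n where "n = degree f"
        from hval_factorization[OF False order.refl] obtain A as where A: "A > 0" "length as = n"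
          "\<forall>x\<in>P1Berk absK. hval n x f = A * prod_list (map (kap x) as)" unfolding n_def by blast
        have div: "prod_list (map (\<lambda>c. g c / r) as) = prod_list (map g as) / r ^ length as" for g :: "'a option \<Rightarrow> real" and r
          by (induction as) auto
        have "s f = A * prod_list (map (\<lambda>c. kap x c / kap x None) as)"
          using sem_eq_hval[OF s(2), of f n] A x s by (simp add: div del: hval_simps)
        also have "\<dots> \<le> A * prod_list (map (\<lambda>c. kap y c / kap y None) as)"
          using prod_list_map_mono[of as "\<lambda>c. kap x c / kap x None" "\<lambda>c. kap y c / kap y None"] * A xN kap_nonneg[OF x] by simp
        also have "\<dots> = t f"
          using sem_eq_hval[OF t(2), of f n] A y t by (simp add: div del: hval_simps)
        finally show ?thesis .
      qed (simp add: sem_0 s t)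
    qed
    also have "\<dots> \<longleftrightarrow> (\<forall>c. kap x c * kap y None \<le> kap y c * kap x None)"
      using xN yN by (simp add: field_simps)
    finally show ?thesis .
  qed
qed

declare pt.simps [simp del]

section \<open>Realisation of tight functions as kernels\<close>

lemma chord_ultra: "chord a c \<le> max (chord a b) (chord b c)"
  using kap_ultra1[OF pt_in] .

text \<open>Either \<open>b\<close> can be moved by a translation that leaves its weight unchanged,
  or \<open>b\<close> is within \<open>u\<close> of infinity and points of suitable large value
  serve.\<close>

lemma chord_dense:
  assumes "0 \<le> u" "u < w" "w \<le> 1"
  obtains c where "u < chord b c" "chord b c < w"
proof (cases "\<exists>a. b = Some a \<and> u < 1 / max 1 (absK a)")
  case True
  then obtain a where b: "b = Some a" and a: "u < 1 / max 1 (absK a)" by blast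
  define m where "m = max 1 (absK a)"
  have m: "m \<ge> 1" by (simp add: m_def)
  \<comment> \<open>The bound \<open>1 / m\<close> forces \<open>absK z < m\<close>, which keeps the
    weight of \<open>a + z\<close> equal to \<open>m\<close>.\<close>
  define w' where "w' = min w (1 / m)"
  have "u * m\<^sup>2 < w' * m\<^sup>2" using assms a m by (auto simp: w'_def m_def[symmetric])
  then obtain z where z: "u * m\<^sup>2 < absK z" "absK z < w' * m\<^sup>2"
    using value_group_dense[of "u * m\<^sup>2" "w' * m\<^sup>2"] assms by auto
  have "w' * m\<^sup>2 \<le> 1 / m * m\<^sup>2" by (intro mult_right_mono) (auto simp: w'_def)
  also have "\<dots> = m" using m by (simp add: power2_eq_square)
  finally have "w' * m\<^sup>2 \<le> m" .
  then have zm: "absK z < m" using z by linarith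
  have "max 1 (absK (a + z)) = m"
  proof (cases "absK a \<le> 1")
    case True
    then show ?thesis using zm abs_add[of a z] by (auto simp: m_def)
  next
    case False
    then have "m = absK a" by (simp add: m_def)
    then have "absK (a + z) = absK a" using zm abs_add[of a z] abs_diff[of "a + z" z] by auto
    then show ?thesis using m_def by simp
  qed
  then have "chord b (Some (a + z)) = absK z / m\<^sup>2"
    by (simp add: b chord_det wt_simps m_def power2_eq_square)
  moreover have "u < absK z / m\<^sup>2" "absK z / m\<^sup>2 < w'" using z m by (auto simp: field_simps)
  ultimately show ?thesis using that[of "Some (a + z)"] by (auto simp: w'_def)
next
  case False
  have w0: "0 < w" using assms by simp
  obtain z where z: "1 / w < absK z" "0 < u \<longrightarrow> absK z < 1 / u"
  proof (cases "u = 0")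
    case True
    then show ?thesis using value_group_dense[of "1 / w" "1 / w + 1"] w0 that by force
  next
    case False
    then have "1 / w < 1 / u" using assms by (auto simp: frac_less2)
    then show ?thesis using value_group_dense[of "1 / w" "1 / u"] w0 that False by force
  qed
  have z1: "absK z > 1" using z(1) assms w0 by (smt (verit) le_divide_eq_1_pos)
  have "chord b (Some z) = 1 / absK z"
  proof (cases b)
    case None
    then show ?thesis using z1 by (simp add: chord_det wt_simps)
  next
    case (Some a)
    then have au: "1 / max 1 (absK a) \<le> u" using False by auto
    then have "0 < u" by (smt (verit) divide_pos_pos)
    then have "1 / u \<le> max 1 (absK a)" using au by (simp add: field_simps)
    then have az: "absK z < absK a" using z \<open>0 < u\<close> z1 by auto
    have "absK (a - z) = absK a" using abs_diff[of a z] abs_add[of "a - z" z] az by auto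
    moreover have "absK a > 0" using az z1 by linarith
    ultimately show ?thesis using Some z1 az by (auto simp: chord_det wt_simps)
  qed
  moreover have "1 / absK z < w"
  proof -
    have "1 < absK z * w" using z(1) w0 by (simp add: pos_divide_less_eq)
    moreover have "0 < absK z" using z1 by linarith
    ultimately show ?thesis by (simp only: pos_divide_less_eq mult.commute)
  qed
  moreover have "u < 1 / absK z"
  proof (cases "u = 0")
    case False
    then have "u * absK z < 1" using z(2) assms by (simp add: pos_less_divide_eq mult.commute)
    moreover have "0 < absK z" using z1 by linarith
    ultimately show ?thesis by (simp only: pos_less_divide_eq)
  qed (use z1 in auto)
  ultimately show ?thesis using that by metis
qed

definition tight :: "('a option \<Rightarrow> real) \<Rightarrow> bool" where
  "tight k \<longleftrightarrow> (\<forall>c. 0 \<le> k c \<and> k c \<le> 1) \<and> (\<forall>c e. k c \<le> max (k e) (chord e c) \<and> chord e c \<le> max (k e) (k c))"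

lemma tight_kap: "x \<in> P1Berk absK \<Longrightarrow> tight (kap x)"
  by (simp add: tight_def kap_nonneg kap_le_1 kap_ultra1 kap_ultra2)

lemma tightD:
  assumes "tight k"
  shows "0 \<le> k c" "k c \<le> 1" "k c \<le> max (k e) (chord e c)" "chord e c \<le> max (k e) (k c)"
  using assms by (auto simp: tight_def)

lemma tight_bdd_below: "tight k \<Longrightarrow> bdd_below (range k)"
  by (auto simp: tight_def)

text \<open>The point \<open>c j\<close> is chosen at a distance slightly larger than \<open>k (b j)\<close> from \<open>b j\<close>, where \<open>k (b j)\<close> nearly
  attains the infimum of \<open>k\<close>; this avoids ties in the ultrametric inequality.\<close>

lemma tight_approx:
  assumes k: "tight k"
  obtains c where "\<And>b. (\<lambda>j::nat. chord (c j) b) \<longlonglongrightarrow> k b"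
proof (cases "(INF b. k b) < 1")
  case True
  define i where "i = (INF b. k b)"
  have ik: "i \<le> k b" for b unfolding i_def by (rule cINF_lower[OF tight_bdd_below[OF k]]) simp
  have "\<exists>b. k b < min 1 (i + 1 / real (Suc j))" for j
  proof -
    have "(INF b. k b) < min 1 (i + 1 / real (Suc j))" using True by (simp add: i_def[symmetric])
    then obtain y where "y \<in> range k" "y < min 1 (i + 1 / real (Suc j))" using cInf_lessD[of "range k"] by blast
    then show ?thesis by blast
  qed
  then obtain b where b: "\<And>j. k (b j) < min 1 (i + 1 / real (Suc j))" by metis
  have "\<exists>c. k (b j) < chord (b j) c \<and> chord (b j) c < min 1 (k (b j) + 1 / real (Suc j))" for j
    using chord_dense[of "k (b j)" "min 1 (k (b j) + 1 / real (Suc j))" "b j"] b[of j] tightD(1)[OF k] by auto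
  then obtain c where c: "\<And>j. k (b j) < chord (b j) (c j)"
      "\<And>j. chord (b j) (c j) < min 1 (k (b j) + 1 / real (Suc j))" by metis
  define w where "w j = chord (b j) (c j)" for j
  have w: "k (b j) < w j" "w j < i + 2 * (1 / real (Suc j))" for j
    using c(1)[of j] c(2)[of j] b[of j] by (auto simp: w_def)
  have lim: "(\<lambda>j. i + 2 * (1 / real (Suc j))) \<longlonglongrightarrow> i"
  proof -
    have "(\<lambda>j. i + 2 * (1 / real (Suc j))) \<longlonglongrightarrow> i + 2 * 0"
      by (intro tendsto_intros LIMSEQ_Suc[OF lim_1_over_n])
    then show ?thesis by simp
  qed
  have "i \<le> w j" "w j \<le> i + 2 * (1 / real (Suc j))" for j using ik[of "b j"] w[of j] by linarith+
  then have wlim: "w \<longlonglongrightarrow> i"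
    by (intro tendsto_sandwich[OF _ _ tendsto_const lim] always_eventually) auto
  show ?thesis
  proof (rule that[of c])
    fix \<beta>
    show "(\<lambda>j. chord (c j) \<beta>) \<longlonglongrightarrow> k \<beta>"
    proof (cases "k \<beta> = i")
      case True
      have "chord (c j) \<beta> = w j" for j
      proof -
        have "chord (b j) \<beta> \<le> k (b j)" using tightD(4)[OF k, of "b j" \<beta>] ik[of "b j"] True by auto
        then have "chord (b j) \<beta> < w j" using w(1)[of j] by simp
        then show ?thesis
          using chord_ultra[of "c j" \<beta> "b j"] chord_ultra[of "b j" "c j" \<beta>] chord_sym[of \<beta> "c j"] chord_sym[of "c j" "b j"]
          by (auto simp: w_def)
      qed
      then show ?thesis using wlim True by simp
    next
      case False
      then have "i < k \<beta>" using ik[of \<beta>] by simp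
      have "\<forall>\<^sub>F j in sequentially. chord (c j) \<beta> = k \<beta>"
        using order_tendstoD(2)[OF wlim \<open>i < k \<beta>\<close>]
      proof eventually_elim
        case (elim j)
        have "chord (b j) \<beta> = k \<beta>"
          using tightD(3)[OF k, of \<beta> "b j"] tightD(4)[OF k, of "b j" \<beta>] w(1)[of j] elim by auto
        then show ?case
          using chord_ultra[of "c j" \<beta> "b j"] chord_ultra[of "b j" \<beta> "c j"] chord_sym[of "c j" "b j"] elim
          by (auto simp: w_def)
      qed
      then show ?thesis by (rule tendsto_eventually)
    qed
  qed
next
  case False
  have k1: "k b = 1" for b
    using False cINF_lower[OF tight_bdd_below[OF k], of b] tightD(2)[OF k, of b] by simp
  \<comment> \<open>Here \<open>k\<close> is the kernel of the Gauss point. It is approached by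
    points that stay in the open residue ball of infinity but tend to its boundary.\<close>
  have "\<exists>c. 1 - 1 / real (Suc j) < chord None c \<and> chord None c < 1" for j
    using chord_dense[of "1 - 1 / real (Suc j)" 1 None] by auto
  then obtain c where c: "\<And>j. 1 - 1 / real (Suc j) < chord None (c j)" "\<And>j. chord None (c j) < 1" by metis
  have lim: "(\<lambda>j. 1 - 1 / real (Suc j)) \<longlonglongrightarrow> 1"
  proof -
    have "(\<lambda>j. 1 - 1 / real (Suc j)) \<longlonglongrightarrow> 1 - 0"
      by (intro tendsto_intros LIMSEQ_Suc[OF lim_1_over_n])
    then show ?thesis by simp
  qed
  have wlim: "(\<lambda>j. chord None (c j)) \<longlonglongrightarrow> 1"
    by (rule tendsto_sandwich[OF _ _ lim tendsto_const])
      (use c in \<open>auto intro!: always_eventually intro: less_imp_le\<close>)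
  show ?thesis
  proof (rule that[of c])
    fix \<beta>
    show "(\<lambda>j. chord (c j) \<beta>) \<longlonglongrightarrow> k \<beta>"
    proof (cases "chord None \<beta> < 1")
      case True
      have "\<forall>\<^sub>F j in sequentially. chord None (c j) = chord (c j) \<beta>"
        using order_tendstoD(1)[OF wlim True]
      proof eventually_elim
        case (elim j)
        then show ?case
          using chord_ultra[of "c j" \<beta> None] chord_ultra[of None "c j" \<beta>] chord_sym[of \<beta> "c j"] chord_sym[of "c j" None]
          by auto
      qed
      from tendsto_cong[OF this, of 1] wlim show ?thesis by (simp add: k1)
    next
      case False
      then have "chord None \<beta> = 1" using kap_le_1[OF pt_in, of None \<beta>] by simp
      then have "chord (c j) \<beta> = 1" for j
        using chord_ultra[of None \<beta> "c j"] kap_le_1[OF pt_in, of "c j" \<beta>] c(2)[of j] by (auto simp: max_def split: if_splits)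
      then show ?thesis by (simp add: k1)
    qed
  qed
qed

text \<open>The kernel is a limit of kernels of points of P1(K). While the value at
  \<open>None\<close> stays away from 0, the value of a polynomial depends continuously on the
  kernel, so the seminorms of these points converge and their limit realises \<open>k\<close>. No
  nested discs are needed.\<close>

lemma tight_realized:
  assumes k: "tight k"
  obtains x where "x \<in> P1Berk absK" "kap x = k"
proof (cases "k None = 0")
  case True
  have "chord None c = k c" for c
    using tightD(3)[OF k, of c None] tightD(4)[OF k, of None c] tightD(1)[OF k, of c] kap_nonneg[OF pt_in, of None c] True
    by auto
  then show ?thesis using that[of "pt None"] pt_in by (metis ext)
next
  case False
  then have kN: "k None > 0" using tightD(1)[OF k, of None] by simp
  obtain c where c: "\<And>b. (\<lambda>j::nat. chord (c j) b) \<longlonglongrightarrow> k b" using tight_approx[OF k] by blast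
  have "\<forall>\<^sub>F j in sequentially. chord (c j) None > 0" using order_tendstoD(1)[OF c kN] .
  then obtain J where J: "\<And>j. j \<ge> J \<Longrightarrow> chord (c j) None > 0" unfolding eventually_sequentially by blast
  define z where "z j = the (c (j + J))" for j
  have cz: "c (j + J) = Some (z j)" for j
    using J[of "j + J"] chord_self[of None] unfolding z_def by (cases "c (j + J)") auto
  define S where "S j = (\<lambda>f. absK (poly f (z j)))" for j
  have S: "is_mseminorm absK (S j)" "pt (c (j + J)) = BAff (S j)" for j
    by (auto simp: S_def typeI_mseminorm cz typeI_def pt.simps)
  have lim: "(\<lambda>j. kap (BAff (S j)) b) \<longlonglongrightarrow> k b" for b
    using LIMSEQ_ignore_initial_segment[OF c[of b], of J] S(2) by simp
  have conv: "convergent (\<lambda>j. S j f)" for f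
  proof (cases "f = 0")
    case False
    define n where "n = degree f"
    from hval_factorization[OF False order.refl] obtain A as where A: "length as = n"
      "\<forall>x\<in>P1Berk absK. hval n x f = A * prod_list (map (kap x) as)" unfolding n_def by blast
    have "S j f = A * prod_list (map (kap (BAff (S j))) as) / kap (BAff (S j)) None ^ n" for j
      using sem_eq_hval[OF S(1), of j f n] A(2) S(1)[of j] by (simp del: hval_simps)
    moreover have "(\<lambda>j. A * prod_list (map (kap (BAff (S j))) as) / kap (BAff (S j)) None ^ n)
        \<longlonglongrightarrow> A * prod_list (map k as) / k None ^ n"
      using kN by (intro tendsto_intros tendsto_prod_list_map lim) auto
    ultimately show ?thesis by (auto simp: convergent_def)
  qed (simp add: S_def convergent_const)
  define s where "s f = lim (\<lambda>j. S j f)" for f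
  have s: "(\<lambda>j. S j f) \<longlonglongrightarrow> s f" for f
    using conv[of f] by (simp add: s_def convergent_LIMSEQ_iff)
  have "is_mseminorm absK s"
    unfolding is_mseminorm_def
  proof (intro conjI allI)
    show "0 \<le> s f" for f
      by (rule LIMSEQ_le_const[OF s]) (auto simp: S_def)
    show "s [:c:] = absK c" for c
      using s[of "[:c:]"] by (simp add: S_def LIMSEQ_const_iff)
    show "s (f * g) = s f * s g" for f g
    proof (rule LIMSEQ_unique[OF s])
      show "(\<lambda>j. S j (f * g)) \<longlonglongrightarrow> s f * s g"
        using tendsto_mult[OF s s, of f g] by (simp add: S_def abs_mult)
    qed
    show "s (f + g) \<le> s f + s g" for f g
      by (rule LIMSEQ_le[OF s tendsto_add[OF s s]]) (auto intro: sem_triangle[OF S(1)])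
  qed
  moreover have "kap (BAff s) b = k b" for b
  proof (rule LIMSEQ_unique[OF _ lim])
    have "max 1 (s tT) ^ 1 \<noteq> 0" by auto
    then show "(\<lambda>j. kap (BAff (S j)) b) \<longlonglongrightarrow> kap (BAff s) b"
      unfolding kap_def hval_simps by (intro tendsto_divide tendsto_power tendsto_max tendsto_const s wt_pos)
  qed
  ultimately show ?thesis using that[of "BAff s"] by auto
qed

lemma tight_max: "tight k \<Longrightarrow> tight l \<Longrightarrow> tight (\<lambda>c. max (k c) (l c))"
  unfolding tight_def by (smt (verit) max_def)

lemma tight_max_const: "tight k \<Longrightarrow> 0 \<le> t \<Longrightarrow> t \<le> 1 \<Longrightarrow> tight (\<lambda>c. max (k c) t)"
  unfolding tight_def by (smt (verit) max_def)

lemma tight_one: "tight (\<lambda>_. 1)"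
  by (simp add: tight_def kap_le_1)

text \<open>Instead of the Gauss lemma: the maximum of the coefficients is submultiplicative, so by comparison
  on linear factors it is bounded by the multiplicative seminorm with kernel 1.\<close>

lemma gauss_point: "gauss absK \<in> P1Berk absK" "kap (gauss absK) c = 1"
proof -
  define N where "N f = Max ((\<lambda>i. absK (coeff f i)) ` {..degree f})" for f
  have coeff_N: "absK (coeff f i) \<le> N f" for f i
  proof (cases "i \<le> degree f")
    case False
    then have "absK (coeff f i) \<le> absK (coeff f 0)" by (simp add: coeff_eq_0)
    also have "\<dots> \<le> N f" unfolding N_def by (rule Max_ge) auto
    finally show ?thesis .
  qed (auto simp: N_def intro!: Max_ge)
  have N_le: "N f \<le> r" if "\<And>i. absK (coeff f i) \<le> r" for f r
    unfolding N_def using that by (subst Max_le_iff) auto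
  have N_nonneg: "0 \<le> N f" for f using coeff_N[of f 0] abs_nonneg order_trans by blast
  have abs_sum: "absK (\<Sum>i\<in>I. g i) \<le> r" if "finite I" "0 \<le> r" "\<And>i. i \<in> I \<Longrightarrow> absK (g i) \<le> r" for I :: "nat set" and g r
    using that
  proof (induction I rule: finite_induct)
    case (insert i I)
    then have "absK (g i) \<le> r" "absK (sum g I) \<le> r" by auto
    then show ?case using insert.hyps abs_add[of "g i" "sum g I"] by simp
  qed simp
  have N_mult: "N (f * g) \<le> N f * N g" for f g
    by (rule N_le) (auto simp: coeff_mult abs_mult intro!: abs_sum mult_mono coeff_N mult_nonneg_nonneg N_nonneg)
  obtain x where x: "x \<in> P1Berk absK" "kap x = (\<lambda>_. 1)" using tight_realized[OF tight_one] by blast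
  then have "x \<noteq> BInf" using kap_None_eq_0[OF x(1)] by auto
  then obtain s where s: "x = BAff s" "is_mseminorm absK s" using x(1) by (metis P1Berk_cases)
  have "s f = N f" for f
  proof (rule antisym)
    have sT: "s tT \<le> 1"
      using kap_None_BAff[OF s(2)] x(2) s(1) by (simp add: max_def split: if_splits)
    have ssum: "s (\<Sum>i\<in>I. g i) \<le> r" if "finite I" "0 \<le> r" "\<And>i. i \<in> I \<Longrightarrow> s (g i) \<le> r" for I :: "nat set" and g r
      using that
    proof (induction I rule: finite_induct)
      case (insert i I)
      then have "s (g i) \<le> r" "s (sum g I) \<le> r" by auto
      then show ?case using insert.hyps sem_add[OF s(2), of "g i" "sum g I"] by simp
    qed (simp add: sem_0[OF s(2)])
    have "s f = s (\<Sum>i\<le>degree f. smult (coeff f i) (tT ^ i))"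
      by (rule arg_cong[where f = s]) (simp add: poly_as_sum_of_monoms flip: monom_altdef)
    also have "s (\<Sum>i\<le>degree f. smult (coeff f i) (tT ^ i)) \<le> N f"
    proof (intro ssum N_nonneg)
      fix i
      have "s (smult (coeff f i) (tT ^ i)) = absK (coeff f i) * s tT ^ i"
        by (simp add: sem_smult[OF s(2)] sem_power[OF s(2)])
      also have "\<dots> \<le> N f * 1" by (intro mult_mono coeff_N power_le_one sT sem_nonneg[OF s(2)] N_nonneg zero_le_power)
      finally show "s (smult (coeff f i) (tT ^ i)) \<le> N f" by simp
    qed simp
    finally show "s f \<le> N f" .
    show "N f \<le> s f"
    proof (induction "degree f" arbitrary: f)
      case 0
      then obtain c where "f = [:c:]" by (metis degree_eq_zeroE)
      then show ?case by (simp add: N_def sem_const[OF s(2)])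
    next
      case (Suc n)
      then obtain r where "poly f r = 0" using root_exists[of f] by auto
      then obtain g where g: "f = [:-r, 1:] * g" "degree f = Suc (degree g)"
        using poly_factor_root[of f r] Suc.hyps(2) by force
      have "N [:-r, 1:] \<le> max 1 (absK r)"
        by (rule N_le) (auto simp: coeff_pCons split: nat.splits)
      moreover have "s [:-r, 1:] = max 1 (absK r)"
        using hval_linear_form[OF x(1), of "Some r"] sem_eq_hval[OF s(2), of "[:-r,1:]" 1]
        unfolding s(1)[symmetric] x(2) by (simp add: wt_simps del: hval_simps)
      ultimately have "N [:-r, 1:] \<le> s [:-r, 1:]" by simp
      moreover have "N g \<le> s g" using Suc.hyps(1)[of g] Suc.hyps(2) g(2) by simp
      ultimately have "N [:-r, 1:] * N g \<le> s [:-r, 1:] * s g"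
        by (intro mult_mono N_nonneg sem_nonneg[OF s(2)])
      then show ?case using N_mult[of "[:-r, 1:]" g] by (simp only: g(1) sem_mult[OF s(2)])
    qed
  qed
  then have "gauss absK = x" unfolding gauss_def s(1) N_def by auto
  then show "gauss absK \<in> P1Berk absK" "kap (gauss absK) c = 1" using x by auto
qed

section \<open>From the order rooted at infinity to the order rooted at the Gauss point\<close>

abbreviation berk_leG :: "'a berk \<Rightarrow> 'a berk \<Rightarrow> bool" where
  "berk_leG x y \<equiv> kap x \<le> kap y"

text \<open>A point \<open>z\<close> above infinity bounds the ball of radius
  \<open>kap z None\<close> around infinity, and everything in that ball lies below it.\<close>

lemma leG_of_None_le:
  assumes "w \<in> P1Berk absK" "z \<in> P1Berk absK" "chord None \<le> kap z" "kap w None \<le> kap z None"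
  shows "berk_leG w z"
proof (rule le_funI)
  fix b
  have "chord None b \<le> kap z b" using assms(3) by (auto simp: le_fun_def)
  then show "kap w b \<le> kap z b"
    using kap_ultra1[OF assms(1), of b None] kap_ultra1[OF assms(2), of None b] assms(4) chord_sym[of b None] by auto
qed

text \<open>The value at \<open>None\<close> starts to grow only where the path from
  \<open>x\<close> has met the path from infinity; from there on its points lie above
  infinity.\<close>

lemma None_leG:
  assumes "x \<in> P1Berk absK" "w \<in> P1Berk absK" "berk_leG x w" "kap x None < kap w None"
  shows "chord None \<le> kap w"
proof (rule le_funI)
  fix b
  have "kap x b \<le> kap w b" using assms(3) by (auto simp: le_fun_def)
  then show "chord None b \<le> kap w b"
    using kap_ultra2[OF assms(1), of None b] kap_ultra1[OF assms(2), of None b] assms(4) chord_sym[of b None] by auto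
qed

text \<open>On the path from \<open>x\<close> to \<open>\<infinity>\<close> one first climbs towards the Gauss point, with constant value
  at \<open>\<infinity>\<close>, and then descends along the points lying above \<open>\<infinity>\<close>.\<close>

lemma berk_le_iff_leG:
  assumes x: "x \<in> P1Berk absK" and z: "z \<in> P1Berk absK"
  shows "berk_le x z \<longleftrightarrow> berk_leG x z \<and> kap x None = kap z None \<or> chord None \<le> kap z \<and> kap z None \<le> kap x None"
    (is "_ \<longleftrightarrow> ?R")
proof
  assume "berk_le x z"
  then have le: "kap x b * kap z None \<le> kap z b * kap x None" for b
    using berk_le_kap[OF x z] by blast
  have "chord None (Some 0) = 1" by (simp add: chord_det wt_simps)
  then have one: "kap x None = 1 \<or> kap x (Some 0) = 1"
    using kap_ultra2[OF x, of None "Some 0"] kap_le_1[OF x, of None] kap_le_1[OF x, of "Some 0"] by auto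
  have zx: "kap z None \<le> kap x None"
    using one
  proof
    assume "kap x (Some 0) = 1"
    then have "kap z None \<le> kap z (Some 0) * kap x None" using le[of "Some 0"] by simp
    also have "\<dots> \<le> 1 * kap x None" by (intro mult_right_mono kap_le_1[OF z] kap_nonneg[OF x])
    finally show ?thesis by simp
  qed (use kap_le_1[OF z] in simp)
  show ?R
  proof (cases "kap z None = kap x None")
    case True
    show ?thesis
    proof (cases "kap x None = 0")
      case True
      then have "x = BInf" "z = BInf" using \<open>kap z None = kap x None\<close> kap_None_eq_0 x z by metis+
      then show ?thesis by simp
    next
      case False
      then have "kap x None > 0" using kap_nonneg[OF x, of None] by simp
      then have "kap x b \<le> kap z b" for b
        using le[of b] True by (simp add: mult_le_cancel_right)
      then show ?thesis using True by (auto simp: le_fun_def)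
    qed
  next
    case False
    then have lt: "kap z None < kap x None" using zx by simp
    have "chord None b \<le> kap z b" for b
    proof (rule ccontr)
      assume "\<not> chord None b \<le> kap z b"
      then have n: "kap z b < chord None b" "chord None b \<le> kap z None"
        using kap_ultra2[OF z, of None b] by auto
      then have "kap x None \<le> kap x b"
        using kap_ultra1[OF x, of None b] chord_sym[of b None] lt by auto
      then have "kap x None * kap z None \<le> kap z b * kap x None"
        using le[of b] mult_right_mono[of "kap x None" "kap x b" "kap z None"] kap_nonneg[OF z, of None] by linarith
      then have "kap z None \<le> kap z b"
        using lt kap_nonneg[OF z, of None] by (metis mult.commute mult_le_cancel_right_pos order.strict_trans1)
      then show False using n by simp
    qed
    then show ?thesis using zx by (auto simp: le_fun_def)
  qed
next
  assume R: ?R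
  have "kap x b * kap z None \<le> kap z b * kap x None" for b
    using R
  proof
    assume "berk_leG x z \<and> kap x None = kap z None"
    then show ?thesis by (auto simp: le_fun_def intro!: mult_right_mono kap_nonneg[OF z])
  next
    assume "chord None \<le> kap z \<and> kap z None \<le> kap x None"
    then have h: "chord None b \<le> kap z b" "kap z None \<le> kap x None" by (auto simp: le_fun_def)
    show ?thesis
    proof (cases "kap x b \<le> kap z b")
      case True
      then show ?thesis using h by (intro mult_mono kap_nonneg x z)
    next
      case False
      then have "kap x b \<le> kap x None" "kap z None \<le> kap z b"
        using kap_ultra1[OF x, of b None] kap_ultra1[OF z, of None b] chord_sym[of b None] h by auto
      then have "kap x b * kap z None \<le> kap x None * kap z b"
        by (intro mult_mono kap_nonneg x z)
      then show ?thesis by (simp add: mult.commute)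
    qed
  qed
  then show "berk_le x z" using berk_le_kap[OF x z] by blast
qed

text \<open>Re-rooting: paths are defined by the order rooted at infinity, and turning them into
  order intervals below the Gauss point makes \<open>join_G\<close> and \<open>Q_pt\<close>
  computable on kernels.\<close>

lemma berk_path_leG:
  assumes x: "x \<in> P1Berk absK" and z: "z \<in> P1Berk absK" and xz: "berk_leG x z"
  shows "berk_path absK x z = {w \<in> P1Berk absK. berk_leG x w \<and> berk_leG w z}"
proof (intro set_eqI iffI)
  fix w assume "w \<in> {w \<in> P1Berk absK. berk_leG x w \<and> berk_leG w z}"
  then have w: "w \<in> P1Berk absK" "berk_leG x w" "berk_leG w z" by auto
  have XWZ: "kap x None \<le> kap w None" "kap w None \<le> kap z None" using w by (auto simp: le_fun_def)
  have "berk_le x w \<or> berk_le z w"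
  proof (cases "kap x None = kap w None")
    case True
    then show ?thesis using berk_le_iff_leG x w by auto
  next
    case False
    then have "chord None \<le> kap w" using None_leG[OF x w(1,2)] XWZ by simp
    then show ?thesis using berk_le_iff_leG[OF z w(1)] XWZ by auto
  qed
  moreover have "berk_le w v" if v: "v \<in> P1Berk absK" "berk_le x v" "berk_le z v" for v
  proof -
    have "berk_leG x v \<and> kap x None = kap v None \<or> chord None \<le> kap v \<and> kap v None \<le> kap x None"
      "berk_leG z v \<and> kap z None = kap v None \<or> chord None \<le> kap v \<and> kap v None \<le> kap z None"
      using v berk_le_iff_leG x z by auto
    then show ?thesis unfolding berk_le_iff_leG[OF w(1) v(1)]
      using XWZ order_trans[OF w(3), of "kap v"] by auto
  qed
  ultimately show "w \<in> berk_path absK x z" using w by (auto simp: berk_path_def)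
next
  fix w assume "w \<in> berk_path absK x z"
  then have w: "w \<in> P1Berk absK" "berk_le x w \<or> berk_le z w"
    "\<And>v. v \<in> P1Berk absK \<Longrightarrow> berk_le x v \<Longrightarrow> berk_le z v \<Longrightarrow> berk_le w v"
    by (auto simp: berk_path_def)
  have XZ: "kap x None \<le> kap z None" using xz by (auto simp: le_fun_def)
  have z_above: "chord None \<le> kap z" if "kap x None < kap z None"
    using None_leG[OF x z xz] that by simp
  have XW: "kap x None \<le> kap w None"
  proof (cases "kap x None = kap z None")
    case True
    then have "berk_le x z" "berk_le z z" using berk_le_iff_leG x z xz by auto
    then have "berk_le w z" using w z by blast
    then show ?thesis using berk_le_iff_leG[OF w(1) z] True by auto
  next
    case False
    \<comment> \<open>The point above infinity whose value at \<open>None\<close> is that of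
      \<open>x\<close>. It bounds \<open>x\<close> and \<open>z\<close> in the order rooted at
      infinity, and lying below it bounds \<open>kap w None\<close> from below.\<close>
    obtain v where v: "v \<in> P1Berk absK" "kap v = (\<lambda>c. max (chord None c) (kap x None))"
      using tight_realized[OF tight_max_const[OF tight_kap[OF pt_in]]] kap_nonneg[OF x] kap_le_1[OF x] by metis
    have vN: "kap v None = kap x None" "chord None \<le> kap v"
      using v kap_nonneg[OF x, of None] chord_self[of None] by (auto simp: le_fun_def)
    then have "berk_le x v" "berk_le z v" using XZ v(1) berk_le_iff_leG x z by auto
    then have "berk_le w v" using w v by blast
    then show ?thesis using berk_le_iff_leG[OF w(1) v(1)] vN by auto
  qed
  have xw: "berk_leG x w" and WZ: "kap w None \<le> kap z None"
  proof -
    have "berk_leG x w \<or> chord None \<le> kap w" "kap w None \<le> kap z None"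
      using w(2) berk_le_iff_leG[OF x w(1)] berk_le_iff_leG[OF z w(1)] XZ order_trans[OF xz] by auto
    then show "berk_leG x w" "kap w None \<le> kap z None"
      using leG_of_None_le[OF x w(1)] XW by auto
  qed
  have "berk_leG w z"
  proof (cases "kap x None < kap z None")
    case True
    then show ?thesis using leG_of_None_le[OF w(1) z z_above] WZ by simp
  next
    case False
    then have eq: "kap x None = kap z None" using XZ by simp
    then have "berk_le x z" "berk_le z z" using berk_le_iff_leG x z xz by auto
    then have "berk_le w z" using w z by blast
    then show ?thesis using berk_le_iff_leG[OF w(1) z] leG_of_None_le[OF w(1) z] WZ by auto
  qed
  then show "w \<in> {w \<in> P1Berk absK. berk_leG x w \<and> berk_leG w z}" using w xw by auto
qed

lemma leG_gauss: "x \<in> P1Berk absK \<Longrightarrow> berk_leG x (gauss absK)"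
  by (simp add: le_fun_def gauss_point kap_le_1)

lemma berk_path_gauss:
  "x \<in> P1Berk absK \<Longrightarrow> berk_path absK x (gauss absK) = {w \<in> P1Berk absK. berk_leG x w}"
  using berk_path_leG[OF _ gauss_point(1) leG_gauss] leG_gauss by auto

lemma leG_antisym: "x \<in> P1Berk absK \<Longrightarrow> y \<in> P1Berk absK \<Longrightarrow> berk_leG x y \<Longrightarrow> berk_leG y x \<Longrightarrow> x = y"
  using kap_inject by (metis antisym)

lemma join_G_kap:
  assumes x: "x \<in> P1Berk absK" and y: "y \<in> P1Berk absK"
  shows "join_G absK x y \<in> P1Berk absK" "kap (join_G absK x y) = (\<lambda>c. max (kap x c) (kap y c))"
proof -
  obtain z where z: "z \<in> P1Berk absK" "kap z = (\<lambda>c. max (kap x c) (kap y c))"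
    using tight_realized[OF tight_max[OF tight_kap[OF x] tight_kap[OF y]]] by blast
  have xz: "berk_leG x z" "berk_leG y z" using z by (auto simp: le_fun_def)
  have zle: "berk_leG z w" if "berk_leG x w" "berk_leG y w" for w
    using that z by (auto simp: le_fun_def)
  have "join_G absK x y = z"
    unfolding join_G_def berk_path_gauss[OF x] berk_path_gauss[OF y]
  proof (rule the_equality)
    show "z \<in> {w \<in> P1Berk absK. berk_leG x w} \<inter> {w \<in> P1Berk absK. berk_leG y w} \<and>
      (\<forall>w\<in>berk_path absK x z. w \<in> {w \<in> P1Berk absK. berk_leG y w} \<longrightarrow> w = z)"
    proof (intro conjI ballI impI)
      fix w assume "w \<in> berk_path absK x z" "w \<in> {w \<in> P1Berk absK. berk_leG y w}"
      then have "w \<in> P1Berk absK" "berk_leG x w" "berk_leG w z" "berk_leG y w"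
        unfolding berk_path_leG[OF x z(1) xz(1)] by simp_all
      then show "w = z" using leG_antisym[of w z] z(1) zle[of w] by blast
    qed (use z(1) xz in simp)
  next
    fix z' assume *: "z' \<in> {w \<in> P1Berk absK. berk_leG x w} \<inter> {w \<in> P1Berk absK. berk_leG y w} \<and>
      (\<forall>w\<in>berk_path absK x z'. w \<in> {w \<in> P1Berk absK. berk_leG y w} \<longrightarrow> w = z')"
    then have "z' \<in> P1Berk absK" "berk_leG x z'" "berk_leG z z'" using zle by auto
    then have "z \<in> berk_path absK x z'" using berk_path_leG[OF x] xz z by auto
    then show "z' = z" using * z xz by auto
  qed
  then show "join_G absK x y \<in> P1Berk absK" "kap (join_G absK x y) = (\<lambda>c. max (kap x c) (kap y c))"
    using z by auto
qed

section \<open>Diameters, the metric and balls in terms of kernels\<close>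

text \<open>\<open>diam_G\<close> divides \<open>[T - a]\<close> by \<open>M ^ 2\<close> with
  \<open>M = max 1 [T]\<close>, the kernel divides it by \<open>M\<close> times the weight of
  \<open>a\<close>. For weight \<open>M\<close> the quotients coincide; for other \<open>a\<close>
  both are at least \<open>1 / M\<close>, the value of the kernel at infinity.\<close>

lemma diam_G_kap:
  assumes x: "x \<in> P1Berk absK"
  shows "diam_G x = (INF c. kap x c)"
  using x
proof (rule P1Berk_cases)
  assume "x = BInf"
  then have "kap x None = 0" using kap_None_eq_0 by auto
  then have "(INF c. kap x c) = 0"
    using cINF_lower[OF tight_bdd_below[OF tight_kap[OF x]], of None] cINF_greatest[of UNIV 0 "kap x"] kap_nonneg[OF x]
    by (intro antisym) simp_all
  then show ?thesis using \<open>x = BInf\<close> by (simp add: diam_G_def)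
next
  fix s assume s: "x = BAff s" "is_mseminorm absK s"
  define M where "M = max 1 (s tT)"
  have M: "M \<ge> 1" "s tT \<le> M" by (auto simp: M_def)
  have kN: "kap x None = 1 / M" using kap_None_BAff[OF s(2)] s(1) M_def by simp
  have kS: "kap x (Some a) = s [:-a, 1:] / (M * max 1 (absK a))" for a
    by (simp add: kap_def s wt_simps M_def)
  have bdd: "bdd_below (range (kap x))" using tight_bdd_below[OF tight_kap[OF x]] .
  have bdd': "bdd_below (range (\<lambda>a. s [:-a, 1:]))" using sem_nonneg[OF s(2)] by (auto intro!: bdd_belowI[of _ 0])
  have le0: "(INF a. s [:-a, 1:]) / M\<^sup>2 \<le> 1 / M"
  proof -
    have "(INF a. s [:-a, 1:]) \<le> s [:-0, 1:]" by (rule cINF_lower[OF bdd']) simp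
    then have "(INF a. s [:-a, 1:]) \<le> M" using M by simp
    then show ?thesis using M by (simp add: field_simps power2_eq_square)
  qed
  have "(INF a. s [:-a, 1:]) / M\<^sup>2 = (INF c. kap x c)"
  proof (rule antisym)
    show "(INF a. s [:-a, 1:]) / M\<^sup>2 \<le> (INF c. kap x c)"
    proof (rule cINF_greatest)
      fix c
      show "(INF a. s [:-a, 1:]) / M\<^sup>2 \<le> kap x c"
      proof (cases c)
        case None
        then show ?thesis using le0 kN by simp
      next
        case (Some a)
        show ?thesis
        proof (cases "max 1 (absK a) \<le> M")
          case True
          have "(INF a. s [:-a, 1:]) / M\<^sup>2 \<le> s [:-a, 1:] / M\<^sup>2"
            using cINF_lower[OF bdd', of a] by (simp add: divide_right_mono)
          also have "\<dots> \<le> kap x (Some a)"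
            unfolding kS power2_eq_square using True M
            by (intro divide_left_mono mult_left_mono sem_nonneg[OF s(2)] mult_pos_pos) auto
          finally show ?thesis using Some by simp
        next
          case False
          have "chord (Some a) None = 1 / max 1 (absK a)" by (simp add: chord_det wt_simps)
          also have "\<dots> < 1 / M" using False M by (intro divide_strict_left_mono mult_pos_pos) linarith+
          finally have "1 / M \<le> kap x (Some a)" using kap_ultra1[OF x, of None "Some a"] kN by auto
          then show ?thesis using le0 Some by simp
        qed
      qed
    qed simp
    have "(INF c. kap x c) * M\<^sup>2 \<le> (INF a. s [:-a, 1:])"
    proof (rule cINF_greatest)
      fix a
      have inf: "(INF c. kap x c) \<le> kap x c" for c by (rule cINF_lower[OF bdd]) simp
      show "(INF c. kap x c) * M\<^sup>2 \<le> s [:-a, 1:]"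
      proof (cases "absK a < M \<and> 1 < M")
        case True
        then have "M = s tT" by (auto simp: M_def)
        moreover have "s tT \<le> max (s [:-a, 1:]) (absK a)"
          using sem_add[OF s(2), of "[:-a, 1:]" "[:a:]"] sem_const[OF s(2), of a] by simp
        ultimately have "M \<le> s [:-a, 1:]" using True by auto
        moreover have "(INF c. kap x c) * M\<^sup>2 \<le> M"
          using inf[of None] M by (simp add: kN field_simps power2_eq_square)
        ultimately show ?thesis by simp
      next
        case False
        then have *: "M \<le> max 1 (absK a)" using M by auto
        have "(INF c. kap x c) * M\<^sup>2 \<le> kap x (Some a) * M\<^sup>2" using inf by (simp add: mult_right_mono)
        also have "\<dots> = s [:-a, 1:] * (M / max 1 (absK a))" using M by (simp add: kS power2_eq_square)
        also have "\<dots> \<le> s [:-a, 1:] * 1" using * M by (intro mult_left_mono sem_nonneg[OF s(2)]) auto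
        finally show ?thesis by simp
      qed
    qed simp
    then show "(INF c. kap x c) \<le> (INF a. s [:-a, 1:]) / M\<^sup>2" using M by (simp add: field_simps)
  qed
  then show ?thesis by (simp add: diam_G_def s M_def)
qed

lemma diam_le_kap: "x \<in> P1Berk absK \<Longrightarrow> diam_G x \<le> kap x c"
  using cINF_lower[OF tight_bdd_below[OF tight_kap], of x c] by (simp add: diam_G_kap)

lemma diam_lessD:
  assumes "x \<in> P1Berk absK" "diam_G x < t"
  obtains c where "kap x c < t"
  using assms cInf_lessD[of "range (kap x)" t] by (auto simp: diam_G_kap)

lemma diam_greatest: "x \<in> P1Berk absK \<Longrightarrow> (\<And>c. r \<le> kap x c) \<Longrightarrow> r \<le> diam_G x"
  by (simp add: diam_G_kap cINF_greatest)

lemma diam_nonneg: "x \<in> P1Berk absK \<Longrightarrow> 0 \<le> diam_G x"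
  by (simp add: diam_greatest kap_nonneg)

lemma diam_le_1: "x \<in> P1Berk absK \<Longrightarrow> diam_G x \<le> 1"
  using diam_le_kap kap_le_1 order_trans by blast

text \<open>Only the diameter of \<open>z\<close> enters, so the points above \<open>x\<close> are
  parametrised by their diameter. If \<open>kap z c\<close> were larger, some \<open>e\<close> with
  \<open>kap z e < kap z c\<close> would give
  \<open>kap z c \<le> chord e c \<le> max (kap x e) (kap x c)\<close>, which is too small.\<close>

lemma kap_above:
  assumes x: "x \<in> P1Berk absK" and z: "z \<in> P1Berk absK" and xz: "berk_leG x z"
  shows "kap z c = max (kap x c) (diam_G z)"
proof (rule antisym)
  show "kap z c \<le> max (kap x c) (diam_G z)"
  proof (rule ccontr)
    assume n: "\<not> kap z c \<le> max (kap x c) (diam_G z)"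
    then have "diam_G z < kap z c" by simp
    then obtain e where e: "kap z e < kap z c" using diam_lessD[OF z] by blast
    then have "kap z c \<le> chord e c" using kap_ultra1[OF z, of c e] by auto
    also have "\<dots> \<le> max (kap x e) (kap x c)" using kap_ultra2[OF x] .
    finally show False using n e le_funD[OF xz, of e] by auto
  qed
  show "max (kap x c) (diam_G z) \<le> kap z c"
    using xz diam_le_kap[OF z] by (auto simp: le_fun_def)
qed

text \<open>The point of diameter \<open>t\<close> on the path from \<open>x\<close> to the Gauss point (for \<open>diam_G x \<le> t \<le> 1\<close>).\<close>

definition raise :: "'a berk \<Rightarrow> real \<Rightarrow> 'a berk" where
  "raise x t = (SOME z. z \<in> P1Berk absK \<and> kap z = (\<lambda>c. max (kap x c) t))"

lemma raise:
  assumes "x \<in> P1Berk absK" "0 \<le> t" "t \<le> 1"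
  shows "raise x t \<in> P1Berk absK" "kap (raise x t) c = max (kap x c) t"
proof -
  have "\<exists>z. z \<in> P1Berk absK \<and> kap z = (\<lambda>c. max (kap x c) t)"
    using tight_realized[OF tight_max_const[OF tight_kap[OF assms(1)] assms(2,3)]] by blast
  then have "raise x t \<in> P1Berk absK \<and> kap (raise x t) = (\<lambda>c. max (kap x c) t)"
    unfolding raise_def by (rule someI_ex)
  then show "raise x t \<in> P1Berk absK" "kap (raise x t) c = max (kap x c) t" by auto
qed

lemma raise_diam:
  assumes "x \<in> P1Berk absK" "diam_G x \<le> t" "t \<le> 1"
  shows "diam_G (raise x t) = t"
proof -
  have t: "0 \<le> t" using assms diam_nonneg order_trans by blast
  note r = raise[OF assms(1) t assms(3)]
  show ?thesis
  proof (rule antisym)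
    show "t \<le> diam_G (raise x t)" by (rule diam_greatest[OF r(1)]) (simp add: r(2))
    show "diam_G (raise x t) \<le> t"
    proof (rule field_le_epsilon)
      fix e :: real assume "0 < e"
      then obtain c where "kap x c < t + e" using diam_lessD[OF assms(1), of "t + e"] assms by auto
      then show "diam_G (raise x t) \<le> t + e"
        using diam_le_kap[OF r(1), of c] r(2)[of c] \<open>0 < e\<close> by auto
    qed
  qed
qed

lemma raise_eq:
  assumes x: "x \<in> P1Berk absK" and z: "z \<in> P1Berk absK" and "berk_leG x z"
  shows "z = raise x (diam_G z)"
proof -
  note r = raise[OF x diam_nonneg[OF z] diam_le_1[OF z]]
  show ?thesis by (rule kap_inject[OF z r(1)]) (auto simp: r kap_above[OF assms])
qed

lemma berk_d_le:
  assumes x: "x \<in> P1Berk absK" and y: "y \<in> P1Berk absK"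
  shows "berk_d absK x y \<le> 2 * max (kap x c) (kap y c) - diam_G x - diam_G y"
  using diam_le_kap[OF join_G_kap(1)[OF x y], of c] by (simp add: berk_d_def join_G_kap[OF x y])

text \<open>The diameters of joins satisfy the strong triangle inequality, and the smaller of the
  two joins with \<open>y\<close> still has diameter at least \<open>diam_G y\<close>.\<close>

lemma berk_d_triangle:
  assumes x: "x \<in> P1Berk absK" and y: "y \<in> P1Berk absK" and z: "z \<in> P1Berk absK"
  shows "berk_d absK x z \<le> berk_d absK x y + berk_d absK y z"
proof -
  let ?J = "\<lambda>x y. diam_G (join_G absK x y)"
  have ge: "diam_G y \<le> ?J x y" "diam_G y \<le> ?J y z"
    by (rule diam_greatest[OF join_G_kap(1)]; use x y z diam_le_kap[OF y] in \<open>auto simp: join_G_kap le_max_iff_disj\<close>)+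
  have "?J x z \<le> max (?J x y) (?J y z)"
  proof (rule ccontr)
    assume n: "\<not> ?J x z \<le> max (?J x y) (?J y z)"
    then have "?J x y < ?J x z" "?J y z < ?J x z" by auto
    then obtain c e where "kap (join_G absK x y) c < ?J x z" "kap (join_G absK y z) e < ?J x z"
      using diam_lessD[OF join_G_kap(1)[OF x y]] diam_lessD[OF join_G_kap(1)[OF y z]] by metis
    then have c: "max (kap x c) (kap y c) < ?J x z" and e: "max (kap y e) (kap z e) < ?J x z"
      by (auto simp: join_G_kap x y z)
    have "kap z c < ?J x z" using kap_ultra1[OF z, of c e] kap_ultra2[OF y, of e c] c e by auto
    then show False using c diam_le_kap[OF join_G_kap(1)[OF x z], of c] by (auto simp: join_G_kap x z)
  qed
  then show ?thesis using ge by (auto simp: berk_d_def)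
qed

lemma berk_d_commute: "x \<in> P1Berk absK \<Longrightarrow> y \<in> P1Berk absK \<Longrightarrow> berk_d absK x y = berk_d absK y x"
  unfolding berk_d_def diam_G_kap[OF join_G_kap(1)] using join_G_kap by (simp add: diam_G_kap max.commute)

lemma berk_d_pos:
  assumes x: "x \<in> P1Berk absK" and y: "y \<in> P1Berk absK" and "x \<noteq> y"
  shows "berk_d absK x y > 0"
proof -
  let ?z = "join_G absK x y"
  note z = join_G_kap[OF x y]
  have le: "berk_leG x ?z" "berk_leG y ?z" using z by (auto simp: le_fun_def)
  have dle: "diam_G x \<le> diam_G ?z" "diam_G y \<le> diam_G ?z"
    by (rule diam_greatest[OF z(1)]; use diam_le_kap x y in \<open>auto simp: z le_max_iff_disj\<close>)+
  have eq: "w = ?z" if "w \<in> P1Berk absK" "berk_leG w ?z" "diam_G w = diam_G ?z" for w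
  proof (rule kap_inject[OF that(1) z(1)])
    show "kap w = kap ?z"
      using kap_above[OF that(1) z(1) that(2)] that(3) diam_le_kap[OF that(1)] by (auto simp: max_def fun_eq_iff intro: antisym)
  qed
  then have "diam_G x \<noteq> diam_G ?z \<or> diam_G y \<noteq> diam_G ?z" using le x y assms(3) by metis
  then show ?thesis using dle by (auto simp: berk_d_def)
qed

lemma Q_pt_raise:
  assumes "0 < r" "r \<le> 1"
  shows "Q_pt absK (pt a) r = raise (pt a) r"
  unfolding Q_pt_def berk_path_gauss[OF pt_in]
proof (rule the_equality)
  have d: "diam_G (pt a) \<le> r"
    using diam_le_kap[OF pt_in, of a a] chord_self[of a] assms by linarith
  show "raise (pt a) r \<in> {w \<in> P1Berk absK. berk_leG (pt a) w} \<and> diam_G (raise (pt a) r) = r"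
    using raise[OF pt_in, of r a] raise_diam[OF pt_in d] assms by (auto simp: le_fun_def)
  fix z assume "z \<in> {w \<in> P1Berk absK. berk_leG (pt a) w} \<and> diam_G z = r"
  then show "z = raise (pt a) r" using raise_eq[OF pt_in, of z a] by auto
qed

text \<open>The ball consists of everything strictly below \<open>raise (pt a) r\<close>, in all
  downward directions and not only that of \<open>a\<close>. Hence the inequality is not strict and
  just the boundary point is excluded.\<close>

lemma ball_minus_lt1_iff:
  assumes "0 < r" "r \<le> 1"
  shows "x \<in> ball_minus_lt1 absK (pt a) r \<longleftrightarrow> x \<in> P1Berk absK \<and> kap x a \<le> r \<and> x \<noteq> raise (pt a) r"
proof -
  have "berk_leG x (raise (pt a) r) \<longleftrightarrow> kap x a \<le> r" if x: "x \<in> P1Berk absK"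
  proof
    assume "berk_leG x (raise (pt a) r)"
    then have "kap x a \<le> kap (raise (pt a) r) a" by (auto simp: le_fun_def)
    then show "kap x a \<le> r" using raise(2)[OF pt_in, of r a a] chord_self[of a] assms by simp
  next
    assume "kap x a \<le> r"
    show "berk_leG x (raise (pt a) r)"
    proof (intro le_funI)
      fix c show "kap x c \<le> kap (raise (pt a) r) c"
        using kap_ultra1[OF x, of c a] raise(2)[OF pt_in, of r a c] \<open>kap x a \<le> r\<close> assms by auto
    qed
  qed
  then show ?thesis
    using raise(1)[OF pt_in, of r a] assms
    by (auto simp: ball_minus_lt1_def Q_pt_raise berk_path_gauss)
qed

section \<open>Seminorms just above a point of a path\<close>

lemma hval_factor:
  assumes "f \<noteq> 0" "degree f \<le> n"
  obtains as where "length as = n"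
    "\<And>x. x \<in> P1Berk absK \<Longrightarrow> hval n x f = hval n (gauss absK) f * prod_list (map (kap x) as)"
    "0 < hval n (gauss absK) f"
proof -
  from hval_factorization[OF assms] obtain A as where A: "A > 0" "length as = n"
    "\<forall>x\<in>P1Berk absK. hval n x f = A * prod_list (map (kap x) as)" by blast
  have "kap (gauss absK) = (\<lambda>_. 1)" using gauss_point by auto
  then have "hval n (gauss absK) f = A" using A(3) gauss_point(1) by (simp add: map_replicate_const)
  then show ?thesis using that A by auto
qed

lemma kap_eq_0:
  assumes y: "y \<in> P1Berk absK" "kap y c = 0"
  shows "y = pt c"
proof (rule kap_inject[OF y(1) pt_in], rule ext)
  fix b show "kap y b = chord c b"
    using kap_ultra1[OF y(1), of b c] kap_ultra2[OF y(1), of c b] y(2) kap_nonneg[OF y(1), of b] kap_nonneg[OF pt_in, of c b]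
    by auto
qed

text \<open>\<open>E\<close> stands for a disc of centres and \<open>u\<close> for a radius moving
  just off it, so that \<open>n\<close> counts the roots in \<open>E\<close>. The last three clauses
  are what the denominators and the regular part of a partial fraction call for.\<close>

lemma sem_germ:
  assumes s: "eventually (\<lambda>t. is_mseminorm absK (s t)) F"
    and lin: "\<And>b. \<exists>C>0. eventually (\<lambda>t. s t [:-b, 1:] = C * (if b \<in> E then u t else 1)) F"
    and "f \<noteq> 0"
  shows "\<exists>C>0. \<exists>n\<le>degree f. eventually (\<lambda>t. s t f = C * u t ^ n) F \<and>
    ((\<forall>r. poly f r = 0 \<longrightarrow> r \<in> E) \<longrightarrow> n = degree f) \<and> ((\<forall>r. poly f r = 0 \<longrightarrow> r \<notin> E) \<longrightarrow> n = 0) \<and>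
    ((\<exists>r\<in>E. poly f r = 0) \<longrightarrow> n \<ge> 1)"
  using \<open>f \<noteq> 0\<close>
proof (induction "degree f" arbitrary: f)
  case 0
  then obtain c where c: "f = [:c:]" "c \<noteq> 0" by (metis degree_eq_zeroE pCons_0_0)
  have "eventually (\<lambda>t. s t f = absK c * u t ^ 0) F"
    using s by eventually_elim (simp add: c sem_const)
  then show ?case using c by (intro exI[of _ "absK c"] conjI exI[of _ 0]) auto
next
  case (Suc k)
  then obtain r where r: "poly f r = 0" using root_exists[of f] by auto
  obtain g where g: "f = [:-r, 1:] * g" "g \<noteq> 0" "degree f = Suc (degree g)"
    using poly_factor_root[OF r Suc.prems] by blast
  have "k = degree g" using Suc.hyps(2) g(3) by simp
  from Suc.hyps(1)[OF this g(2)] obtain C n where C: "C > 0" "n \<le> degree g"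
    "eventually (\<lambda>t. s t g = C * u t ^ n) F" "(\<forall>r. poly g r = 0 \<longrightarrow> r \<in> E) \<longrightarrow> n = degree g"
    "(\<forall>r. poly g r = 0 \<longrightarrow> r \<notin> E) \<longrightarrow> n = 0" "(\<exists>r\<in>E. poly g r = 0) \<longrightarrow> n \<ge> 1" by blast
  obtain D where D: "D > 0" "eventually (\<lambda>t. s t [:-r, 1:] = D * (if r \<in> E then u t else 1)) F" using lin by blast
  define n' where "n' = (if r \<in> E then Suc n else n)"
  have ev: "eventually (\<lambda>t. s t f = (D * C) * u t ^ n') F"
    using s C(3) D(2)
  proof eventually_elim
    case (elim t)
    have "s t f = s t [:-r, 1:] * s t g" unfolding g(1) by (rule sem_mult[OF elim(1)])
    then show ?case using elim by (simp add: n'_def)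
  qed
  have pf: "poly f b = 0 \<longleftrightarrow> b = r \<or> poly g b = 0" for b by (auto simp: g(1))
  have "n' \<le> degree f \<and> ((\<forall>r. poly f r = 0 \<longrightarrow> r \<in> E) \<longrightarrow> n' = degree f) \<and>
    ((\<forall>r. poly f r = 0 \<longrightarrow> r \<notin> E) \<longrightarrow> n' = 0) \<and> ((\<exists>r\<in>E. poly f r = 0) \<longrightarrow> n' \<ge> 1)"
  proof (cases "r \<in> E")
    case True
    then have n': "n' = Suc n" by (simp add: n'_def)
    show ?thesis unfolding n' pf g(3) using C(2,4) True by auto
  next
    case False
    then have n': "n' = n" by (simp add: n'_def)
    show ?thesis unfolding n' pf g(3) using C(2,5,6) False le_SucI by blast
  qed
  then show ?case using ev C(1) D(1) by (intro exI[of _ "D * C"] conjI exI[of _ n']) auto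
qed

text \<open>Subtracting from \<open>P/Q\<close> the constant term of its Laurent expansion on an annulus free of poles leaves
  only terms of nonzero exponent; the expansion is encoded by the partial fraction \<open>P/Q = A/Q1 + B/Q2\<close>.\<close>

lemma rational_germ_not_const:
  assumes s: "eventually (\<lambda>t. is_mseminorm absK (s t)) F"
    and lin: "\<And>b. \<exists>C>0. eventually (\<lambda>t. s t [:-b, 1:] = C * (if b \<in> E then u t else 1)) F"
    and u: "deciding F u" and a: "a \<in> E" and "Q \<noteq> 0" and nc: "\<And>c. P \<noteq> smult c Q"
  obtains c where "\<And>K. \<not> eventually (\<lambda>t. s t (P - smult c Q) = K * s t Q) F"
proof -
  obtain Q1 Q2 A B where I: "Q = Q1 * Q2" "\<forall>r. poly Q1 r = 0 \<longrightarrow> r \<in> E"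
      "\<forall>r. poly Q2 r = 0 \<longrightarrow> r \<notin> E" "P = A * Q2 + B * Q1" "A = 0 \<or> degree A < degree Q1"
    using partial_fractions[OF \<open>Q \<noteq> 0\<close>, of E P] by blast
  have nz: "Q1 \<noteq> 0" "Q2 \<noteq> 0" using \<open>Q \<noteq> 0\<close> I(1) by auto
  have "poly Q2 a \<noteq> 0" using I(3) a by blast
  \<comment> \<open>The constant term: the value at \<open>a\<close> of the part
    \<open>B / Q2\<close> without poles in \<open>E\<close>. Subtracting it gives \<open>B'\<close>
    a zero in \<open>E\<close>, hence a positive exponent relative to \<open>Q\<close>.\<close>
  define c where "c = poly B a / poly Q2 a"
  define B' where "B' = B - smult c Q2"
  have B'a: "poly B' a = 0" using \<open>poly Q2 a \<noteq> 0\<close> by (simp add: B'_def c_def)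
  have eq: "P - smult c Q = A * Q2 + B' * Q1" by (simp add: I(1,4) B'_def algebra_simps)
  obtain C1 where C1: "C1 > 0" "eventually (\<lambda>t. s t Q1 = C1 * u t ^ degree Q1) F"
  proof -
    from sem_germ[OF s lin nz(1)] obtain C n where "C > 0" "eventually (\<lambda>t. s t Q1 = C * u t ^ n) F"
      "(\<forall>r. poly Q1 r = 0 \<longrightarrow> r \<in> E) \<longrightarrow> n = degree Q1" by blast
    then show ?thesis using that[of C] I(2) by simp
  qed
  obtain C2 where C2: "C2 > 0" "eventually (\<lambda>t. s t Q2 = C2 * u t ^ 0) F"
  proof -
    from sem_germ[OF s lin nz(2)] obtain C n where "C > 0" "eventually (\<lambda>t. s t Q2 = C * u t ^ n) F"
      "(\<forall>r. poly Q2 r = 0 \<longrightarrow> r \<notin> E) \<longrightarrow> n = 0" by blast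
    then show ?thesis using that[of C] I(3) by simp
  qed
  let ?n = "degree Q1"
  have pos: "eventually (\<lambda>t. 0 < u t) F" using u by (auto simp: deciding_def)
  have sQ: "eventually (\<lambda>t. s t Q = C1 * C2 * u t ^ ?n) F"
    using s C1(2) C2(2) by eventually_elim (simp add: I(1) sem_mult)
  have no_high: False if "C > 0" "m > ?n" "eventually (\<lambda>t. C * u t ^ m = K * (C1 * C2 * u t ^ ?n)) F" for C m K
  proof -
    have "eventually (\<lambda>t. u t ^ (m - ?n) = K * C1 * C2 / C) F"
      using that(3) pos
    proof eventually_elim
      case (elim t)
      have e: "u t ^ m = u t ^ (m - ?n) * u t ^ ?n" using that(2) by (simp flip: power_add)
      have "C * u t ^ (m - ?n) = K * C1 * C2"
        using elim unfolding e by (simp add: mult_ac)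
      then show ?case using that(1) by (simp add: eq_divide_eq mult.commute)
    qed
    then show False using deciding_power_not_const[OF u, of "m - ?n"] that(2) by simp
  qed
  have no_low: False if "C > 0" "m < ?n" "eventually (\<lambda>t. C * u t ^ m = K * (C1 * C2 * u t ^ ?n)) F" for C m K
  proof -
    have "eventually (\<lambda>t. u t ^ (?n - m) = C / (K * C1 * C2)) F"
      using that(3) pos
    proof eventually_elim
      case (elim t)
      have e: "u t ^ ?n = u t ^ (?n - m) * u t ^ m" using that(2) by (simp flip: power_add)
      have "K \<noteq> 0"
      proof
        assume "K = 0"
        then have "C * u t ^ m = 0" using elim(1) by simp
        then show False using elim(2) that(1) by auto
      qed
      moreover have "C = K * C1 * C2 * u t ^ (?n - m)"
        using elim unfolding e by (simp add: mult_ac)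
      ultimately show ?case using C1(1) C2(1) by simp
    qed
    then show False using deciding_power_not_const[OF u, of "?n - m"] that(2) by simp
  qed
  have germA: "\<exists>C>0. \<exists>k<?n. eventually (\<lambda>t. s t (A * Q2) = C * u t ^ k) F" if "A \<noteq> 0"
  proof -
    obtain C k where C: "C > 0" "k \<le> degree A" "eventually (\<lambda>t. s t A = C * u t ^ k) F"
      using sem_germ[OF s lin \<open>A \<noteq> 0\<close>] by blast
    have "eventually (\<lambda>t. s t (A * Q2) = (C * C2) * u t ^ k) F"
      using s C(3) C2(2) by eventually_elim (simp add: sem_mult)
    moreover have "k < ?n" using C(2) I(5) that by simp
    ultimately show ?thesis using C(1) C2(1) by (intro exI[of _ "C * C2"] conjI exI[of _ k]) auto
  qed
  have germB: "\<exists>C>0. \<exists>m>?n. eventually (\<lambda>t. s t (B' * Q1) = C * u t ^ m) F" if "B' \<noteq> 0"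
  proof -
    obtain C m where C: "C > 0" "m \<ge> 1" "eventually (\<lambda>t. s t B' = C * u t ^ m) F"
    proof -
      from sem_germ[OF s lin \<open>B' \<noteq> 0\<close>] obtain C m where "C > 0" "eventually (\<lambda>t. s t B' = C * u t ^ m) F"
        "(\<exists>r\<in>E. poly B' r = 0) \<longrightarrow> m \<ge> 1" by blast
      moreover have "\<exists>r\<in>E. poly B' r = 0" using a B'a by blast
      ultimately show ?thesis using that[of C m] by simp
    qed
    have "eventually (\<lambda>t. s t (B' * Q1) = (C * C1) * u t ^ (m + ?n)) F"
      using s C(3) C1(2) by eventually_elim (simp add: sem_mult power_add)
    then show ?thesis using C(1,2) C1(1) by (intro exI[of _ "C * C1"] conjI exI[of _ "m + ?n"]) auto
  qed
  have "\<not> eventually (\<lambda>t. s t (P - smult c Q) = K * s t Q) F" for K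
  proof
    assume ev0: "eventually (\<lambda>t. s t (P - smult c Q) = K * s t Q) F"
    have ev: "eventually (\<lambda>t. s t (A * Q2 + B' * Q1) = K * (C1 * C2 * u t ^ ?n)) F"
      using ev0 sQ by eventually_elim (simp add: eq)
    consider "A = 0" "B' \<noteq> 0" | "A \<noteq> 0" "B' = 0" | "A \<noteq> 0" "B' \<noteq> 0"
    proof (cases "A = 0 \<and> B' = 0")
      case True
      then have "P - smult c Q = 0" by (simp add: eq)
      then show ?thesis using nc[of c] by simp
    qed (use that in blast)
    then show False
    proof cases
      case 1
      then obtain C m where C: "C > 0" "m > ?n" "eventually (\<lambda>t. s t (B' * Q1) = C * u t ^ m) F" using germB by blast
      have "eventually (\<lambda>t. C * u t ^ m = K * (C1 * C2 * u t ^ ?n)) F"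
        using ev C(3) by eventually_elim (simp add: 1)
      then show False using no_high C by blast
    next
      case 2
      then obtain C k where C: "C > 0" "k < ?n" "eventually (\<lambda>t. s t (A * Q2) = C * u t ^ k) F" using germA by blast
      have "eventually (\<lambda>t. C * u t ^ k = K * (C1 * C2 * u t ^ ?n)) F"
        using ev C(3) by eventually_elim (simp add: 2)
      then show False using no_low C by blast
    next
      case 3
      obtain C m where C: "C > 0" "m > ?n" "eventually (\<lambda>t. s t (B' * Q1) = C * u t ^ m) F" using germB 3 by blast
      obtain D k where D: "D > 0" "k < ?n" "eventually (\<lambda>t. s t (A * Q2) = D * u t ^ k) F" using germA 3 by blast
      \<comment> \<open>For two different values the ultrametric inequality is an equality, so the
        larger monomial survives in the sum; its exponent is not that of \<open>Q\<close> in either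
        case.\<close>
      have dom: "s' (f + g) = s' g" if "is_mseminorm absK s'" "s' f < s' g" for s' f g
      proof -
        have "s' (- f) = s' f" using sem_smult[OF that(1), of "-1" f] by simp
        moreover have "s' g \<le> max (s' (f + g)) (s' (- f))" using sem_add[OF that(1), of "f + g" "- f"] by simp
        ultimately show ?thesis using sem_add[OF that(1), of f g] that(2) by linarith
      qed
      have "eventually (\<lambda>t. D * u t ^ k < C * u t ^ m) F \<or> eventually (\<lambda>t. C * u t ^ m < D * u t ^ k) F"
        using C D by (intro deciding_monomials[OF u]) auto
      then show False
      proof
        assume "eventually (\<lambda>t. D * u t ^ k < C * u t ^ m) F"
        then have "eventually (\<lambda>t. C * u t ^ m = K * (C1 * C2 * u t ^ ?n)) F"
          using ev C(3) D(3) s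
        proof eventually_elim
          case (elim t)
          then show ?case using dom[of "s t" "A * Q2" "B' * Q1"] by simp
        qed
        then show False using no_high C by blast
      next
        assume "eventually (\<lambda>t. C * u t ^ m < D * u t ^ k) F"
        then have "eventually (\<lambda>t. D * u t ^ k = K * (C1 * C2 * u t ^ ?n)) F"
          using ev C(3) D(3) s
        proof eventually_elim
          case (elim t)
          then show ?case using dom[of "s t" "B' * Q1" "A * Q2"] by (simp add: add.commute)
        qed
        then show False using no_low D by blast
      qed
    qed
  qed
  then show ?thesis using that by blast
qed

lemma berk_d_le_of_kap:
  assumes X: "X \<in> P1Berk absK" and Y: "Y \<in> P1Berk absK" and "\<And>c. \<bar>kap X c - kap Y c\<bar> \<le> e"
  shows "berk_d absK X Y \<le> 2 * e"
proof -
  note J = join_G_kap[OF X Y]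
  have "diam_G (join_G absK X Y) - e \<le> diam_G X" "diam_G (join_G absK X Y) - e \<le> diam_G Y"
  proof -
    have *: "diam_G (join_G absK X Y) \<le> max (kap X c) (kap Y c)" for c
      using diam_le_kap[OF J(1), of c] J(2) by simp
    show "diam_G (join_G absK X Y) - e \<le> diam_G X"
      using *  assms(3) by (intro diam_greatest[OF X]) (smt (verit))
    show "diam_G (join_G absK X Y) - e \<le> diam_G Y"
      using *  assms(3) by (intro diam_greatest[OF Y]) (smt (verit))
  qed
  then show ?thesis by (simp add: berk_d_def)
qed

lemma raise_mono:
  assumes x: "x \<in> P1Berk absK" and st: "diam_G x \<le> s" "s \<le> t" "t \<le> 1"
  shows "raise x s \<in> P1Berk absK" "raise x t \<in> P1Berk absK" "berk_leG (raise x s) (raise x t)"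
    "kap (raise x t) c \<le> kap (raise x s) c + (t - s)"
proof -
  have s0: "0 \<le> s" "s \<le> 1" "0 \<le> t" using diam_nonneg[OF x] st by auto
  note rs = raise[OF x s0(1,2)] and rt = raise[OF x s0(3) st(3)]
  show "raise x s \<in> P1Berk absK" "raise x t \<in> P1Berk absK" by (rule rs(1), rule rt(1))
  show "berk_leG (raise x s) (raise x t)" using st by (auto simp: le_fun_def rs rt)
  show "kap (raise x t) c \<le> kap (raise x s) c + (t - s)" using st by (auto simp: rs rt)
qed

lemma eventually_raise:
  assumes x: "x \<in> P1Berk absK" and \<tau>: "diam_G x < \<tau>" "\<tau> < 1"
  shows "eventually (\<lambda>t. \<tau> < t \<and> t < 1 \<and> raise x t \<in> P1Berk absK \<and> kap (raise x t) = (\<lambda>c. max (kap x c) t)) (at_right \<tau>)"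
proof (rule eventually_at_rightI[OF _ \<tau>(2)])
  fix t assume "t \<in> {\<tau><..<1}"
  then have t: "\<tau> < t" "t < 1" "0 \<le> t" using diam_nonneg[OF x] \<tau> by auto
  then show "\<tau> < t \<and> t < 1 \<and> raise x t \<in> P1Berk absK \<and> kap (raise x t) = (\<lambda>c. max (kap x c) t)"
    using raise[OF x t(3)] by auto
qed

text \<open>In the coordinate \<open>T\<close> the path is a family of discs containing the centres
  in \<open>E\<close>. Since values are normalised by the kernel at \<open>None\<close>, the radius
  is proportional to \<open>t\<close> while infinity is not below \<open>raise x t\<close>, and to
  \<open>1 / t\<close> once it is.\<close>

lemma affine_germ:
  assumes x: "x \<in> P1Berk absK" and \<tau>: "diam_G x < \<tau>" "\<tau> < 1"
  obtains s E u a where "eventually (\<lambda>t. is_mseminorm absK (s t) \<and> raise x t = BAff (s t)) (at_right \<tau>)"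
    "\<forall>b. \<exists>C>0. eventually (\<lambda>t. s t [:-b, 1:] = C * (if b \<in> E then u t else 1)) (at_right \<tau>)"
    "deciding (at_right \<tau>) u" "a \<in> E"
proof -
  let ?F = "at_right \<tau>"
  have \<tau>0: "0 \<le> \<tau>" using diam_nonneg[OF x] \<tau> by simp
  have dec: "deciding ?F (\<lambda>t. t)" using \<tau>0 by (rule deciding_at_right)
  have pos: "eventually (\<lambda>t. 0 < t) ?F" using dec by (simp add: deciding_def)
  define s where "s t = (case raise x t of BAff s \<Rightarrow> s | BInf \<Rightarrow> undefined)" for t
  have s: "eventually (\<lambda>t. is_mseminorm absK (s t) \<and> raise x t = BAff (s t)) ?F"
    using eventually_raise[OF assms] pos
  proof eventually_elim
    case (elim t)
    then have "raise x t \<noteq> BInf" using kap_None_eq_0[of "raise x t"] by auto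
    then show ?case using elim(1) by (auto simp: s_def elim: P1Berk_cases)
  qed
  have lin: "eventually (\<lambda>t. s t [:-b, 1:] = wt (Some b) * max (kap x (Some b)) t / max (kap x None) t) ?F" for b
    using eventually_raise[OF assms] s
  proof eventually_elim
    case (elim t)
    have r: "raise x t \<in> P1Berk absK" using elim by simp
    have "s t [:-b, 1:] = hval 1 (raise x t) [:-b, 1:] / kap (raise x t) None ^ 1"
      using sem_eq_hval[of "s t" "[:-b, 1:]" 1] elim by simp
    also have "hval 1 (raise x t) [:-b, 1:] = wt (Some b) * kap (raise x t) (Some b)"
      using hval_linear_form[OF r, of "Some b"] by simp
    finally show ?case using elim by simp
  qed
  have hi: "eventually (\<lambda>t. max (kap x c) t = kap x c) ?F" if "\<tau> < kap x c" for c
    using that by (intro eventually_at_rightI[of \<tau> "kap x c"]) auto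
  have lo: "eventually (\<lambda>t. max (kap x c) t = t) ?F" if "kap x c \<le> \<tau>" for c
    using eventually_at_right_less[of \<tau>] by eventually_elim (use that in auto)
  show ?thesis
  proof (cases "kap x None \<le> \<tau>")
    case True
    define E where "E = {b. \<tau> < kap x (Some b)}"
    have "\<exists>C>0. eventually (\<lambda>t. s t [:-b, 1:] = C * (if b \<in> E then 1 / t else 1)) ?F" for b
    proof (cases "b \<in> E")
      case bE: True
      then have "\<tau> < kap x (Some b)" by (simp add: E_def)
      have "eventually (\<lambda>t. s t [:-b, 1:] = (wt (Some b) * kap x (Some b)) * (if b \<in> E then 1 / t else 1)) ?F"
        using lin[of b] hi[OF \<open>\<tau> < kap x (Some b)\<close>] lo[OF True] by eventually_elim (simp add: bE)
      then show ?thesis using \<open>\<tau> < kap x (Some b)\<close> \<tau>0 by (intro exI[of _ "wt (Some b) * kap x (Some b)"]) auto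
    next
      case bE: False
      then have "kap x (Some b) \<le> \<tau>" by (simp add: E_def)
      have "eventually (\<lambda>t. s t [:-b, 1:] = wt (Some b) * (if b \<in> E then 1 / t else 1)) ?F"
        using lin[of b] lo[OF \<open>kap x (Some b) \<le> \<tau>\<close>] lo[OF True] pos by eventually_elim (simp add: bE)
      then show ?thesis by (intro exI[of _ "wt (Some b)"]) auto
    qed
    moreover have "chord None (Some 0) = 1" by (simp add: chord_det wt_simps)
    then have "0 \<in> E" using kap_ultra2[OF x, of None "Some 0"] True \<tau>(2) by (auto simp: E_def)
    ultimately show ?thesis using that[of s E "\<lambda>t. 1 / t" 0] s deciding_inverse[OF dec] by blast
  next
    case False
    then have N: "\<tau> < kap x None" by simp
    define E where "E = {b. kap x (Some b) \<le> \<tau>}"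
    have "\<exists>C>0. eventually (\<lambda>t. s t [:-b, 1:] = C * (if b \<in> E then t else 1)) ?F" for b
    proof (cases "b \<in> E")
      case bE: True
      then have "kap x (Some b) \<le> \<tau>" by (simp add: E_def)
      have "eventually (\<lambda>t. s t [:-b, 1:] = (wt (Some b) / kap x None) * (if b \<in> E then t else 1)) ?F"
        using lin[of b] lo[OF \<open>kap x (Some b) \<le> \<tau>\<close>] hi[OF N] by eventually_elim (simp add: bE)
      then show ?thesis using N \<tau>0 by (intro exI[of _ "wt (Some b) / kap x None"]) auto
    next
      case bE: False
      then have b: "\<tau> < kap x (Some b)" by (simp add: E_def)
      have "eventually (\<lambda>t. s t [:-b, 1:] = (wt (Some b) * kap x (Some b) / kap x None) * (if b \<in> E then t else 1)) ?F"
        using lin[of b] hi[OF b] hi[OF N] by eventually_elim (simp add: bE)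
      then show ?thesis using N b \<tau>0 by (intro exI[of _ "wt (Some b) * kap x (Some b) / kap x None"]) auto
    qed
    moreover obtain a where "a \<in> E"
    proof -
      obtain c where c: "kap x c < \<tau>" using diam_lessD[OF x \<tau>(1)] by blast
      then obtain b where "c = Some b" using N by (cases c) auto
      then show ?thesis using c that[of b] by (simp add: E_def)
    qed
    ultimately show ?thesis using that[of s E "\<lambda>t. t" a] s dec by blast
  qed
qed

end

section \<open>The action of a rational map\<close>

locale rational_map = berkovich +
  fixes P Q :: "'a poly" and d :: nat
  assumes coprime: "coprime P Q" and Q_nz: "Q \<noteq> 0"
    and d_eq: "d = max (degree P) (degree Q)" and d_ge: "d \<ge> 1"
begin

section \<open>The homogeneous lift of the map and its effect on kernels\<close>

abbreviation phi :: "'a berk \<Rightarrow> 'a berk" where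
  "phi \<equiv> berk_map absK P Q"

text \<open>The zeros in \<open>P1(K)\<close> of \<open>num c\<close>, a form of degree \<open>d\<close>, are the preimages of \<open>c\<close>.\<close>

definition num :: "'a option \<Rightarrow> 'a poly" where
  "num c = smult (hc1 c) P - smult (hc0 c) Q"

text \<open>The size of the homogeneous lift at normalised coordinates. It is not rescaled to be 1
  at the Gauss point, so factors \<open>H zG\<close> are carried along until they cancel.\<close>

definition H :: "'a berk \<Rightarrow> real" where
  "H x = max (hval d x P) (hval d x Q)"

lemma num_simps: "num None = Q" "num (Some c) = P - smult c Q"
  by (simp_all add: num_def)

lemma degree_PQ: "degree P \<le> d" "degree Q \<le> d" by (auto simp: d_eq)

lemma no_common_root: "poly P r \<noteq> 0 \<or> poly Q r \<noteq> 0"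
proof (rule ccontr)
  assume "\<not> ?thesis"
  then have "[:-r, 1:] dvd P" "[:-r, 1:] dvd Q" by (auto simp: poly_eq_0_iff_dvd)
  then have "[:-r, 1:] dvd 1" by (rule coprime_common_divisor[OF coprime])
  then show False by (auto simp: is_unit_iff_degree)
qed

lemma P_nz: "P \<noteq> 0"
proof
  assume "P = 0"
  then have "is_unit Q" using coprime by simp
  then show False using d_eq d_ge \<open>P = 0\<close> Q_nz by (simp add: is_unit_iff_degree)
qed

lemma num_nz: "num c \<noteq> 0"
proof (cases c)
  case (Some a)
  show ?thesis
  proof
    assume "num c = 0"
    then have "P = smult a Q" using Some by (simp add: num_simps)
    then have "Q dvd P" by (simp add: dvd_smult)
    then have "is_unit Q" using coprime_common_divisor[OF coprime, of Q] by simp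
    then have "degree Q = 0" using Q_nz by (simp add: is_unit_iff_degree)
    moreover have "degree P \<le> degree Q" unfolding \<open>P = smult a Q\<close> by (rule degree_smult_le)
    ultimately show False using d_eq d_ge by simp
  qed
qed (simp add: num_simps Q_nz)

lemma degree_num: "degree (num c) \<le> d"
  unfolding num_def using degree_PQ by (intro degree_diff_le) (auto simp: degree_smult_eq)

lemma hval_num_le:
  assumes x: "x \<in> P1Berk absK"
  shows "hval d x (num c) \<le> wt c * H x"
proof -
  have "absK 1 * hval d x (num c) \<le> max (absK (hc1 c) * hval d x P) (absK (- hc0 c) * hval d x Q)"
    by (rule hval_combine[OF x]) (simp add: num_def)
  also have "\<dots> \<le> wt c * H x"
    unfolding H_def using hval_nonneg[OF x]
    by (auto intro!: mult_mono simp: wt_def le_max_iff_disj)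
  finally show ?thesis by simp
qed

lemma H_pt_pos: "H (pt c) > 0"
proof (cases c)
  case None
  have "coeff P d \<noteq> 0 \<or> coeff Q d \<noteq> 0"
    using P_nz Q_nz d_eq by (metis leading_coeff_0_iff max_def)
  then show ?thesis by (auto simp: None H_def pt.simps less_max_iff_disj)
next
  case (Some a)
  then show ?thesis using no_common_root[of a]
    by (auto simp: H_def pt.simps typeI_def less_max_iff_disj)
qed

text \<open>Zeros and poles are separated in the chordal metric, so no point is close to both.\<close>

lemma H_lower_bound: obtains \<eta> where "\<eta> > 0" "\<And>x. x \<in> P1Berk absK \<Longrightarrow> \<eta> \<le> H x"
proof -
  obtain as where as: "length as = d"
    "\<And>x. x \<in> P1Berk absK \<Longrightarrow> hval d x P = hval d (gauss absK) P * prod_list (map (kap x) as)"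
    "0 < hval d (gauss absK) P"
    using hval_factor[OF P_nz degree_PQ(1)] by metis
  obtain bs where bs: "length bs = d"
    "\<And>x. x \<in> P1Berk absK \<Longrightarrow> hval d x Q = hval d (gauss absK) Q * prod_list (map (kap x) bs)"
    "0 < hval d (gauss absK) Q"
    using hval_factor[OF Q_nz degree_PQ(2)] by metis
  have pos: "chord a b > 0" if "a \<in> set as" "b \<in> set bs" for a b
  proof -
    have "prod_list (map (chord a) as) = 0" using that(1) by (auto simp: prod_list_zero_iff image_iff intro!: bexI[of _ a])
    then have "hval d (pt a) P = 0" using as(2)[OF pt_in, of a] by simp
    then have "hval d (pt a) Q > 0" using H_pt_pos[of a] by (auto simp: H_def)
    then have "prod_list (map (chord a) bs) \<noteq> 0" using bs(2)[OF pt_in, of a] by auto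
    then have "chord a b \<noteq> 0" using that(2) by (auto simp: prod_list_zero_iff image_iff)
    then show ?thesis using kap_nonneg[OF pt_in, of a b] by simp
  qed
  define D where "D = (\<lambda>(a, b). chord a b) ` (set as \<times> set bs)"
  have "as \<noteq> []" "bs \<noteq> []" using as(1) bs(1) d_ge by auto
  then have D: "finite D" "D \<noteq> {}" by (auto simp: D_def)
  define \<delta> where "\<delta> = Min D"
  have "\<delta> > 0" unfolding \<delta>_def using D pos by (subst Min_gr_iff) (auto simp: D_def)
  have \<delta>: "\<delta> \<le> chord a b" if "a \<in> set as" "b \<in> set bs" for a b
    unfolding \<delta>_def using that D by (intro Min_le) (auto simp: D_def)
  define \<eta> where "\<eta> = min (hval d (gauss absK) P) (hval d (gauss absK) Q) * \<delta> ^ d"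
  have "\<eta> \<le> H x" if x: "x \<in> P1Berk absK" for x
  proof (cases "\<forall>a\<in>set as. \<delta> \<le> kap x a")
    case True
    then have "\<delta> ^ d \<le> prod_list (map (kap x) as)"
      using prod_list_map_const_le_power[of as \<delta> "kap x"] \<open>\<delta> > 0\<close> as(1) by simp
    then have "\<eta> \<le> hval d x P"
      unfolding \<eta>_def as(2)[OF x] using as(3) \<open>\<delta> > 0\<close> by (intro mult_mono) auto
    then show ?thesis by (simp add: H_def)
  next
    case False
    then obtain a where a: "a \<in> set as" "kap x a < \<delta>" by auto
    have "\<delta> \<le> kap x b" if "b \<in> set bs" for b
      using \<delta>[OF a(1) that] kap_ultra2[OF x, of a b] a(2) by auto
    then have "\<delta> ^ d \<le> prod_list (map (kap x) bs)"
      using prod_list_map_const_le_power[of bs \<delta> "kap x"] \<open>\<delta> > 0\<close> bs(1) by simp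
    then have "\<eta> \<le> hval d x Q"
      unfolding \<eta>_def bs(2)[OF x] using bs(3) \<open>\<delta> > 0\<close> by (intro mult_mono) auto
    then show ?thesis by (simp add: H_def)
  qed
  moreover have "\<eta> > 0" using as(3) bs(3) \<open>\<delta> > 0\<close> by (simp add: \<eta>_def)
  ultimately show ?thesis using that by blast
qed

lemma H_pos: "x \<in> P1Berk absK \<Longrightarrow> H x > 0"
  using H_lower_bound by (metis order_less_le_trans)

text \<open>\<open>hcomp\<close> with a free degree \<open>n\<close>: the degree of a sum may drop,
  whereas homogenisation in a fixed degree is additive.\<close>

definition hsub :: "nat \<Rightarrow> 'a poly \<Rightarrow> 'a poly" where
  "hsub n f = (\<Sum>i\<le>n. smult (coeff f i) (P ^ i * Q ^ (n - i)))"

lemma hcomp_eq_hsub: "hcomp f P Q = hsub (degree f) f"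
  by (simp add: hcomp_def hsub_def)

lemma hsub_extend:
  assumes "degree f \<le> n"
  shows "hsub (m + n) f = Q ^ m * hsub n f"
proof -
  have "hsub (m + n) f = (\<Sum>i\<le>n. smult (coeff f i) (P ^ i * Q ^ (m + n - i)))"
    unfolding hsub_def by (rule sum.mono_neutral_right) (use assms in \<open>auto simp: coeff_eq_0\<close>)
  also have "\<dots> = (\<Sum>i\<le>n. Q ^ m * smult (coeff f i) (P ^ i * Q ^ (n - i)))"
    by (rule sum.cong) (auto simp: mult.left_commute simp flip: power_add)
  finally show ?thesis by (simp add: hsub_def sum_distrib_left)
qed

lemma hsub_add: "hsub n (f + g) = hsub n f + hsub n g"
  by (simp add: hsub_def smult_add_left sum.distrib)

lemma hsub_smult: "hsub n (smult c f) = smult c (hsub n f)"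
  using sum_distrib_left[of "[:c:]" "\<lambda>i. smult (coeff f i) (P ^ i * Q ^ (n - i))" "{..n}"]
  by (simp add: hsub_def mult.commute)

lemma hsub_pCons: "hsub (Suc n) (pCons a f) = smult a (Q ^ Suc n) + P * hsub n f"
proof -
  have "hsub (Suc n) (pCons a f) = smult a (Q ^ Suc n) + (\<Sum>i\<le>n. smult (coeff f i) (P ^ Suc i * Q ^ (n - i)))"
    unfolding hsub_def by (subst sum.atMost_Suc_shift) simp
  also have "(\<Sum>i\<le>n. smult (coeff f i) (P ^ Suc i * Q ^ (n - i))) = P * hsub n f"
    unfolding hsub_def sum_distrib_left by (rule sum.cong) (auto simp: mult.assoc)
  finally show ?thesis .
qed

lemma hsub_mult:
  assumes "degree f \<le> n" "degree g \<le> m"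
  shows "hsub (n + m) (f * g) = hsub n f * hsub m g"
  using assms(1)
proof (induction f arbitrary: n)
  case 0
  then show ?case by (simp add: hsub_def)
next
  case (pCons a p)
  show ?case
  proof (cases n)
    case 0
    then have "p = 0" using pCons.prems by (auto split: if_splits)
    then show ?thesis using 0 by (simp add: hsub_smult) (simp add: hsub_def)
  next
    case (Suc k)
    then have p: "degree p \<le> k" using pCons.prems by (auto split: if_splits)
    have "hsub (n + m) (pCons a p * g) = smult a (hsub (Suc k + m) g) + hsub (Suc (k + m)) (pCons 0 (p * g))"
      using Suc by (simp add: hsub_add hsub_smult)
    also have "\<dots> = smult a (Q ^ Suc k * hsub m g) + P * (hsub k p * hsub m g)"
      using hsub_extend[OF assms(2), of "Suc k"] pCons.IH[OF p] by (simp add: hsub_pCons)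
    also have "\<dots> = hsub n (pCons a p) * hsub m g"
      unfolding Suc hsub_pCons by (simp add: algebra_simps)
    finally show ?thesis .
  qed
qed

lemma phi_BAff:
  assumes s: "is_mseminorm absK s" and "s Q \<noteq> 0"
  obtains s' where "phi (BAff s) = BAff s'" "is_mseminorm absK s'"
    "\<And>f n. degree f \<le> n \<Longrightarrow> s' f = s (hsub n f) / s Q ^ n"
proof -
  define s' where "s' f = s (hcomp f P Q) / s Q ^ degree f" for f
  have s': "s' f = s (hsub n f) / s Q ^ n" if "degree f \<le> n" for f n
    using hsub_extend[of f "degree f" "n - degree f"] that assms(2)
    by (simp add: s'_def hcomp_eq_hsub sem_mult[OF s] sem_power[OF s] field_simps flip: power_add)
  have "is_mseminorm absK s'"
    unfolding is_mseminorm_def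
  proof (intro conjI allI)
    show "0 \<le> s' f" for f by (simp add: s'_def sem_nonneg[OF s])
    show "s' [:c:] = absK c" for c
      using s'[of "[:c:]" 0] sem_const[OF s, of c] by (simp add: hsub_def)
    show "s' (f * g) = s' f * s' g" for f g
      using s'[of "f * g" "degree f + degree g"] s'[of f "degree f"] s'[of g "degree g"]
        hsub_mult[of f "degree f" g "degree g"] degree_mult_le[of f g] by (simp add: sem_mult[OF s] power_add)
    show "s' (f + g) \<le> s' f + s' g" for f g
    proof -
      define n where "n = max (degree f) (degree g)"
      have "s' (f + g) = s (hsub n f + hsub n g) / s Q ^ n"
        using s'[of "f + g" n] degree_add_le[of f n g] by (simp add: n_def hsub_add)
      also have "\<dots> \<le> (s (hsub n f) + s (hsub n g)) / s Q ^ n"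
        by (intro divide_right_mono sem_triangle[OF s] zero_le_power sem_nonneg[OF s])
      also have "\<dots> = s' f + s' g" using s'[of f n] s'[of g n] by (simp add: n_def add_divide_distrib)
      finally show ?thesis .
    qed
  qed
  moreover have "phi (BAff s) = BAff s'" using assms(2) by (simp add: berk_map_def s'_def fun_eq_iff)
  ultimately show ?thesis using that s' by blast
qed

text \<open>The linear form of \<open>c\<close> pulls back to \<open>num c\<close>, and
  \<open>H x\<close> normalises the coordinates of the image. The cases follow the branches of
  \<open>berk_map\<close>.\<close>

lemma phi_kap:
  assumes x: "x \<in> P1Berk absK"
  shows "phi x \<in> P1Berk absK" "kap (phi x) c = hval d x (num c) / (wt c * H x)"
proof -
  have BInf: "kap BInf c = absK (hc1 c) / wt c" by (simp add: kap_def)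
  have "phi x \<in> P1Berk absK \<and> kap (phi x) c = hval d x (num c) / (wt c * H x)"
    using x
  proof (rule P1Berk_cases)
    assume x: "x = BInf"
    show ?thesis
    proof (cases "degree P > degree Q")
      case True
      then have "coeff Q d = 0" "coeff P d \<noteq> 0" "phi x = BInf"
        using P_nz by (auto simp: d_eq coeff_eq_0 x berk_map_def max_def)
      then show ?thesis by (simp add: BInf x H_def num_def abs_mult max.absorb1)
    next
      case False
      then have q: "d = degree Q" "coeff Q d \<noteq> 0" using Q_nz by (auto simp: d_eq)
      define e where "e = coeff P d / coeff Q d"
      have "phi x = typeI absK e" using False q Q_nz by (auto simp: x berk_map_def e_def coeff_eq_0)
      then have phi: "phi x = pt (Some e)" by (simp add: pt.simps)
      have absq: "absK (coeff Q d) * absK (a / coeff Q d) = absK a" for a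
        using q(2) by (simp flip: abs_mult)
      have n: "absK (coeff (num c) d) = absK (coeff Q d) * absK (e * hc1 c - hc0 c)"
      proof -
        have "coeff (num c) d = coeff Q d * (e * hc1 c - hc0 c)"
          using q(2) by (simp add: num_def e_def right_diff_distrib)
        then show ?thesis by (simp add: abs_mult)
      qed
      have h: "H x = absK (coeff Q d) * max 1 (absK e)"
        using absq[of "coeff P d"] by (simp add: H_def x e_def max_mult_distrib_left max.commute)
      show ?thesis using q(2) by (simp add: phi chord_det n h wt_simps) (simp add: x n)
    qed
  next
    fix s assume s: "x = BAff s" "is_mseminorm absK s"
    define M where "M = max 1 (s tT) ^ d"
    have M: "M > 0" by (simp add: M_def zero_less_power)
    have hv: "hval d x f = s f / M" for f by (simp add: s M_def)
    have HM: "H x = max (s P) (s Q) / M" using M by (simp add: H_def hv max_divide_distrib_right)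
    show ?thesis
    proof (cases "s Q = 0")
      case True
      have "s P > 0" using H_pos[OF x] True M sem_nonneg[OF s(2), of P] by (simp add: HM zero_less_divide_iff)
      have "s (num c) = absK (hc1 c) * s P"
      proof (rule antisym)
        have z: "s (smult (hc0 c) Q) = 0" "s (smult (- hc0 c) Q) = 0" by (simp_all add: sem_smult[OF s(2)] True del: smult_minus_left)
        show "s (num c) \<le> absK (hc1 c) * s P"
          using sem_triangle[OF s(2), of "smult (hc1 c) P" "smult (- hc0 c) Q"] z
          by (simp add: num_def sem_smult[OF s(2), of "hc1 c"])
        show "absK (hc1 c) * s P \<le> s (num c)"
          using sem_triangle[OF s(2), of "num c" "smult (hc0 c) Q"] z
          by (simp add: num_def sem_smult[OF s(2), of "hc1 c"])
      qed
      moreover have "phi x = BInf" using True by (simp add: s berk_map_def)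
      ultimately show ?thesis using True \<open>s P > 0\<close> M by (simp add: hv HM BInf)
    next
      case False
      then obtain s' where s': "phi (BAff s) = BAff s'" "is_mseminorm absK s'"
        "\<And>f n. degree f \<le> n \<Longrightarrow> s' f = s (hsub n f) / s Q ^ n"
        using phi_BAff[OF s(2)] by metis
      have Qp: "s Q > 0" using False sem_nonneg[OF s(2), of Q] by simp
      have "s' [:- hc0 c, hc1 c:] = s (num c) / s Q"
        using s'(3)[of "[:- hc0 c, hc1 c:]" 1] by (simp add: hsub_def num_def)
      moreover have "s' tT = s P / s Q"
        using s'(3)[of tT 1] by (simp add: hsub_def)
      ultimately have "kap (phi x) c = (s (num c) / s Q) / max 1 (s P / s Q) / wt c"
        by (simp add: s(1) s'(1) kap_def)
      also have "max 1 (s P / s Q) = max (s P) (s Q) / s Q"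
        using Qp by (simp add: max_divide_distrib_right max.commute)
      also have "(s (num c) / s Q) / (max (s P) (s Q) / s Q) / wt c = hval d x (num c) / (wt c * H x)"
        using Qp M by (simp add: hv HM mult.commute)
      finally show ?thesis using s' s by auto
    qed
  qed
  then show "phi x \<in> P1Berk absK" "kap (phi x) c = hval d x (num c) / (wt c * H x)" by auto
qed

section \<open>Values at the Gauss point and continuity of the map\<close>

abbreviation "zG \<equiv> gauss absK"
abbreviation "gir \<equiv> GIR absK P Q"
abbreviation "b0 \<equiv> B0 absK P Q"

lemma gauss_in [simp]: "zG \<in> P1Berk absK" by (rule gauss_point)

lemma gir_eq: "gir = diam_G (phi zG)" by (simp add: GIR_def)

lemma hval_gauss_num: "hval d zG (num c) = wt c * (H zG * kap (phi zG) c)"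
  using H_pos[OF gauss_in] by (simp add: phi_kap)

lemma hval_gauss_num_bounds:
  "hval d zG (num c) \<le> wt c * H zG" "wt c * (H zG * gir) \<le> hval d zG (num c)"
proof -
  show "hval d zG (num c) \<le> wt c * H zG" by (rule hval_num_le[OF gauss_in])
  show "wt c * (H zG * gir) \<le> hval d zG (num c)"
    unfolding hval_gauss_num gir_eq using H_pos[OF gauss_in] diam_le_kap[OF phi_kap(1)[OF gauss_in]]
    by (intro mult_left_mono) auto
qed

lemma num_PQ: "num (Some 0) = P" "num None = Q" by (simp_all add: num_simps)

lemma hval_perturb:
  assumes x: "x \<in> P1Berk absK" and w: "w \<in> P1Berk absK" and "berk_leG x w" "\<And>c. kap w c \<le> kap x c + e"
  shows "hval d x (num c) \<le> hval d w (num c)"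
    "hval d w (num c) \<le> hval d x (num c) + wt c * (H zG * (real d * e))"
proof -
  obtain as where as: "length as = d"
    "\<And>x. x \<in> P1Berk absK \<Longrightarrow> hval d x (num c) = hval d zG (num c) * prod_list (map (kap x) as)"
    "0 < hval d zG (num c)"
    using hval_factor[OF num_nz degree_num] by metis
  have b: "0 \<le> kap x c \<and> kap x c \<le> kap w c \<and> kap w c \<le> 1 \<and> kap w c \<le> kap x c + e" for c
    using assms kap_nonneg[OF x] kap_le_1[OF w] by (auto simp: le_fun_def)
  have "prod_list (map (kap x) as) \<le> prod_list (map (kap w) as)"
    using prod_list_map_mono[of as "kap x" "kap w"] b by auto
  then show "hval d x (num c) \<le> hval d w (num c)"
    unfolding as(2)[OF x] as(2)[OF w] using as(3) by (intro mult_left_mono) auto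
  have e: "0 \<le> e" using b[of c] by linarith
  have "hval d w (num c) \<le> hval d zG (num c) * (prod_list (map (kap x) as) + real d * e)"
    unfolding as(2)[OF w] using prod_list_map_diff_le[of "kap x" "kap w" e as] b as(1,3) by (intro mult_left_mono) auto
  also have "\<dots> = hval d x (num c) + hval d zG (num c) * (real d * e)"
    unfolding as(2)[OF x] by (simp add: algebra_simps)
  also have "hval d zG (num c) * (real d * e) \<le> (wt c * H zG) * (real d * e)"
    using hval_gauss_num_bounds(1) e by (intro mult_right_mono) auto
  finally show "hval d w (num c) \<le> hval d x (num c) + wt c * (H zG * (real d * e))" by (simp add: mult.assoc)
qed

text \<open>Numerators and \<open>H\<close> change by at most a multiple of \<open>e\<close>, and
  \<open>H\<close> is bounded away from 0. The constant \<open>C\<close> is far from sharp; it only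
  has to provide continuity and the crude bound for the continuation argument.\<close>

lemma phi_kap_perturb:
  "\<exists>C\<ge>0. \<forall>x\<in>P1Berk absK. \<forall>w\<in>P1Berk absK. \<forall>e. berk_leG x w \<longrightarrow> (\<forall>c. kap w c \<le> kap x c + e) \<longrightarrow>
     (\<forall>c. \<bar>kap (phi w) c - kap (phi x) c\<bar> \<le> C * e)"
proof -
  obtain \<eta> where \<eta>: "\<eta> > 0" "\<And>x. x \<in> P1Berk absK \<Longrightarrow> \<eta> \<le> H x" using H_lower_bound by blast
  define C where "C = H zG * real d / \<eta>"
  have "C \<ge> 0" using H_pos[OF gauss_in] \<eta>(1) by (simp add: C_def)
  moreover have "\<bar>kap (phi w) c - kap (phi x) c\<bar> \<le> C * e"
    if x: "x \<in> P1Berk absK" and w: "w \<in> P1Berk absK" and xw: "berk_leG x w" and e: "\<And>c. kap w c \<le> kap x c + e" for x w e c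
  proof -
    define \<delta> where "\<delta> = H zG * (real d * e)"
    note pert = hval_perturb[OF x w xw e, folded \<delta>_def]
    define U where "U = hval d x (num c) / wt c"
    define V where "V = hval d w (num c) / wt c"
    have UV: "U \<le> V" "V \<le> U + \<delta>" "0 \<le> U" "U \<le> H x" "V \<le> H w"
      using pert[of c] hval_nonneg[OF x] hval_num_le[OF x, of c] hval_num_le[OF w, of c]
      by (auto simp: U_def V_def divide_right_mono field_simps)
    have Hs: "H x \<le> H w" "H w \<le> H x + \<delta>" "\<eta> \<le> H x"
      using pert[of "Some 0"] pert[of None] \<eta>(2)[OF x] by (auto simp: num_PQ H_def wt_simps)
    have k: "kap (phi x) c = U / H x" "kap (phi w) c = V / H w"
      by (simp_all add: phi_kap x w U_def V_def)
    have Hp: "0 < H x" "0 < H w" "0 \<le> \<delta>" using Hs \<eta>(1) UV by auto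
    have Ce: "C * e = \<delta> / \<eta>" by (simp add: C_def \<delta>_def)
    have "V / H w \<le> (U + \<delta>) / H x" using UV Hs Hp by (intro frac_le) auto
    also have "\<dots> = U / H x + \<delta> / H x" by (simp add: add_divide_distrib)
    also have "\<delta> / H x \<le> \<delta> / \<eta>" using Hs \<eta>(1) Hp by (intro divide_left_mono) auto
    finally have 1: "V / H w - U / H x \<le> C * e" using Ce by simp
    have "U / H x - V / H w \<le> U / H x - U / H w" using UV Hp by (simp add: divide_right_mono)
    also have "\<dots> = (U / H x) * ((H w - H x) / H w)" using Hp by (simp add: field_simps)
    also have "\<dots> \<le> 1 * (\<delta> / \<eta>)" using UV Hp Hs \<eta>(1) by (intro mult_mono frac_le) auto
    finally show ?thesis using 1 k Ce by simp
  qed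
  ultimately show ?thesis by (intro exI[of _ C]) simp
qed

lemma phi_pt_of_root:
  assumes "hval d (pt e) (num c) = 0"
  shows "phi (pt e) = pt c"
  by (rule kap_eq_0) (simp_all add: phi_kap assms)

section \<open>The ball-mapping radius\<close>

definition small_radius :: "real \<Rightarrow> bool" where
  "small_radius r \<longleftrightarrow> 0 < r \<and> r \<le> 1 \<and> (\<forall>a \<in> P1K absK. phi ` ball_minus absK a r \<noteq> P1Berk absK)"

lemma b0_eq: "b0 = Sup {r. small_radius r}"
  by (simp add: B0_def small_radius_def)

text \<open>Points of \<open>P1(K)\<close> approximating \<open>y\<close> have preimages near \<open>a\<close>; by compactness of the cube of all
  kernels these preimages cluster at a preimage of \<open>y\<close>.\<close>

lemma phi_surj_of_typeI:
  assumes pre: "\<And>c. \<exists>e. phi (pt e) = pt c \<and> chord e a \<le> r" and y: "y \<in> P1Berk absK"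
  obtains x where "x \<in> P1Berk absK" "phi x = y" "kap x a \<le> r"
proof -
  obtain c where c: "\<And>b. (\<lambda>j::nat. chord (c j) b) \<longlonglongrightarrow> kap y b"
    using tight_approx[OF tight_kap[OF y]] by blast
  have "\<exists>\<alpha>. \<forall>j. phi (pt (\<alpha> j)) = pt (c j) \<and> chord (\<alpha> j) a \<le> r"
    using pre by (intro choice allI)
  then obtain \<alpha> where \<alpha>: "\<And>j. phi (pt (\<alpha> j)) = pt (c j)" "\<And>j. chord (\<alpha> j) a \<le> r" by blast
  obtain g G where G: "G \<noteq> bot" "G \<le> sequentially" "\<And>b. ((\<lambda>j. chord (\<alpha> j) b) \<longlongrightarrow> g b) G"
    using unit_cube_cluster_point[of "\<lambda>j. kap (pt (\<alpha> j))"] kap_nonneg[OF pt_in] kap_le_1[OF pt_in] by metis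
  have "tight g"
    unfolding tight_def
  proof (intro conjI allI)
    fix c e
    show "0 \<le> g c" by (rule tendsto_lowerbound[OF G(3) _ G(1)]) (simp add: kap_nonneg)
    show "g c \<le> 1" by (rule tendsto_upperbound[OF G(3) _ G(1)]) (simp add: kap_le_1)
    show "g c \<le> max (g e) (chord e c)"
      by (rule tendsto_le[OF G(1) tendsto_max[OF G(3) tendsto_const] G(3)]) (simp add: kap_ultra1)
    show "chord e c \<le> max (g e) (g c)"
      by (rule tendsto_lowerbound[OF tendsto_max[OF G(3) G(3)] _ G(1)]) (simp add: kap_ultra2)
  qed
  then obtain x where x: "x \<in> P1Berk absK" "kap x = g" using tight_realized by blast
  have lim: "((\<lambda>j. hval d (pt (\<alpha> j)) (num c)) \<longlongrightarrow> hval d x (num c)) G" for c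
  proof -
    obtain as where as:
      "\<And>x. x \<in> P1Berk absK \<Longrightarrow> hval d x (num c) = hval d zG (num c) * prod_list (map (kap x) as)"
      using hval_factor[OF num_nz degree_num] by metis
    show ?thesis unfolding as[OF pt_in] as[OF x(1)] x(2)
      by (intro tendsto_intros tendsto_prod_list_map G(3))
  qed
  have limH: "((\<lambda>j. H (pt (\<alpha> j))) \<longlongrightarrow> H x) G"
    using lim[of None] lim[of "Some 0"] unfolding H_def num_PQ by (intro tendsto_max)
  have "kap (phi x) b = kap y b" for b
  proof (rule tendsto_unique[OF G(1)])
    show "((\<lambda>j. kap (phi (pt (\<alpha> j))) b) \<longlongrightarrow> kap (phi x) b) G"
      unfolding phi_kap(2)[OF pt_in] phi_kap(2)[OF x(1)]
      using H_pos[OF x(1)] by (intro tendsto_intros lim limH) auto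
    show "((\<lambda>j. kap (phi (pt (\<alpha> j))) b) \<longlongrightarrow> kap y b) G"
      unfolding \<alpha>(1) by (rule tendsto_mono[OF G(2) c])
  qed
  then have "phi x = y" using kap_inject[OF phi_kap(1)[OF x(1)] y] by auto
  moreover have "kap x a \<le> r"
    unfolding x(2) by (rule tendsto_upperbound[OF G(3) _ G(1)]) (simp add: \<alpha>(2))
  ultimately show ?thesis using that x by blast
qed

text \<open>If \<open>H x\<close> were smaller, the product formula would put a preimage of every
  \<open>c\<close> within \<open>u\<close> of \<open>x\<close>, hence all of them into one ball,
  which would then cover the whole line. The margin \<open>u < r\<close> keeps limits of preimages
  inside the ball.\<close>

lemma H_ge_of_small_radius:
  assumes r: "small_radius r" and "u < r" and x: "x \<in> P1Berk absK" "diam_G x < u"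
  shows "H zG * (gir * u ^ d) \<le> H x"
proof (rule ccontr)
  assume "\<not> ?thesis"
  then have lt: "H x < H zG * (gir * u ^ d)" by simp
  have u: "0 < u" using x diam_nonneg[OF x(1)] by simp
  have Hx: "0 < H x" "0 < H zG" using H_pos x(1) by auto
  have near: "\<exists>e. phi (pt e) = pt c \<and> kap x e < u" for c
  proof -
    obtain as where as: "length as = d"
      "\<And>x. x \<in> P1Berk absK \<Longrightarrow> hval d x (num c) = hval d zG (num c) * prod_list (map (kap x) as)"
      using hval_factor[OF num_nz degree_num] by metis
    have nn: "0 \<le> prod_list (map (kap x) as)"
      using prod_list_map_mono[of as "kap x" "kap x"] kap_nonneg[OF x(1)] by auto
    have "wt c * (H zG * gir) * prod_list (map (kap x) as) \<le> hval d zG (num c) * prod_list (map (kap x) as)"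
      using hval_gauss_num_bounds(2) nn by (intro mult_right_mono) auto
    also have "\<dots> = hval d x (num c)" using as(2)[OF x(1)] by simp
    also have "\<dots> \<le> wt c * H x" by (rule hval_num_le[OF x(1)])
    also have "\<dots> < wt c * (H zG * (gir * u ^ d))" using lt by simp
    finally have "wt c * (H zG * gir) * prod_list (map (kap x) as) < wt c * (H zG * gir) * u ^ d"
      by (simp add: mult.assoc)
    moreover have "0 \<le> wt c * (H zG * gir)" using Hx diam_nonneg[OF phi_kap(1)[OF gauss_in]] by (simp add: gir_eq)
    ultimately have "prod_list (map (kap x) as) < u ^ d" by (simp add: mult_less_cancel_left)
    then have "\<not> (\<forall>e\<in>set as. u \<le> kap x e)"
      using prod_list_map_const_le_power[of as u "kap x"] as(1) u by auto
    then obtain e where e: "e \<in> set as" "kap x e < u" by auto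
    have "prod_list (map (chord e) as) = 0" using e(1) by (auto simp: prod_list_zero_iff image_iff intro!: bexI[of _ e])
    then have "hval d (pt e) (num c) = 0" using as(2)[OF pt_in, of e] by simp
    then show ?thesis using phi_pt_of_root e(2) by blast
  qed
  obtain a where a: "kap x a < u" using diam_lessD[OF x] by blast
  have pre: "\<exists>e. phi (pt e) = pt c \<and> chord e a \<le> u" for c
    using near[of c] kap_ultra2[OF x(1), of _ a] a by (meson less_imp_le max.boundedI order_trans)
  have r01: "0 < r" "r \<le> 1" and ns: "phi ` ball_minus absK (pt a) r \<noteq> P1Berk absK"
    using r P1K_eq by (auto simp: small_radius_def)
  have "P1Berk absK \<subseteq> phi ` ball_minus absK (pt a) r"
  proof
    fix y assume "y \<in> P1Berk absK"
    then obtain z where z: "z \<in> P1Berk absK" "phi z = y" "kap z a \<le> u"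
      using phi_surj_of_typeI[OF pre] by blast
    have ball: "z \<in> ball_minus_lt1 absK (pt a) t" if "u < t" "t \<le> 1" for t
    proof -
      \<comment> \<open>The boundary point has value \<open>t\<close> at \<open>a\<close>, which
        exceeds \<open>u\<close>, so it is not \<open>z\<close>.\<close>
      have "kap (raise (pt a) t) a = t" using raise(2)[OF pt_in, of t a a] that u by simp
      then show ?thesis using ball_minus_lt1_iff[of t z a] that u z by auto
    qed
    have "z \<in> ball_minus absK (pt a) r"
    proof (cases "r < 1")
      case True
      then show ?thesis using ball[of r] assms(2) by (simp add: ball_minus_def)
    next
      case False
      \<comment> \<open>For \<open>r = 1\<close> the ball is a union over smaller radii, and the
        midpoint of \<open>u\<close> and 1 is one of them.\<close>
      then have "u < (u + 1) / 2" "(u + 1) / 2 < 1" using assms(2) r01 by auto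
      then show ?thesis using ball[of "(u + 1) / 2"] False u
        by (auto simp: ball_minus_def intro!: bexI[of _ "(u + 1) / 2"])
    qed
    then show "y \<in> phi ` ball_minus absK (pt a) r" using z by blast
  qed
  moreover have "phi ` ball_minus absK (pt a) r \<subseteq> P1Berk absK"
    by (auto simp: ball_minus_def ball_minus_lt1_def phi_kap split: if_splits)
  ultimately show False using ns by blast
qed

text \<open>A small ball cannot contain preimages of both \<open>0\<close> and \<open>\<infinity>\<close>.\<close>

lemma small_radius_exists: "\<exists>r. small_radius r"
proof -
  obtain \<eta> where \<eta>: "\<eta> > 0" "\<And>x. x \<in> P1Berk absK \<Longrightarrow> \<eta> \<le> H x" using H_lower_bound by blast
  have h: "0 < H zG" using H_pos by simp
  define r where "r = min (1 / 2) (\<eta> / (2 * H zG))"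
  have r: "0 < r" "r < 1" "H zG * r < \<eta>"
  proof -
    show "0 < r" "r < 1" using \<eta>(1) h by (auto simp: r_def)
    have "H zG * r \<le> H zG * (\<eta> / (2 * H zG))" using h by (intro mult_left_mono) (auto simp: r_def)
    then show "H zG * r < \<eta>" using h \<eta>(1) by simp
  qed
  have "phi ` ball_minus absK (pt a) r \<noteq> P1Berk absK" for a
  proof
    assume surj: "phi ` ball_minus absK (pt a) r = P1Berk absK"
    \<comment> \<open>The boundary point of the ball. Preimages in the ball of both 0 and infinity
      give each of \<open>P\<close> and \<open>Q\<close> a root within \<open>r\<close> of the
      centre, and then \<open>H q\<close> falls below its lower bound.\<close>
    define q where "q = raise (pt a) r"
    have q: "q \<in> P1Berk absK" "\<And>c. kap q c = max (chord a c) r"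
      using raise[OF pt_in, of r a] r by (auto simp: q_def)
    have "hval d q (num c) \<le> wt c * (H zG * r)" for c
    proof -
      obtain as where as: "length as = d"
        "\<And>x. x \<in> P1Berk absK \<Longrightarrow> hval d x (num c) = hval d zG (num c) * prod_list (map (kap x) as)"
        "0 < hval d zG (num c)"
        using hval_factor[OF num_nz degree_num] by metis
      have "pt c \<in> phi ` ball_minus absK (pt a) r" using surj pt_in by blast
      then obtain x where x: "x \<in> ball_minus absK (pt a) r" "phi x = pt c" by auto
      then have x': "x \<in> P1Berk absK" "kap x a \<le> r"
        using ball_minus_lt1_iff[of r x a] r by (auto simp: ball_minus_def)
      have "kap (phi x) c = 0" using x(2) by simp
      then have "hval d x (num c) = 0" using phi_kap(2)[OF x'(1), of c] H_pos[OF x'(1)] by simp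
      then have "prod_list (map (kap x) as) = 0" using as(2)[OF x'(1)] as(3) by simp
      then obtain e where e: "e \<in> set as" "kap x e = 0" by (auto simp: prod_list_zero_iff image_iff)
      then have "chord a e \<le> r" using kap_ultra2[OF x'(1), of a e] x'(2) r by auto
      then have "prod_list (map (kap q) as) \<le> r"
        using prod_list_map_le_elem[of "kap q" e as] e(1) kap_nonneg[OF q(1)] kap_le_1[OF q(1)] q(2)[of e] by simp
      then have "hval d q (num c) \<le> hval d zG (num c) * r"
        unfolding as(2)[OF q(1)] using as(3) by (intro mult_left_mono) auto
      also have "\<dots> \<le> wt c * H zG * r" using hval_gauss_num_bounds(1) r by (intro mult_right_mono) auto
      finally show ?thesis by (simp add: mult.assoc)
    qed
    from this[of None] this[of "Some 0"] have "H q \<le> H zG * r" by (simp add: num_PQ H_def wt_simps)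
    then show False using \<eta>(2)[OF q(1)] r(3) by simp
  qed
  then show ?thesis using r P1K_eq by (intro exI[of _ r]) (auto simp: small_radius_def)
qed

lemma b0_bounds: "0 < b0" "b0 \<le> 1"
proof -
  obtain r where r: "small_radius r" using small_radius_exists by blast
  have bdd: "bdd_above {r. small_radius r}" by (auto simp: small_radius_def)
  have "r \<le> b0" unfolding b0_eq using r bdd by (intro cSup_upper) auto
  then show "0 < b0" using r by (simp add: small_radius_def)
  show "b0 \<le> 1" unfolding b0_eq using r by (intro cSup_least) (auto simp: small_radius_def)
qed

text \<open>The supremum \<open>b0\<close> need not be attained: the estimate holds for
  \<open>u\<close> below it and passes to the limit.\<close>

lemma H_ge_below_b0:
  assumes x: "x \<in> P1Berk absK" "diam_G x < b0"
  shows "H zG * (gir * b0 ^ d) \<le> H x"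
proof (rule tendsto_upperbound)
  show "((\<lambda>u. H zG * (gir * u ^ d)) \<longlongrightarrow> H zG * (gir * b0 ^ d)) (at_left b0)"
    by (intro tendsto_intros)
  have "\<forall>\<^sub>F u in at_left b0. u \<in> {diam_G x<..<b0}"
    by (rule eventually_at_leftI[OF _ x(2)]) simp
  then show "\<forall>\<^sub>F u in at_left b0. H zG * (gir * u ^ d) \<le> H x"
  proof eventually_elim
    case (elim u)
    then obtain r where "small_radius r" "u < r"
      using less_cSupE[of u "{r. small_radius r}"] small_radius_exists by (auto simp: b0_eq)
    then show ?case using H_ge_of_small_radius x elim by auto
  qed
qed simp

section \<open>The monomial form of the image along a path\<close>

lemma num_germ:
  assumes x: "x \<in> P1Berk absK" and \<tau>: "diam_G x < \<tau>" "\<tau> < 1"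
  obtains C N where "0 < C" "C \<le> hval d zG (num c)" "N \<le> d"
    "eventually (\<lambda>t. hval d (raise x t) (num c) = C * t ^ N) (at_right \<tau>)"
proof -
  obtain as where as: "length as = d"
    "\<And>x. x \<in> P1Berk absK \<Longrightarrow> hval d x (num c) = hval d zG (num c) * prod_list (map (kap x) as)"
    "0 < hval d zG (num c)"
    using hval_factor[OF num_nz degree_num] by metis
  have \<tau>0: "0 \<le> \<tau>" using diam_nonneg[OF x] \<tau> by simp
  have k1: "kap x a \<le> 1" for a by (rule kap_le_1[OF x])
  from prod_list_max_germ[of \<tau> "kap x" as, OF \<tau>0 k1] obtain C N where C: "0 < C" "C \<le> 1" "N \<le> d"
    "eventually (\<lambda>t. prod_list (map (\<lambda>a. max (kap x a) t) as) = C * t ^ N) (at_right \<tau>)"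
    unfolding as(1) by blast
  have "eventually (\<lambda>t. hval d (raise x t) (num c) = (hval d zG (num c) * C) * t ^ N) (at_right \<tau>)"
    using C(4) eventually_raise[OF assms]
  proof eventually_elim
    case (elim t)
    then have "hval d (raise x t) (num c) = hval d zG (num c) * prod_list (map (\<lambda>a. max (kap x a) t) as)"
      using as(2)[of "raise x t"] by simp
    then show ?case unfolding elim(1) by simp
  qed
  moreover have "hval d zG (num c) * C \<le> hval d zG (num c)" using C as(3) by (simp add: mult_left_le)
  moreover have "0 < hval d zG (num c) * C" using C as(3) by simp
  ultimately show ?thesis using C(3) by (intro that[of "hval d zG (num c) * C" N])
qed

text \<open>\<open>H\<close> is a maximum of two monomials; different exponents are separated just
  above \<tau>, and equal ones are compared by their coefficients.\<close>

lemma H_germ: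
  assumes x: "x \<in> P1Berk absK" and \<tau>: "diam_G x < \<tau>" "\<tau> < 1"
  obtains C N where "0 < C" "C \<le> H zG" "N \<le> d"
    "eventually (\<lambda>t. H (raise x t) = C * t ^ N) (at_right \<tau>)"
proof -
  obtain C1 N1 where 1: "0 < C1" "C1 \<le> hval d zG P" "N1 \<le> d"
    "eventually (\<lambda>t. hval d (raise x t) P = C1 * t ^ N1) (at_right \<tau>)"
    using num_germ[OF assms, of "Some 0"] unfolding num_PQ by blast
  obtain C2 N2 where 2: "0 < C2" "C2 \<le> hval d zG Q" "N2 \<le> d"
    "eventually (\<lambda>t. hval d (raise x t) Q = C2 * t ^ N2) (at_right \<tau>)"
    using num_germ[OF assms, of None] unfolding num_PQ by blast
  have dec: "deciding (at_right \<tau>) (\<lambda>t. t)" using diam_nonneg[OF x] \<tau> by (intro deciding_at_right) simp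
  have pos: "eventually (\<lambda>t. 0 < t) (at_right \<tau>)" using dec by (simp add: deciding_def)
  note conclude = that
  have H1: ?thesis if "eventually (\<lambda>t. C2 * t ^ N2 \<le> C1 * t ^ N1) (at_right \<tau>)"
  proof (rule conclude[of C1 N1])
    show "eventually (\<lambda>t. H (raise x t) = C1 * t ^ N1) (at_right \<tau>)"
      using 1(4) 2(4) \<open>eventually (\<lambda>t. C2 * t ^ N2 \<le> C1 * t ^ N1) (at_right \<tau>)\<close>
      by eventually_elim (simp add: H_def)
  qed (use 1 in \<open>auto simp: H_def\<close>)
  have H2: ?thesis if "eventually (\<lambda>t. C1 * t ^ N1 \<le> C2 * t ^ N2) (at_right \<tau>)"
  proof (rule conclude[of C2 N2])
    show "eventually (\<lambda>t. H (raise x t) = C2 * t ^ N2) (at_right \<tau>)"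
      using 1(4) 2(4) \<open>eventually (\<lambda>t. C1 * t ^ N1 \<le> C2 * t ^ N2) (at_right \<tau>)\<close>
      by eventually_elim (simp add: H_def)
  qed (use 2 in \<open>auto simp: H_def\<close>)
  have weaken: "eventually (\<lambda>t. f t \<le> g t) (at_right \<tau>)" if "eventually (\<lambda>t. f t < g t) (at_right \<tau>)" for f g :: "real \<Rightarrow> real"
    using that by (rule eventually_mono) simp
  have "eventually (\<lambda>t. C2 * t ^ N2 \<le> C1 * t ^ N1) (at_right \<tau>) \<or> eventually (\<lambda>t. C1 * t ^ N1 \<le> C2 * t ^ N2) (at_right \<tau>)"
  proof (cases N1 N2 rule: linorder_cases)
    case less
    from deciding_monomials[OF dec 1(1) 2(1) less] show ?thesis
      using weaken[of "\<lambda>t. C1 * t ^ N1" "\<lambda>t. C2 * t ^ N2"] weaken[of "\<lambda>t. C2 * t ^ N2" "\<lambda>t. C1 * t ^ N1"] by blast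
  next
    case equal
    show ?thesis
    proof (cases "C1 \<le> C2")
      case True
      have "eventually (\<lambda>t. C1 * t ^ N1 \<le> C2 * t ^ N2) (at_right \<tau>)"
        using pos by eventually_elim (use True equal in \<open>auto intro: mult_right_mono\<close>)
      then show ?thesis ..
    next
      case False
      have "eventually (\<lambda>t. C2 * t ^ N2 \<le> C1 * t ^ N1) (at_right \<tau>)"
        using pos by eventually_elim (use False equal in \<open>auto intro: mult_right_mono\<close>)
      then show ?thesis ..
    qed
  next
    case greater
    from deciding_monomials[OF dec 2(1) 1(1) greater] show ?thesis
      using weaken[of "\<lambda>t. C1 * t ^ N1" "\<lambda>t. C2 * t ^ N2"] weaken[of "\<lambda>t. C2 * t ^ N2" "\<lambda>t. C1 * t ^ N1"] by blast
  qed
  then show ?thesis using H1 H2 by blast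
qed

text \<open>If every \<open>num c\<close> had the exponent of \<open>H\<close>, then for every
  \<open>c\<close> the values of \<open>P - c Q\<close> and \<open>Q\<close> would be proportional
  just above \<tau>, which the Laurent expansion excludes.\<close>

lemma slope_exists:
  assumes x: "x \<in> P1Berk absK" and \<tau>: "diam_G x < \<tau>" "\<tau> < 1"
  obtains c C N D M where "0 < C" "C \<le> hval d zG (num c)" "N \<le> d" "0 < D" "D \<le> H zG" "M \<le> d" "N \<noteq> M"
    "eventually (\<lambda>t. hval d (raise x t) (num c) = C * t ^ N) (at_right \<tau>)"
    "eventually (\<lambda>t. H (raise x t) = D * t ^ M) (at_right \<tau>)"
proof -
  let ?F = "at_right \<tau>"
  obtain D M where D: "0 < D" "D \<le> H zG" "M \<le> d" "eventually (\<lambda>t. H (raise x t) = D * t ^ M) ?F"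
    using H_germ[OF assms] by blast
  have "\<exists>c C N. 0 < C \<and> C \<le> hval d zG (num c) \<and> N \<le> d \<and> N \<noteq> M \<and>
      eventually (\<lambda>t. hval d (raise x t) (num c) = C * t ^ N) ?F"
  proof (rule ccontr)
    assume no: "\<not> ?thesis"
    have all: "\<exists>C>0. eventually (\<lambda>t. hval d (raise x t) (num c) = C * t ^ M) ?F" for c
    proof -
      obtain C N where C: "0 < C" "C \<le> hval d zG (num c)" "N \<le> d"
        "eventually (\<lambda>t. hval d (raise x t) (num c) = C * t ^ N) ?F" by (rule num_germ[OF assms])
      moreover from this have "N = M" using no by blast
      ultimately show ?thesis by blast
    qed
    obtain s E u a where s: "eventually (\<lambda>t. is_mseminorm absK (s t) \<and> raise x t = BAff (s t)) ?F"
      and lin: "\<forall>b. \<exists>C>0. eventually (\<lambda>t. s t [:-b, 1:] = C * (if b \<in> E then u t else 1)) ?F"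
      and u: "deciding ?F u" and a: "a \<in> E"
      by (rule affine_germ[OF assms])
    have s': "eventually (\<lambda>t. is_mseminorm absK (s t)) ?F" using s by eventually_elim simp
    have "P \<noteq> smult c Q" for c using num_nz[of "Some c"] by (simp add: num_simps)
    then obtain c where c: "\<And>K. \<not> eventually (\<lambda>t. s t (P - smult c Q) = K * s t Q) ?F"
      using rational_germ_not_const[OF s' lin[rule_format] u a Q_nz] by blast
    obtain C1 where C1: "C1 > 0" "eventually (\<lambda>t. hval d (raise x t) (num (Some c)) = C1 * t ^ M) ?F" using all by blast
    obtain C2 where C2: "C2 > 0" "eventually (\<lambda>t. hval d (raise x t) (num None) = C2 * t ^ M) ?F" using all by blast
    have "eventually (\<lambda>t. s t (P - smult c Q) = (C1 / C2) * s t Q) ?F"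
      using s C1(2) C2(2)
    proof eventually_elim
      case (elim t)
      define K where "K = max 1 (s t tT) ^ d"
      have K: "K > 0" by (simp add: K_def zero_less_power)
      have "s t (P - smult c Q) / K = C1 * t ^ M" "s t Q / K = C2 * t ^ M"
        using elim by (auto simp: num_simps K_def)
      then have "s t (P - smult c Q) = C1 * t ^ M * K" "s t Q = C2 * t ^ M * K" using K by (auto simp: field_simps)
      then show ?case using C2(1) by simp
    qed
    then show False using c by blast
  qed
  then obtain c C N where "0 < C" "C \<le> hval d zG (num c)" "N \<le> d" "N \<noteq> M"
      "eventually (\<lambda>t. hval d (raise x t) (num c) = C * t ^ N) ?F" by blast
  then show ?thesis by (intro that[of C c N D M] D)
qed

text \<open>That is, the image moves along the path from the point \<open>c\<close> of \<open>P1(K)\<close> to the Gauss point.\<close>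

lemma local_form:
  assumes x: "x \<in> P1Berk absK" and \<tau>: "diam_G x < \<tau>" "\<tau> < 1"
  obtains b c K N M where "\<tau> < b" "b \<le> 1" "0 < K" "N \<le> d" "M \<le> d" "N \<noteq> M"
    "\<forall>t. \<tau> < t \<and> t < b \<longrightarrow> kap (phi (raise x t)) c = K * (t ^ N / t ^ M) \<and>
       hval d (raise x t) (num c) \<le> wt c * (H zG * t ^ N) \<and> H (raise x t) \<le> H zG * t ^ M \<and>
       diam_G (phi (raise x t)) = K * (t ^ N / t ^ M)"
proof -
  obtain c C N D M where *: "0 < C" "C \<le> hval d zG (num c)" "N \<le> d" "0 < D" "D \<le> H zG" "M \<le> d" "N \<noteq> M"
    "eventually (\<lambda>t. hval d (raise x t) (num c) = C * t ^ N) (at_right \<tau>)"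
    "eventually (\<lambda>t. H (raise x t) = D * t ^ M) (at_right \<tau>)"
    by (rule slope_exists[OF assms])
  from eventually_conj[OF *(8,9)] obtain b' where b': "\<tau> < b'"
    "\<And>t. \<tau> < t \<Longrightarrow> t < b' \<Longrightarrow> hval d (raise x t) (num c) = C * t ^ N \<and> H (raise x t) = D * t ^ M"
    unfolding eventually_at_right_field by blast
  define b where "b = min b' 1"
  have b: "\<tau> < b" "b \<le> 1" "b \<le> b'" using b' \<tau> by (auto simp: b_def)
  define K where "K = C / (wt c * D)"
  have K: "0 < K" using *(1,4) by (simp add: K_def)
  have \<tau>0: "0 \<le> \<tau>" using diam_nonneg[OF x] \<tau> by simp
  define y where "y t = K * (t ^ N / t ^ M)" for t
  have pth: "raise x t \<in> P1Berk absK" "phi (raise x t) \<in> P1Berk absK" if "\<tau> < t" "t < b" for t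
    using raise_mono(1)[OF x, of t t] phi_kap(1) that \<tau> b(2) by auto
  have hv: "hval d (raise x t) (num c) = C * t ^ N" "H (raise x t) = D * t ^ M" if "\<tau> < t" "t < b" for t
    using b'(2)[of t] that b(3) by auto
  have kc: "kap (phi (raise x t)) c = y t" if "\<tau> < t" "t < b" for t
    using phi_kap(2)[OF pth(1)[OF that], of c] hv[OF that] by (simp add: K_def y_def)
  obtain C0 where C0: "C0 \<ge> 0"
    "\<forall>x\<in>P1Berk absK. \<forall>w\<in>P1Berk absK. \<forall>e. berk_leG x w \<longrightarrow> (\<forall>c. kap w c \<le> kap x c + e) \<longrightarrow>
       (\<forall>c. \<bar>kap (phi w) c - kap (phi x) c\<bar> \<le> C0 * e)"
    using phi_kap_perturb by blast
  \<comment> \<open>An \<open>e\<close> with smaller kernel would force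
    \<open>chord e c = y t\<close>, and by continuity also \<open>chord e c = y (t + h)\<close> for
    small \<open>h\<close>; but \<open>N \<noteq> M\<close> makes \<open>y\<close> injective. Hence
    the infimum of the kernel is attained at \<open>c\<close>.\<close>
  have min: "y t \<le> kap (phi (raise x t)) e" if t: "\<tau> < t" "t < b" for t e
  proof (rule ccontr)
    assume n: "\<not> y t \<le> kap (phi (raise x t)) e"
    have ch: "chord e c = y t'" if t': "\<tau> < t'" "t' < b" "kap (phi (raise x t')) e < y t'" for t'
      using kap_ultra1[OF pth(2)[OF t'(1,2)], of c e] kap_ultra2[OF pth(2)[OF t'(1,2)], of e c]
        kc[OF t'(1,2)] t'(3) by auto
    define g where "g = y t - kap (phi (raise x t)) e"
    have g: "0 < g" using n by (simp add: g_def)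
    \<comment> \<open>Between \<open>t\<close> and \<open>t + h\<close> each of the two kernel
      values moves by at most \<open>C0 * h\<close>, so the gap \<open>g\<close> stays open if
      \<open>2 * C0 * h < g\<close>. The added 1 covers \<open>C0 = 0\<close>.\<close>
    define g' where "g' = g / (2 * C0 + 1)"
    have "0 < g'" using g C0(1) by (simp add: g'_def)
    define h where "h = min ((b - t) / 2) (g' / 2)"
    have h: "0 < h" "t + h < b" "h < g'"
    proof -
      show "0 < h" using t \<open>0 < g'\<close> by (simp add: h_def)
      have hh: "h \<le> (b - t) / 2" "h \<le> g' / 2" unfolding h_def by (rule min.cobounded1, rule min.cobounded2)
      have "2 * h \<le> b - t" using hh(1) by simp
      then show "t + h < b" using t by arith
      show "h < g'" using hh(2) \<open>0 < g'\<close> by linarith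
    qed
    have "2 * C0 * h < g"
    proof -
      have "h * (2 * C0 + 1) < g" using h(3) C0(1) by (simp add: g'_def pos_less_divide_eq)
      then show ?thesis using h(1) by (simp add: algebra_simps)
    qed
    have r: "diam_G x \<le> t" "t \<le> t + h" "t + h \<le> 1" using t \<tau> h b(2) by auto
    have pert: "\<bar>kap (phi (raise x (t + h))) e' - kap (phi (raise x t)) e'\<bar> \<le> C0 * h" for e'
    proof (rule C0(2)[rule_format, OF raise_mono(1-3)[OF x r]])
      show "kap (raise x (t + h)) c \<le> kap (raise x t) c + h" for c
        using raise_mono(4)[OF x r, of c] by simp
    qed
    have t': "\<tau> < t + h" "t + h < b" using t h by auto
    have "kap (phi (raise x (t + h))) e < y (t + h)"
      using pert[of e] pert[of c] kc[OF t] kc[OF t'] \<open>2 * C0 * h < g\<close> unfolding g_def by linarith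
    then have "y (t + h) = y t" using ch[OF t'] ch[OF t] n by simp
    then have "(t + h) ^ N / (t + h) ^ M = t ^ N / t ^ M" using K unfolding y_def mult_cancel_left by linarith
    then have "t + h = t" using power_quotient_inj[of "t + h" t N M] t t' \<tau>0 *(7) by auto
    then show False using h by simp
  qed
  have fin: "kap (phi (raise x t)) c = K * (t ^ N / t ^ M) \<and>
       hval d (raise x t) (num c) \<le> wt c * (H zG * t ^ N) \<and> H (raise x t) \<le> H zG * t ^ M \<and>
       diam_G (phi (raise x t)) = K * (t ^ N / t ^ M)" if t: "\<tau> < t" "t < b" for t
  proof (intro conjI)
    have t0: "0 < t" using t \<tau>0 by simp
    show "kap (phi (raise x t)) c = K * (t ^ N / t ^ M)" using kc[OF t] by (simp add: y_def)
    have "C \<le> wt c * H zG" using *(2) hval_gauss_num_bounds(1)[of c] by simp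
    then have "C * t ^ N \<le> wt c * H zG * t ^ N" using t0 by (intro mult_right_mono) auto
    then show "hval d (raise x t) (num c) \<le> wt c * (H zG * t ^ N)" using hv[OF t] by (simp add: mult.assoc)
    show "H (raise x t) \<le> H zG * t ^ M" unfolding hv[OF t] using t0 *(5) by (intro mult_right_mono) auto
    show "diam_G (phi (raise x t)) = K * (t ^ N / t ^ M)"
      using diam_le_kap[OF pth(2)[OF t], of c] diam_greatest[OF pth(2)[OF t] min[OF t]] kc[OF t]
      by (simp add: y_def)
  qed
  then show ?thesis by (intro that[OF b(1,2) K *(3,6,7), of c]) blast
qed

text \<open>The monomial form yields a point \<open>q\<close> whose image has positive diameter.
  Towards the Gauss point \<open>kap (phi x) e * H x\<close> does not decrease, for any
  \<open>e\<close>, so positivity carries over. The starting parameter \<open>1 / 2\<close> is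
  arbitrary.\<close>

lemma gir_pos: "0 < gir" "gir \<le> 1"
proof -
  have dN: "diam_G (pt None) < 1 / 2"
    using diam_le_kap[OF pt_in, of None None] chord_self[of None] by linarith
  obtain b c K N M where l: "1 / 2 < b" "b \<le> 1" "0 < K"
    "\<forall>t. 1 / 2 < t \<and> t < b \<longrightarrow> kap (phi (raise (pt None) t)) c = K * (t ^ N / t ^ M) \<and>
       hval d (raise (pt None) t) (num c) \<le> wt c * (H zG * t ^ N) \<and> H (raise (pt None) t) \<le> H zG * t ^ M \<and>
       diam_G (phi (raise (pt None) t)) = K * (t ^ N / t ^ M)"
    by (rule local_form[OF pt_in dN]) simp_all
  define t where "t = (1 / 2 + b) / 2"
  have t: "1 / 2 < t" "t < b" using l by (auto simp: t_def)
  define q where "q = raise (pt None) t"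
  have q: "q \<in> P1Berk absK" using raise(1)[OF pt_in, of t None] t l by (auto simp: q_def)
  have dq: "0 < diam_G (phi q)" using l(3,4) t by (auto simp: q_def)
  have Hp: "0 < H q" "0 < H zG" using H_pos q by auto
  have "diam_G (phi q) * H q / H zG \<le> diam_G (phi zG)"
  proof (rule diam_greatest[OF phi_kap(1)[OF gauss_in]])
    fix e
    obtain as where as: "length as = d"
      "\<And>x. x \<in> P1Berk absK \<Longrightarrow> hval d x (num e) = hval d zG (num e) * prod_list (map (kap x) as)"
      "0 < hval d zG (num e)"
      using hval_factor[OF num_nz degree_num] by metis
    have "diam_G (phi q) \<le> kap (phi q) e" by (rule diam_le_kap[OF phi_kap(1)[OF q]])
    also have "\<dots> = hval d q (num e) / (wt e * H q)" by (rule phi_kap(2)[OF q])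
    also have "\<dots> \<le> hval d zG (num e) / (wt e * H q)"
    proof (rule divide_right_mono)
      have "prod_list (map (kap q) as) \<le> 1" by (rule prod_list_map_le_one) (simp add: kap_nonneg[OF q] kap_le_1[OF q])
      then show "hval d q (num e) \<le> hval d zG (num e)"
        unfolding as(2)[OF q] using as(3) by (simp add: mult_left_le)
      show "0 \<le> wt e * H q" using Hp by simp
    qed
    finally have "diam_G (phi q) * H q \<le> hval d zG (num e) / (wt e * H q) * H q" using Hp by (intro mult_right_mono) auto
    also have "\<dots> = kap (phi zG) e * H zG" using Hp phi_kap(2)[OF gauss_in, of e] by simp
    finally show "diam_G (phi q) * H q / H zG \<le> kap (phi zG) e" using Hp by (simp add: pos_divide_le_eq)
  qed
  moreover have "0 < diam_G (phi q) * H q / H zG" using dq Hp by simp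
  ultimately show "0 < gir" by (simp add: gir_eq)
  show "gir \<le> 1" unfolding gir_eq by (rule diam_le_1[OF phi_kap(1)[OF gauss_in]])
qed

section \<open>The Lipschitz bound\<close>

definition LB :: real where
  "LB = max (1 / (gir * b0 ^ d)) (real d / (gir powr (1 / real d) * b0))"

lemma LB_nonneg: "0 \<le> LB"
  using gir_pos b0_bounds by (simp add: LB_def le_max_iff_disj)

text \<open>For \<open>t < b0\<close> the extreme exponents 1 and \<open>d\<close> yield the two
  terms of \<open>LB\<close>; for \<open>t \<ge> b0\<close> the second term suffices because
  \<open>gir \<le> 1\<close>.\<close>

lemma slope_le_LB:
  assumes y: "0 < y" "y \<le> 1" and t: "0 < t" and m: "1 \<le> m" "m \<le> d"
    and key: "t < b0 \<Longrightarrow> (y / t) ^ m \<le> 1 / (gir * b0 ^ d)"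
  shows "real m * (y / t) \<le> LB"
proof (cases "t < b0")
  case True
  show ?thesis unfolding LB_def
    by (rule mult_root_le_max_endpoints) (use y t m key[OF True] gir_pos b0_bounds in auto)
next
  case False
  have "real m * (y / t) \<le> real d * (1 / b0)"
    using False y t m b0_bounds by (intro mult_mono frac_le) auto
  also have "\<dots> \<le> real d / (gir powr (1 / real d) * b0)"
  proof -
    have "gir powr (1 / real d) \<le> 1 powr (1 / real d)" using gir_pos by (intro powr_mono2) auto
    then have "gir powr (1 / real d) * b0 \<le> 1 * b0" using b0_bounds by (intro mult_right_mono) auto
    moreover have "0 < gir powr (1 / real d) * b0" using gir_pos b0_bounds by simp
    ultimately have "real d / b0 \<le> real d / (gir powr (1 / real d) * b0)"
      by (intro divide_left_mono) (auto intro: mult_pos_pos b0_bounds(1))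
    then show ?thesis by simp
  qed
  finally show ?thesis by (simp add: LB_def)
qed

lemma local_Lipschitz:
  assumes x: "x \<in> P1Berk absK" and \<tau>: "diam_G x < \<tau>" "\<tau> < 1"
  shows "\<exists>b>\<tau>. \<forall>s t. \<tau> < s \<longrightarrow> s < t \<longrightarrow> t < b \<longrightarrow> berk_d absK (phi (raise x s)) (phi (raise x t)) \<le> LB * (t - s)"
proof -
  obtain b c K N M where b: "\<tau> < b" "b \<le> 1" and K: "0 < K" and NM: "N \<le> d" "M \<le> d" "N \<noteq> M" and
    lf: "\<forall>t. \<tau> < t \<and> t < b \<longrightarrow> kap (phi (raise x t)) c = K * (t ^ N / t ^ M) \<and>
       hval d (raise x t) (num c) \<le> wt c * (H zG * t ^ N) \<and> H (raise x t) \<le> H zG * t ^ M \<and>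
       diam_G (phi (raise x t)) = K * (t ^ N / t ^ M)"
    by (rule local_form[OF assms])
  define y where "y t = K * (t ^ N / t ^ M)" for t
  have \<tau>0: "0 \<le> \<tau>" using diam_nonneg[OF x] \<tau> by simp
  have pth: "raise x t \<in> P1Berk absK" "phi (raise x t) \<in> P1Berk absK" "diam_G (raise x t) = t" if "\<tau> < t" "t < b" for t
    using raise_mono(1)[OF x, of t t] phi_kap(1) raise_diam[OF x, of t] that \<tau> b(2) by auto
  have gB: "0 < gir * b0 ^ d" using gir_pos b0_bounds by simp
  have Hz: "0 < H zG" using H_pos by simp
  have y1: "0 < y t" "y t \<le> 1" if "\<tau> < t" "t < b" for t
  proof -
    show "0 < y t" using K that \<tau>0 by (simp add: y_def)
    have "kap (phi (raise x t)) c = y t" using lf that by (simp add: y_def)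
    then show "y t \<le> 1" using kap_le_1[OF pth(2)[OF that], of c] by simp
  qed
  \<comment> \<open>\<open>c\<close> attains the diameter of both images, so their join has diameter
    at most the larger of \<open>y s\<close> and \<open>y t\<close>.\<close>
  have dist: "berk_d absK (phi (raise x s)) (phi (raise x t)) \<le> \<bar>y t - y s\<bar>" if st: "\<tau> < s" "s < t" "t < b" for s t
  proof -
    have s: "\<tau> < s" "s < b" and t: "\<tau> < t" "t < b" using st by auto
    have "kap (phi (raise x s)) c = y s" "diam_G (phi (raise x s)) = y s"
      "kap (phi (raise x t)) c = y t" "diam_G (phi (raise x t)) = y t"
      using lf s t by (auto simp: y_def)
    then show ?thesis using berk_d_le[OF pth(2)[OF s] pth(2)[OF t], of c] by auto
  qed
  define m where "m = (if M < N then N - M else M - N)"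
  have m: "1 \<le> m" "m \<le> d" using NM by (auto simp: m_def)
  have slope: "real m * (y t / t) \<le> LB" if t: "\<tau> < t" "t < b" for t
  proof (rule slope_le_LB)
    show "0 < y t" "y t \<le> 1" "0 < t" "1 \<le> m" "m \<le> d" using y1[OF t] m t \<tau>0 by auto
    assume tb: "t < b0"
    have t0: "0 < t" "t \<le> 1" using t \<tau>0 b by auto
    have Hge: "H zG * (gir * b0 ^ d) \<le> H (raise x t)"
      using H_ge_below_b0[OF pth(1)[OF t]] pth(3)[OF t] tb by simp
    \<comment> \<open>For a growing image \<open>N \<ge> m\<close> makes the numerator small, and
      \<open>y t ^ m \<le> y t\<close>. For a shrinking image \<open>M \<ge> m\<close> makes
      \<open>H\<close> small, so its lower bound gives \<open>gir * b0 ^ d \<le> t ^ m\<close> and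
      the right side is at least 1.\<close>
    have "y t ^ m \<le> t ^ m / (gir * b0 ^ d)"
    proof (cases "M < N")
      case True
      have "y t = hval d (raise x t) (num c) / (wt c * H (raise x t))"
        using lf t phi_kap(2)[OF pth(1)[OF t], of c] by (simp add: y_def)
      also have "\<dots> \<le> (wt c * (H zG * t ^ N)) / (wt c * (H zG * (gir * b0 ^ d)))"
        using lf t Hge Hz gir_pos(1) b0_bounds(1) t0 by (intro frac_le mult_left_mono mult_pos_pos) auto
      also have "\<dots> = t ^ N / (gir * b0 ^ d)" using Hz by simp
      also have "\<dots> \<le> t ^ m / (gir * b0 ^ d)"
        using t0 gB True by (intro divide_right_mono power_decreasing) (auto simp: m_def)
      finally have "y t \<le> t ^ m / (gir * b0 ^ d)" .
      moreover have "y t ^ m \<le> y t ^ 1" using y1[OF t] m by (intro power_decreasing) auto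
      ultimately show ?thesis by simp
    next
      case False
      have "H zG * (gir * b0 ^ d) \<le> H zG * t ^ M" using Hge lf t by (meson order_trans)
      then have "gir * b0 ^ d \<le> t ^ M" using Hz by simp
      also have "\<dots> \<le> t ^ m" using t0 False by (intro power_decreasing) (auto simp: m_def)
      finally have "1 \<le> t ^ m / (gir * b0 ^ d)" using gB by simp
      moreover have "y t ^ m \<le> 1" using y1[OF t] by (intro power_le_one) auto
      ultimately show ?thesis by simp
    qed
    then have "y t ^ m / t ^ m \<le> t ^ m / (gir * b0 ^ d) / t ^ m" using t0 by (intro divide_right_mono) auto
    then show "(y t / t) ^ m \<le> 1 / (gir * b0 ^ d)" using t0 by (simp add: power_divide)
  qed
  have "berk_d absK (phi (raise x s)) (phi (raise x t)) \<le> LB * (t - s)" if st: "\<tau> < s" "s < t" "t < b" for s t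
  proof -
    have s0: "0 < s" "0 < t" "s < b" "\<tau> < t" using st \<tau>0 by auto
    obtain k where k: "m = Suc k" using m(1) by (metis Suc_le_D One_nat_def)
    have pd: "t ^ m - s ^ m \<le> real m * t ^ k * (t - s)"
      using power_diff_le_linear[of s t k] s0 st unfolding k by simp
    have pm: "s ^ m \<le> t ^ m" using s0 st by (intro power_mono) auto
    show ?thesis
    proof (cases "M < N")
      case True
      then have yy: "y r = K * r ^ m" if "0 < r" for r
        using power_quotient_eq(1)[OF that True] by (simp add: y_def m_def)
      have "\<bar>y t - y s\<bar> = K * (t ^ m - s ^ m)" using pm K s0 by (simp add: yy right_diff_distrib)
      also have "\<dots> \<le> K * (real m * t ^ k * (t - s))" using pd K by (intro mult_left_mono) auto
      also have "\<dots> = real m * (y t / t) * (t - s)" using s0 by (simp add: yy k)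
      also have "\<dots> \<le> LB * (t - s)" using slope[OF s0(4) st(3)] st by (intro mult_right_mono) auto
      finally show ?thesis using dist[OF st] by simp
    next
      case False
      then have NM': "N < M" using NM by simp
      then have yy: "y r = K / r ^ m" if "0 < r" for r
        using power_quotient_eq(2)[OF that NM'] by (simp add: y_def m_def)
      have "y t \<le> y s" using pm K s0 by (simp add: yy divide_left_mono)
      then have "\<bar>y t - y s\<bar> = K / s ^ m - K / t ^ m" using s0 by (simp add: yy)
      also have "\<dots> = K * (t ^ m - s ^ m) / (s ^ m * t ^ m)" using s0 by (simp add: field_simps)
      also have "\<dots> \<le> K * (real m * t ^ k * (t - s)) / (s ^ m * t ^ m)"
        using pd K s0 by (intro divide_right_mono mult_left_mono) auto
      also have "\<dots> = K * real m * (t - s) / (s ^ m * t)" using s0 by (simp add: k)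
      \<comment> \<open>A negative power is steepest at the smaller parameter, so the slope at
        \<open>s\<close> is the one to use.\<close>
      also have "\<dots> \<le> K * real m * (t - s) / (s ^ m * s)"
        using s0 st K by (intro divide_left_mono mult_left_mono mult_nonneg_nonneg mult_pos_pos) auto
      also have "\<dots> = real m * (y s / s) * (t - s)" using s0 by (simp add: yy)
      also have "\<dots> \<le> LB * (t - s)" using slope[OF st(1) s0(3)] st by (intro mult_right_mono) auto
      finally show ?thesis using dist[OF st] by simp
    qed
  qed
  then show ?thesis using b(1) by blast
qed

lemma Lipschitz_along_path:
  assumes x: "x \<in> P1Berk absK" and z: "z \<in> P1Berk absK" and xz: "berk_leG x z"
  shows "berk_d absK (phi x) (phi z) \<le> LB * (diam_G z - diam_G x)"
proof -
  define D where "D s t = berk_d absK (phi (raise x s)) (phi (raise x t))" for s t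
  obtain C where C: "C \<ge> 0"
    "\<forall>x\<in>P1Berk absK. \<forall>w\<in>P1Berk absK. \<forall>e. berk_leG x w \<longrightarrow> (\<forall>c. kap w c \<le> kap x c + e) \<longrightarrow>
       (\<forall>c. \<bar>kap (phi w) c - kap (phi x) c\<bar> \<le> C * e)"
    using phi_kap_perturb by blast
  have xz_diam: "diam_G x \<le> diam_G z"
    using diam_le_kap[OF x] xz by (intro diam_greatest[OF z]) (meson le_funD order_trans)
  have "D (diam_G x) (diam_G z) \<le> LB * (diam_G z - diam_G x)"
  proof (rule right_local_Lipschitz)
    fix r s t assume *: "diam_G x \<le> r" "r \<le> s" "s \<le> t" "t \<le> diam_G z"
    then have "r \<le> 1" "s \<le> 1" "t \<le> 1" using diam_le_1[OF z] by auto
    then show "D r t \<le> D r s + D s t"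
      unfolding D_def using * by (intro berk_d_triangle phi_kap(1) raise(1)[OF x]) (use diam_nonneg[OF x] in auto)
  next
    fix s t assume *: "diam_G x \<le> s" "s \<le> t" "t \<le> diam_G z"
    then have t1: "t \<le> 1" using diam_le_1[OF z] by simp
    note r = raise_mono[OF x *(1,2) t1]
    have "berk_d absK (phi (raise x s)) (phi (raise x t)) \<le> 2 * (C * (t - s))"
    proof (rule berk_d_le_of_kap[OF phi_kap(1)[OF r(1)] phi_kap(1)[OF r(2)]])
      fix c
      show "\<bar>kap (phi (raise x s)) c - kap (phi (raise x t)) c\<bar> \<le> C * (t - s)"
        using C(2)[rule_format, OF r(1-3) r(4), of c] by (simp add: abs_minus_commute)
    qed
    then show "D s t \<le> 2 * C * (t - s)" by (simp add: D_def)
  next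
    fix \<tau> assume "diam_G x < \<tau>" "\<tau> < diam_G z"
    then show "\<exists>e>\<tau>. \<forall>s t. \<tau> < s \<longrightarrow> s < t \<longrightarrow> t < e \<longrightarrow> D s t \<le> LB * (t - s)"
      unfolding D_def using local_Lipschitz[OF x] diam_le_1[OF z] by simp
  qed (use C LB_nonneg xz_diam in auto)
  moreover have "raise x (diam_G x) = x" "raise x (diam_G z) = z"
    using raise_eq[OF x x] raise_eq[OF x z xz] by simp_all
  ultimately show ?thesis by (simp add: D_def)
qed

text \<open>\<open>berk_d\<close> is the sum of the two increases of diameter up to the join, so the
  bound along paths adds up on the two legs.\<close>

lemma Lipschitz:
  assumes x: "x \<in> P1Berk absK" and y: "y \<in> P1Berk absK"
  shows "berk_d absK (phi x) (phi y) \<le> LB * berk_d absK x y"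
proof -
  define z where "z = join_G absK x y"
  have z: "z \<in> P1Berk absK" "berk_leG x z" "berk_leG y z"
    using join_G_kap[OF x y] by (auto simp: z_def le_fun_def)
  have "berk_d absK (phi x) (phi y) \<le> berk_d absK (phi x) (phi z) + berk_d absK (phi y) (phi z)"
    using berk_d_triangle[OF phi_kap(1)[OF x] phi_kap(1)[OF z(1)] phi_kap(1)[OF y]]
      berk_d_commute[OF phi_kap(1)[OF y] phi_kap(1)[OF z(1)]] by simp
  also have "\<dots> \<le> LB * (diam_G z - diam_G x) + LB * (diam_G z - diam_G y)"
    by (intro add_mono Lipschitz_along_path x y z)
  also have "\<dots> = LB * berk_d absK x y" by (simp add: berk_d_def z_def algebra_simps)
  finally show ?thesis .
qed

lemma Lip_Berk_le: "Lip_Berk absK P Q \<le> ereal LB"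
  unfolding Lip_Berk_def
proof (rule SUP_least, clarsimp)
  fix x y assume "x \<in> P1Berk absK" "y \<in> P1Berk absK" "x \<noteq> y"
  then show "berk_d absK (phi x) (phi y) / berk_d absK x y \<le> LB"
    using Lipschitz berk_d_pos by (simp add: pos_divide_le_eq)
qed

end

theorem theorem2:
  fixes absK :: "'a::field \<Rightarrow> real" and P Q :: "'a poly" and d :: nat
  assumes "nonarch_acf absK"
    and "coprime P Q" and "Q \<noteq> 0"
    and "d = max (degree P) (degree Q)" and "d \<ge> 1"
  shows "Lip_Berk absK P Q \<le>
    ereal (max (1 / (GIR absK P Q * B0 absK P Q ^ d))
               (real d / (GIR absK P Q powr (1 / real d) * B0 absK P Q)))"
proof -
  interpret rational_map absK P Q d
    using assms by unfold_locales
  show ?thesis using Lip_Berk_le unfolding LB_def .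
qed

end
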